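(* Let $n\le r\le 2n$. Then $\lambda_j(\Sigma_r)=(-\infty,\lambda_j(\Lambda_D)]$ for every $1\le j\le 2n-r$, and $\lambda_j(\Sigma_r)=[\lambda_{j-(2n-r)}(\Lambda_D),\lambda_j(\Lambda_D)]$ for every $j>2n-r$. Here $\lambda_j(\Sigma_r)=\{\lambda_j(\Lambda):\Lambda\in\Sigma_r\}$.
   Context: Setting. Let $n\ge1$, $T>0$, $P,Q\in H^1([0,T],L(n))$, $R\in C([0,T],L(n))$, where $L(n)$ is the set of real $n\times n$ matrices; $P(t),R(t)$ are symmetric and $P(t)$ is positive definite for all $t\in[0,T]$. For $x:[0,T]\to\mathbf C^n$ put $y=P\dot x+Qx$ and $z=(y^T,x^T)^T$. Let $\mathcal Ax=-\frac{d}{dt}(P\dot x+Qx)+Q^T\dot x+Rx$. Let $J_n=\begin{bmatrix}0&-I_n\\ I_n&0\end{bmatrix}$, $\omega_n(u,v)=\langle J_nu,v\rangle$ on $\mathbf C^{2n}$ (standard Hermitian product), and $(\mathcal V,\Omega)=(\mathbf C^{2n}\oplus\mathbf C^{2n},-\omega_n\oplus\omega_n)$. $\mathrm{Lag}(\mathcal V,\Omega)$ is the set of complex subspaces $\Lambda\subset\mathcal V$ with $\Omega|_\Lambda=0$ and $\dim_{\mathbf C}\Lambda=2n$. Vectors of $\mathcal V$ are written $(z(0),z(T))$ with $z(0)=(y(0),x(0))$, $z(T)=(y(T),x(T))$; the Dirichlet condition is $\Lambda_D=\{x(0)=x(T)=0\}$. For $\Lambda\in\mathrm{Lag}(\mathcal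 V,\Omega)$, $\mathcal A_\Lambda$ is the self-adjoint operator on $L^2([0,T],\mathbf C^n)$ acting as $\mathcal A$ with domain $\{x\in H^2([0,T],\mathbf C^n):(z(0),z(T))\in\Lambda\}$. Its spectrum is bounded below and consists of discrete eigenvalues, $\lambda_1(\Lambda)\le\lambda_2(\Lambda)\le\cdots$, counted with multiplicity. For $0\le r\le2n$, the $r$-th layer is $\Sigma_r=\{\Lambda\in\mathrm{Lag}(\mathcal V,\Omega):\dim(\Lambda\cap\Lambda_D)=r\}$. *)

theory Defs
  imports "HOL-Analysis.Analysis" "HOL-Library.Function_Algebras"
begin

section \<open>Sobolev functions on a compact interval\<close>

definition L2 :: "real \<Rightarrow> (real \<Rightarrow> 'a::euclidean_space) \<Rightarrow> bool" where
  "L2 T g \<longleftrightarrow> g \<in> borel_measurable (lebesgue_on {0..T}) \<and>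
     integrable (lebesgue_on {0..T}) (\<lambda>t. (norm (g t))\<^sup>2)"

text \<open>Sobolev functions are represented by their continuous representatives, so that
  their values at every point of \<open>[0,T]\<close>, in particular at the end points, make sense:
  \<open>f\<close> is absolutely continuous with weak derivative \<open>g\<close> in \<open>L\<^sup>2\<close>.\<close>

definition has_weak_deriv ::
    "real \<Rightarrow> (real \<Rightarrow> 'a::euclidean_space) \<Rightarrow> (real \<Rightarrow> 'a) \<Rightarrow> bool" where
  "has_weak_deriv T f g \<longleftrightarrow>
     L2 T g \<and> (\<forall>t\<in>{0..T}. (g has_integral (f t - f 0)) {0..t})"

definition H1 :: "real \<Rightarrow> (real \<Rightarrow> 'a::euclidean_space) \<Rightarrow> bool" where
  "H1 T f \<longleftrightarrow> (\<exists>g. has_weak_deriv T f g)"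

definition H2 :: "real \<Rightarrow> (real \<Rightarrow> 'a::euclidean_space) \<Rightarrow> bool" where
  "H2 T f \<longleftrightarrow> (\<exists>g. has_weak_deriv T f g \<and> H1 T g)"

section \<open>The Hermitian symplectic space of boundary values\<close>

text \<open>\<open>C\<^sup>2\<^sup>n\<close> is \<open>complex ^ ('n + 'n)\<close>, and \<open>C\<^sup>2\<^sup>n \<oplus> C\<^sup>2\<^sup>n\<close> is
  \<open>complex ^ (('n + 'n) + ('n + 'n))\<close>, so that \<open>vec.subspace\<close> and \<open>vec.dim\<close> are the
  complex notions.  The first summand of the index type is the first block.\<close>

definition vjoin :: "'a ^ 'm \<Rightarrow> 'a ^ 'k \<Rightarrow> 'a ^ ('m::finite + 'k::finite)" where
  "vjoin u v = (\<chi> i. case i of Inl a \<Rightarrow> u $ a | Inr b \<Rightarrow> v $ b)"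

definition vfst :: "'a ^ ('m::finite + 'k::finite) \<Rightarrow> 'a ^ 'm" where
  "vfst w = (\<chi> a. w $ Inl a)"

definition vsnd :: "'a ^ ('m::finite + 'k::finite) \<Rightarrow> 'a ^ 'k" where
  "vsnd w = (\<chi> b. w $ Inr b)"

definition herm :: "complex ^ 'm \<Rightarrow> complex ^ 'm \<Rightarrow> complex" where
  "herm u v = (\<Sum>i\<in>UNIV. u $ i * cnj (v $ i))"

definition Jmat :: "complex ^ ('n::finite + 'n) ^ ('n::finite + 'n)" where
  "Jmat = (\<chi> i j. case (i, j) of
      (Inl a, Inr b) \<Rightarrow> if a = b then - 1 else 0
    | (Inr a, Inl b) \<Rightarrow> if a = b then 1 else 0
    | _ \<Rightarrow> 0)"

definition omega :: "complex ^ ('n::finite + 'n) \<Rightarrow> complex ^ ('n::finite + 'n) \<Rightarrow> complex" where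
  "omega u v = herm (Jmat *v u) v"

definition Omega ::
    "complex ^ (('n::finite + 'n) + ('n + 'n)) \<Rightarrow> complex ^ (('n::finite + 'n) + ('n + 'n)) \<Rightarrow> complex" where
  "Omega u v = - omega (vfst u) (vfst v) + omega (vsnd u) (vsnd v)"

definition Lag :: "(complex ^ (('n::finite + 'n) + ('n + 'n))) set set" where
  "Lag = {\<Lambda>. vec.subspace \<Lambda> \<and> (\<forall>u\<in>\<Lambda>. \<forall>v\<in>\<Lambda>. Omega u v = 0) \<and>
              vec.dim \<Lambda> = 2 * CARD('n)}"

text \<open>A boundary vector is \<open>((y(0), x(0)), (y(T), x(T)))\<close>.\<close>

definition Dirichlet :: "(complex ^ (('n::finite + 'n) + ('n + 'n))) set" where
  "Dirichlet = {w. vsnd (vfst w) = 0 \<and> vsnd (vsnd w) = 0}"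

definition layer :: "nat \<Rightarrow> (complex ^ (('n::finite + 'n) + ('n + 'n))) set set" where
  "layer r = {\<Lambda> \<in> Lag. vec.dim (\<Lambda> \<inter> Dirichlet) = r}"

section \<open>The Sturm--Liouville operator and its eigenvalues\<close>

abbreviation cmat :: "real ^ 'n ^ 'm \<Rightarrow> complex ^ 'n ^ 'm" where
  "cmat A \<equiv> map_matrix complex_of_real A"

text \<open>For \<open>x\<close> in \<open>H\<^sup>2\<close> the first derivative exists classically at every point of \<open>[0,T]\<close>,
  one-sidedly at the end points.\<close>

definition xdot :: "real \<Rightarrow> (real \<Rightarrow> complex ^ 'n) \<Rightarrow> real \<Rightarrow> complex ^ 'n" where
  "xdot T x t = vector_derivative x (at t within {0..T})"

definition quasi_deriv :: "real \<Rightarrow> (real \<Rightarrow> real ^ 'n ^ 'n) \<Rightarrow> (real \<Rightarrow> real ^ 'n ^ 'n) \<Rightarrow>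
    (real \<Rightarrow> complex ^ 'n) \<Rightarrow> real \<Rightarrow> complex ^ 'n" where
  "quasi_deriv T P Q x t = cmat (P t) *v xdot T x t + cmat (Q t) *v x t"

definition phase :: "real \<Rightarrow> (real \<Rightarrow> real ^ 'n ^ 'n) \<Rightarrow> (real \<Rightarrow> real ^ 'n ^ 'n) \<Rightarrow>
    (real \<Rightarrow> complex ^ 'n) \<Rightarrow> real \<Rightarrow> complex ^ ('n::finite + 'n)" where
  "phase T P Q x t = vjoin (quasi_deriv T P Q x t) (x t)"

text \<open>The operator takes values in \<open>L\<^sup>2\<close>, that is, in classes of functions modulo equality
  almost everywhere; \<open>SL_maps T P Q R x f\<close> says that \<open>f\<close> represents the image of \<open>x\<close>.\<close>

definition SL_maps :: "real \<Rightarrow> (real \<Rightarrow> real ^ 'n ^ 'n) \<Rightarrow> (real \<Rightarrow> real ^ 'n ^ 'n) \<Rightarrow>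
    (real \<Rightarrow> real ^ 'n ^ 'n) \<Rightarrow> (real \<Rightarrow> complex ^ 'n) \<Rightarrow> (real \<Rightarrow> complex ^ 'n) \<Rightarrow> bool" where
  "SL_maps T P Q R x f \<longleftrightarrow>
     (\<exists>g. has_weak_deriv T (quasi_deriv T P Q x) g \<and>
          (AE t in lebesgue_on {0..T}.
             f t = - g t + cmat (transpose (Q t)) *v xdot T x t + cmat (R t) *v x t))"

text \<open>A function on \<open>[0,T]\<close> is extended by zero to the real line, so that it is determined
  by its values on \<open>[0,T]\<close>; otherwise eigenspaces would not have the right dimension.\<close>

definition SL_dom :: "real \<Rightarrow> (real \<Rightarrow> real ^ 'n ^ 'n) \<Rightarrow> (real \<Rightarrow> real ^ 'n ^ 'n) \<Rightarrow>
    (complex ^ (('n::finite + 'n) + ('n + 'n))) set \<Rightarrow> (real \<Rightarrow> complex ^ 'n) set" where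
  "SL_dom T P Q \<Lambda> = {x. H2 T x \<and> (\<forall>t. t \<notin> {0..T} \<longrightarrow> x t = 0) \<and>
                        vjoin (phase T P Q x 0) (phase T P Q x T) \<in> \<Lambda>}"

definition eigenspace :: "real \<Rightarrow> (real \<Rightarrow> real ^ 'n ^ 'n) \<Rightarrow> (real \<Rightarrow> real ^ 'n ^ 'n) \<Rightarrow>
    (real \<Rightarrow> real ^ 'n ^ 'n) \<Rightarrow> (complex ^ (('n::finite + 'n) + ('n + 'n))) set \<Rightarrow> real \<Rightarrow>
    (real \<Rightarrow> complex ^ 'n) set" where
  "eigenspace T P Q R \<Lambda> \<mu> =
     {x \<in> SL_dom T P Q \<Lambda>. SL_maps T P Q R x (\<lambda>t. complex_of_real \<mu> *s x t)}"

global_interpretation cfun: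
  vector_space "\<lambda>(c::complex) (x::real \<Rightarrow> complex ^ 'n) t. c *s x t"
  by unfold_locales
     (simp_all add: fun_eq_iff vec_eq_iff algebra_simps)

definition multiplicity_at :: "real \<Rightarrow> (real \<Rightarrow> real ^ 'n ^ 'n) \<Rightarrow> (real \<Rightarrow> real ^ 'n ^ 'n) \<Rightarrow>
    (real \<Rightarrow> real ^ 'n ^ 'n) \<Rightarrow> (complex ^ (('n::finite + 'n) + ('n + 'n))) set \<Rightarrow> real \<Rightarrow> nat" where
  "multiplicity_at T P Q R \<Lambda> \<mu> = cfun.dim (eigenspace T P Q R \<Lambda> \<mu>)"

text \<open>The nondecreasing enumeration of the eigenvalues in which every real number occurs as
  often as its multiplicity says (so a number that is not an eigenvalue does not occur).
  A self-adjoint operator has only real eigenvalues, and their algebraic and geometric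
  multiplicities agree.  The sequence starts at index \<open>0\<close>, hence the shift in
  \<open>eigval\<close>, which is meant for \<open>j \<ge> 1\<close>.\<close>

definition enumerates_eigvals :: "real \<Rightarrow> (real \<Rightarrow> real ^ 'n ^ 'n) \<Rightarrow>
    (real \<Rightarrow> real ^ 'n ^ 'n) \<Rightarrow> (real \<Rightarrow> real ^ 'n ^ 'n) \<Rightarrow>
    (complex ^ (('n::finite + 'n) + ('n + 'n))) set \<Rightarrow> (nat \<Rightarrow> real) \<Rightarrow> bool" where
  "enumerates_eigvals T P Q R \<Lambda> l \<longleftrightarrow> mono l \<and>
     (\<forall>\<mu>. finite {k. l k = \<mu>} \<and> card {k. l k = \<mu>} = multiplicity_at T P Q R \<Lambda> \<mu>)"

definition eigval :: "real \<Rightarrow> (real \<Rightarrow> real ^ 'n ^ 'n) \<Rightarrow> (real \<Rightarrow> real ^ 'n ^ 'n) \<Rightarrow>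
    (real \<Rightarrow> real ^ 'n ^ 'n) \<Rightarrow> nat \<Rightarrow> (complex ^ (('n::finite + 'n) + ('n + 'n))) set \<Rightarrow> real" where
  "eigval T P Q R j \<Lambda> = (THE l. enumerates_eigvals T P Q R \<Lambda> l) (j - 1)"

end

(* Below both spectra the resolvents K_L and K_D (D for Dirichlet) are compact positive
   operators on the continuous functions with the L^2 inner product. By Green's formula
   K_L - K_D is positive semidefinite, and its rank is at most d = dim L - dim (L \<inter> D) = 2n - r.
   Hence the counting functions of the eigenvalues up to c satisfy N_D \<le> N_L \<le> N_D + d.
   Conversely let c be any real number and G the Lagrangian subspace of boundary values of
   all solutions at c, so that the multiplicity of c for L is dim (G \<inter> L). As d \<le> n and
   dim (G \<inter> D) \<le> n, there is a d-dimensional U \<subseteq> G with U \<inter> D = 0. Then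
   L = U + (D \<inter> U^\<Omega>) lies in the r-th layer, and c has for L at least d more units of
   multiplicity than for D. Together with the interlacing this makes c the j-th eigenvalue
   of L exactly for the j allowed by the interlacing. *)

theory Submission
  imports Defs "HOL-Complex_Analysis.Great_Picard"
begin

text \<open>No space is completed: only eigenvectors are counted, and \<open>Arzela_Ascoli\<close>
  returns the needed limits as continuous functions. For a continuous right-hand side the equation
  is a classical first-order system in (y, x) with continuous coefficients; that P and Q are in H^1
  enters when such a solution is shown to lie in H^2, as the domain of the operator demands. A shift
  below both spectra exists because the boundary form on a Lagrangian subspace is bounded by a
  multiple of |x(0)|^2 + |x(T)|^2, which the energy dominates once the shift is negative enough.
  Gaining d units at the single point c suffices for this reason. Write N(c-) for the count strictly
  below c. Interlacing gives N_D(c-) \<le> N_L(c-) and N_L(c) \<le> N_D(c) + d, so a jump exceeding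
  the Dirichlet jump by d forces equality in both. Hence c is the j-th eigenvalue of L iff N_D(c-) <
  j \<le> N_D(c) + d, that is, iff c is at most the j-th and at least the (j-d)-th Dirichlet
  eigenvalue; for j \<le> d the second condition is empty. This covers both cases of the
  theorem.\<close>

section \<open>Linear algebra\<close>


context vector_space
begin

text \<open>The ambient function space is infinite dimensional and the functionals are linear only
  on part of it, so rank-nullity takes the form of a count on a finite independent set.\<close>

lemma independent_kernel_step:
  fixes l :: "'b \<Rightarrow> 'a"
  assumes C: "independent C" "finite C"
    and add: "\<And>x y. x \<in> span C \<Longrightarrow> y \<in> span C \<Longrightarrow> l (x + y) = l x + l y"
    and scl: "\<And>c x. x \<in> span C \<Longrightarrow> l (scale c x) = c * l x"
  shows "\<exists>C'. independent C' \<and> finite C' \<and> C' \<subseteq> span C \<and> card C \<le> Suc (card C') \<and>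
           (\<forall>c\<in>C'. l c = 0)"
proof (cases "\<forall>c\<in>C. l c = 0")
  case True
  then show ?thesis using C span_superset by (intro exI[of _ C]) auto
next
  case False
  then obtain c0 where c0: "c0 \<in> C" "l c0 \<noteq> 0" by blast
  \<comment> \<open>Each vector is moved into the kernel along \<open>c0\<close>; \<open>c0\<close>
    itself would go to 0 and is dropped.\<close>
  define g where "g c = c + scale (- (l c / l c0)) c0" for c
  define C' where "C' = g ` (C - {c0})"
  have fin: "finite C'" using C C'_def by auto
  have c0s: "c0 \<in> span C" using c0 span_base by blast
  have sub: "C' \<subseteq> span C"
    using span_add[OF span_base span_scale[OF c0s]] unfolding C'_def g_def by blast
  have zero: "l c = 0" if c: "c \<in> C'" for c
  proof -
    obtain d where d: "d \<in> C" "c = g d" using c C'_def by auto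
    have "l c = l d + (- (l d / l c0)) * l c0"
      unfolding d g_def by (subst add[OF span_base[OF d(1)] span_scale[OF c0s]]) (simp only: scl[OF c0s])
    then show ?thesis using c0 by simp
  qed
  have "C \<subseteq> span (insert c0 C')"
  proof
    fix c assume c: "c \<in> C"
    show "c \<in> span (insert c0 C')"
    proof (cases "c = c0")
      case True
      then show ?thesis using span_base[of c0 "insert c0 C'"] by blast
    next
      case False
      then have "g c \<in> span (insert c0 C')" using c
        unfolding C'_def by (intro span_base) blast
      moreover have "scale (l c / l c0) c0 \<in> span (insert c0 C')"
        by (intro span_scale span_base) blast
      ultimately have "g c + scale (l c / l c0) c0 \<in> span (insert c0 C')" by (rule span_add)
      moreover have "g c + scale (l c / l c0) c0 = c"
        unfolding g_def by simp
      ultimately show ?thesis by simp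
    qed
  qed
  \<comment> \<open>\<open>insert c0 C'\<close> spans \<open>C\<close> and has at most
    \<open>card C\<close> elements, so its maximal independent subset \<open>A\<close> must be all
    of it. This makes \<open>C'\<close> independent without a computation.\<close>
  moreover obtain A where A: "A \<subseteq> insert c0 C'" "independent A" "insert c0 C' \<subseteq> span A"
    using maximal_independent_subset[of "insert c0 C'"] by blast
  ultimately have "C \<subseteq> span A"
    using span_minimal[OF A(3) subspace_span] by blast
  moreover have finA: "finite A" using A fin finite_subset by blast
  ultimately have "card C \<le> card A" using independent_span_bound C by blast
  also have "card A \<le> card (insert c0 C')" using A fin by (simp add: card_mono)
  finally have c1: "card C \<le> card (insert c0 C')" .
  have "card C' \<le> card (C - {c0})" unfolding C'_def using C by (simp add: card_image_le)
  then have c2: "Suc (card C') \<le> card C" using card_Suc_Diff1[OF C(2) c0(1)] by simp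
  then have "card (insert c0 C') \<le> card A"
    using \<open>card C \<le> card A\<close> fin by (simp add: card_insert_if)
  then have "A = insert c0 C'" using A fin by (simp add: card_seteq)
  then have "independent C'" using A by (metis independent_mono subset_insertI)
  moreover have "card C \<le> Suc (card C')" using c1 fin by (simp add: card_insert_if split: if_splits)
  ultimately show ?thesis using fin sub zero by blast
qed

text \<open>Each functional costs at most one dimension. This is the source of every rank bound
  below, for matrices and for operators alike.\<close>

lemma independent_kernel:
  fixes l :: "'i \<Rightarrow> 'b \<Rightarrow> 'a"
  assumes I: "finite I" and C: "independent C" "finite C"
    and add: "\<And>i x y. i \<in> I \<Longrightarrow> x \<in> span C \<Longrightarrow> y \<in> span C \<Longrightarrow> l i (x + y) = l i x + l i y"
    and scl: "\<And>i c x. i \<in> I \<Longrightarrow> x \<in> span C \<Longrightarrow> l i (scale c x) = c * l i x"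
  shows "\<exists>C'. independent C' \<and> finite C' \<and> C' \<subseteq> span C \<and> card C \<le> card C' + card I \<and>
           (\<forall>i\<in>I. \<forall>c\<in>C'. l i c = 0)"
  using I add scl
proof (induction I rule: finite_induct)
  case empty
  then show ?case using C span_superset by (intro exI[of _ C]) auto
next
  case (insert i I)
  then obtain C1 where C1: "independent C1" "finite C1" "C1 \<subseteq> span C" "card C \<le> card C1 + card I"
    "\<forall>i\<in>I. \<forall>c\<in>C1. l i c = 0"
    using insert.IH insert.prems by (metis (no_types, lifting) insert_iff)
  have s1: "span C1 \<subseteq> span C" using C1(3) by (metis span_mono span_span)
  obtain C2 where C2: "independent C2" "finite C2" "C2 \<subseteq> span C1" "card C1 \<le> Suc (card C2)"
    "\<forall>c\<in>C2. l i c = 0"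
    using independent_kernel_step[OF C1(1,2), of "l i"] insert.prems s1 by blast
  \<comment> \<open>\<open>C2\<close> lies only in the span of \<open>C1\<close>, so the vanishing
    of the earlier functionals has to be carried from \<open>C1\<close> to its span.\<close>
  have "l k c = 0" if "k \<in> I" "c \<in> C2" for k c
  proof -
    have "c \<in> span C1" using C2 that by blast
    then have "c \<in> span C1 \<and> l k c = 0"
    proof (induction rule: span_induct_alt)
      case base
      have "l k (scale 0 0) = 0 * l k 0" using insert.prems that span_zero by blast
      then show ?case by (simp add: span_zero)
    next
      case (step a x y)
      have "x \<in> span C" "y \<in> span C" using step s1 span_base[of x C1] by auto
      then show ?case using step insert.prems(1)[of k "scale a x" y] insert.prems(2)[of k x a] that C1
        by (auto simp: span_base span_add span_scale)
    qed
    then show ?thesis by simp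
  qed
  then show ?case using C1 C2 insert s1
    by (intro exI[of _ C2]) auto
qed

end

text \<open>Boundary values depend linearly on a function only among solutions, so \<open>f\<close>
  is linear on \<open>S\<close> alone. The linear map \<open>g\<close> extended from the basis
  \<open>B\<close> agrees with \<open>f\<close> on the span and carries the standard facts
  over.\<close>

lemma (in vector_space_pair) independent_image_on:
  assumes S: "vs1.subspace S" and B: "B \<subseteq> S" "vs1.independent B"
    and add: "\<And>x y. x \<in> S \<Longrightarrow> y \<in> S \<Longrightarrow> f (x + y) = f x + f y"
    and scl: "\<And>c x. x \<in> S \<Longrightarrow> f (s1 c x) = s2 c (f x)"
    and ker: "\<And>x. x \<in> S \<Longrightarrow> f x = 0 \<Longrightarrow> x = 0"
  shows "vs2.independent (f ` B)" "inj_on f B" "f ` vs1.span B = vs2.span (f ` B)"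
proof -
  define g where "g = construct B f"
  have lin: "Vector_Spaces.linear s1 s2 g" unfolding g_def using B by (simp add: linear_construct)
  have sp: "vs1.span B \<subseteq> S" using B S by (simp add: vs1.span_minimal)
  have eqB: "g b = f b" if "b \<in> B" for b unfolding g_def using B that by (simp add: construct_basis)
  have f0: "f 0 = 0" using scl[of 0 0] S by (simp add: vs1.subspace_0)
  have eq: "g x = f x" if "x \<in> vs1.span B" for x
  proof -
    have "x \<in> vs1.span B \<and> g x = f x"
      using that
    proof (induction rule: vs1.span_induct_alt)
      case base
      show ?case using linear_0[OF lin] f0 vs1.span_zero by simp
    next
      case (step c x y)
      then have y: "y \<in> vs1.span B" "y \<in> S" "g y = f y" and x: "x \<in> vs1.span B" "x \<in> S" "g x = f x"
        using sp B(1) eqB vs1.span_base by auto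
      have "g (s1 c x + y) = s2 c (f x) + f y"
        by (simp add: linear_add[OF lin] linear_scale[OF lin] x y)
      also have "\<dots> = f (s1 c x + y)"
        using add[OF vs1.subspace_scale[OF S x(2)] y(2)] scl[OF x(2)] by simp
      finally show ?case using vs1.span_add[OF vs1.span_scale[OF x(1)] y(1)] by simp
    qed
    then show ?thesis by simp
  qed
  have inj: "inj_on g (vs1.span B)"
  proof (rule inj_onI)
    fix x y assume xy: "x \<in> vs1.span B" "y \<in> vs1.span B" "g x = g y"
    then have "g (x - y) = 0" by (simp add: linear_diff[OF lin])
    moreover have d: "x - y \<in> vs1.span B" using xy vs1.span_diff by blast
    ultimately have "f (x - y) = 0" using eq by simp
    then have "x - y = 0" using ker sp d by blast
    then show "x = y" by simp
  qed
  show "inj_on f B"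
    using inj eqB vs1.span_superset unfolding inj_on_def by (metis subset_eq)
  have im: "g ` B = f ` B" using eqB by simp
  show "vs2.independent (f ` B)"
    using linear_independent_injective_image[OF lin B(2) inj] im by simp
  have "f ` vs1.span B = g ` vs1.span B" using eq by simp
  also have "\<dots> = vs2.span (f ` B)" using linear_span_image[OF lin, of B] im by simp
  finally show "f ` vs1.span B = vs2.span (f ` B)" .
qed

lemma (in vector_space_pair) dim_image_on:
  assumes S: "vs1.subspace S"
    and add: "\<And>x y. x \<in> S \<Longrightarrow> y \<in> S \<Longrightarrow> f (x + y) = f x + f y"
    and scl: "\<And>c x. x \<in> S \<Longrightarrow> f (s1 c x) = s2 c (f x)"
    and ker: "\<And>x. x \<in> S \<Longrightarrow> f x = 0 \<Longrightarrow> x = 0"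
  shows "vs2.dim (f ` S) = vs1.dim S"
proof -
  obtain B where B: "B \<subseteq> S" "vs1.independent B" "S \<subseteq> vs1.span B" "card B = vs1.dim S"
    by (rule vs1.basis_exists)
  have im: "vs2.independent (f ` B)" "inj_on f B" "f ` vs1.span B = vs2.span (f ` B)"
    by (rule independent_image_on[OF S B(1,2)]; simp add: add scl ker)+
  have "S = vs1.span B" using B S by (simp add: vs1.span_subspace)
  then have "f ` S = vs2.span (f ` B)" using im(3) by simp
  then have "vs2.dim (f ` S) = card (f ` B)" using im(1) by (simp add: vs2.dim_eq_card_independent)
  then show ?thesis using im(2) B(4) by (simp add: card_image)
qed

section \<open>Eigenvalue counts from Rayleigh quotients\<close>

section \<open>Compact positive operators on a pre-Hilbert space\<close>


text \<open>The form is kept apart from the operator because the locale is used a second time for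
  \<open>ip (K f) g\<close>, to which Cauchy-Schwarz is applied as well. The carrier
  \<open>H\<close> will be the functions that vanish outside the interval.\<close>

locale hermitian_form = vector_space scale
  for scale :: "complex \<Rightarrow> 'b::ab_group_add \<Rightarrow> 'b" +
  fixes H :: "'b set" and ip :: "'b \<Rightarrow> 'b \<Rightarrow> complex"
  assumes subspace_H: "subspace H"
    and ip_add: "f \<in> H \<Longrightarrow> g \<in> H \<Longrightarrow> h \<in> H \<Longrightarrow> ip (f + g) h = ip f h + ip g h"
    and ip_scale: "f \<in> H \<Longrightarrow> h \<in> H \<Longrightarrow> ip (scale c f) h = c * ip f h"
    and ip_sym: "f \<in> H \<Longrightarrow> g \<in> H \<Longrightarrow> ip g f = cnj (ip f g)"
    and ip_nonneg: "f \<in> H \<Longrightarrow> Re (ip f f) \<ge> 0"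
begin

lemma H_closed: "0 \<in> H" "f \<in> H \<Longrightarrow> g \<in> H \<Longrightarrow> f + g \<in> H" "f \<in> H \<Longrightarrow> scale c f \<in> H"
  "f \<in> H \<Longrightarrow> g \<in> H \<Longrightarrow> f - g \<in> H"
  using subspace_H by (simp_all add: subspace_0 subspace_add subspace_scale subspace_diff)

lemma ip_add_right: "f \<in> H \<Longrightarrow> g \<in> H \<Longrightarrow> h \<in> H \<Longrightarrow> ip h (f + g) = ip h f + ip h g"
  using ip_sym[of "f + g" h] ip_sym[of f h] ip_sym[of g h] by (simp add: H_closed ip_add)

lemma ip_scale_right: "f \<in> H \<Longrightarrow> h \<in> H \<Longrightarrow> ip h (scale c f) = cnj c * ip h f"
  using ip_sym[of "scale c f" h] ip_sym[of f h] by (simp add: H_closed ip_scale)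

lemma ip_zero: "h \<in> H \<Longrightarrow> ip 0 h = 0" "h \<in> H \<Longrightarrow> ip h 0 = 0"
  using ip_scale[of 0 h 0] ip_scale_right[of 0 h 0] H_closed(1) by simp_all

lemma ip_minus: "f \<in> H \<Longrightarrow> g \<in> H \<Longrightarrow> h \<in> H \<Longrightarrow> ip (f - g) h = ip f h - ip g h"
  "f \<in> H \<Longrightarrow> g \<in> H \<Longrightarrow> h \<in> H \<Longrightarrow> ip h (f - g) = ip h f - ip h g"
  using ip_add[of "f - g" g h] ip_add_right[of "f - g" g h] by (simp_all add: H_closed)

lemma ip_self: "f \<in> H \<Longrightarrow> ip f f = of_real (Re (ip f f))"
  using arg_cong[OF ip_sym[of f f], of Im] by (simp add: complex_eq_iff)

lemma ip_sum: "(\<And>i. i \<in> I \<Longrightarrow> f i \<in> H) \<Longrightarrow> h \<in> H \<Longrightarrow> ip (\<Sum>i\<in>I. f i) h = (\<Sum>i\<in>I. ip (f i) h)"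
proof (induction I rule: infinite_finite_induct)
  case (insert i I)
  have "(\<Sum>i\<in>I. f i) \<in> H" using insert subspace_H by (simp add: subspace_sum)
  then show ?case using insert by (simp add: ip_add)
qed (simp_all add: ip_zero)

lemma cauchy_schwarz:
  assumes f: "f \<in> H" and g: "g \<in> H"
  shows "(cmod (ip f g))\<^sup>2 \<le> Re (ip f f) * Re (ip g g)"
proof -
  define a b p where "a = Re (ip f f)" and "b = Re (ip g g)" and "p = cmod (ip f g)"
  have ge: "0 \<le> a - 2 * s * p\<^sup>2 + s\<^sup>2 * p\<^sup>2 * b" for s :: real
  proof -
    define c where "c = - of_real s * ip f g"
    have h: "scale c g \<in> H" using g H_closed by blast
    have "ip (f + scale c g) (f + scale c g) =
        ip f f + cnj c * ip f g + c * cnj (ip f g) + c * cnj c * ip g g"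
      using f g h by (simp add: ip_add ip_add_right ip_scale ip_scale_right H_closed ip_sym[of f g] algebra_simps)
    moreover have pp: "ip f g * cnj (ip f g) = of_real (p\<^sup>2)"
      unfolding p_def by (rule complex_norm_square[symmetric])
    moreover have "cnj c * ip f g = - of_real s * (ip f g * cnj (ip f g))"
      "c * cnj (ip f g) = - of_real s * (ip f g * cnj (ip f g))"
      "c * cnj c = of_real s * of_real s * (ip f g * cnj (ip f g))"
      by (simp_all add: c_def)
    moreover have "ip f f = of_real a" "ip g g = of_real b"
      unfolding a_def b_def by (rule ip_self, fact)+
    ultimately have "ip (f + scale c g) (f + scale c g) =
       of_real (a - 2 * s * p\<^sup>2 + s\<^sup>2 * p\<^sup>2 * b)"
      by (simp add: power2_eq_square[of s])
    then have "Re (ip (f + scale c g) (f + scale c g)) = a - 2 * s * p\<^sup>2 + s\<^sup>2 * p\<^sup>2 * b"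
      by (simp only: Re_complex_of_real)
    then show ?thesis using ip_nonneg[of "f + scale c g"] f h H_closed by simp
  qed
  have ab: "0 \<le> a" "0 \<le> b" using ip_nonneg f g a_def b_def by auto
  show ?thesis
  proof (cases "b = 0")
    case True
    have "p\<^sup>2 = 0"
    proof (rule ccontr)
      assume "p\<^sup>2 \<noteq> 0"
      \<comment> \<open>With b = 0 the expression is affine in s; this choice makes it -a -
        2.\<close>
      then show False using ge[of "(a + 1) / p\<^sup>2"] True ab by simp
    qed
    then show ?thesis using ab by (simp add: a_def b_def p_def)
  next
    case False
    \<comment> \<open>s = 1/b minimizes the quadratic polynomial in s.\<close>
    have "0 \<le> a - p\<^sup>2 / b" using ge[of "1 / b"] False by (simp add: power2_eq_square field_simps)
    then have "p\<^sup>2 \<le> a * b" using False ab by (simp add: field_simps)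
    then show ?thesis by (simp add: a_def b_def p_def)
  qed
qed

definition nrm :: "'b \<Rightarrow> real" where "nrm f = sqrt (Re (ip f f))"

lemma nrm_ge0: "f \<in> H \<Longrightarrow> 0 \<le> nrm f" by (simp add: nrm_def ip_nonneg)

lemma nrm_sq: "f \<in> H \<Longrightarrow> (nrm f)\<^sup>2 = Re (ip f f)" by (simp add: nrm_def ip_nonneg)

lemma cs_nrm: "f \<in> H \<Longrightarrow> g \<in> H \<Longrightarrow> cmod (ip f g) \<le> nrm f * nrm g"
  by (rule power2_le_imp_le) (simp_all add: cauchy_schwarz nrm_sq nrm_ge0 power_mult_distrib)

lemma nrm_scale: "f \<in> H \<Longrightarrow> nrm (scale c f) = cmod c * nrm f"
proof -
  assume f: "f \<in> H"
  have "ip (scale c f) (scale c f) = (c * cnj c) * ip f f"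
    using f by (simp add: ip_scale ip_scale_right H_closed)
  also have "\<dots> = of_real ((cmod c)\<^sup>2 * Re (ip f f))"
    unfolding of_real_mult ip_self[OF f, symmetric] complex_norm_square ..
  finally have "Re (ip (scale c f) (scale c f)) = (cmod c)\<^sup>2 * Re (ip f f)"
    by (simp only: Re_complex_of_real)
  then show ?thesis by (simp add: nrm_def real_sqrt_mult)
qed

lemma nrm_triangle: assumes "f \<in> H" "g \<in> H" shows "nrm (f + g) \<le> nrm f + nrm g"
proof (rule power2_le_imp_le)
  have "(nrm (f + g))\<^sup>2 = Re (ip f f) + Re (ip g g) + 2 * Re (ip f g)"
    using assms ip_sym[of f g] by (simp add: nrm_sq H_closed ip_add ip_add_right)
  also have "\<dots> \<le> (nrm f)\<^sup>2 + (nrm g)\<^sup>2 + 2 * (nrm f * nrm g)"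
    using assms cs_nrm[of f g] complex_Re_le_cmod[of "ip f g"] by (simp add: nrm_sq)
  finally show "(nrm (f + g))\<^sup>2 \<le> (nrm f + nrm g)\<^sup>2" by (simp add: power2_sum)
qed (simp add: assms nrm_ge0)

end

text \<open>\<open>H\<close> is not assumed complete, so compactness includes that the limit lies in
  \<open>H\<close>. Finite dimension of the eigenspaces is an assumption because a linear
  differential equation supplies it directly.\<close>

locale compact_positive = hermitian_form scale H ip
  for scale :: "complex \<Rightarrow> 'b::ab_group_add \<Rightarrow> 'b" and H ip +
  fixes K :: "'b \<Rightarrow> 'b"
  assumes ip_pos: "f \<in> H \<Longrightarrow> f \<noteq> 0 \<Longrightarrow> Re (ip f f) > 0"
    and K_H: "f \<in> H \<Longrightarrow> K f \<in> H"
    and K_add: "f \<in> H \<Longrightarrow> g \<in> H \<Longrightarrow> K (f + g) = K f + K g"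
    and K_scale: "f \<in> H \<Longrightarrow> K (scale c f) = scale c (K f)"
    and K_sym: "f \<in> H \<Longrightarrow> g \<in> H \<Longrightarrow> ip (K f) g = ip f (K g)"
    and K_pos: "f \<in> H \<Longrightarrow> f \<noteq> 0 \<Longrightarrow> Re (ip (K f) f) > 0"
    and K_contr: "f \<in> H \<Longrightarrow> Re (ip (K f) (K f)) \<le> Re (ip f f)"
    and K_compact: "(\<And>n. u n \<in> H) \<Longrightarrow> (\<And>n. Re (ip (u n) (u n)) \<le> 1) \<Longrightarrow>
      \<exists>v\<in>H. \<exists>s. strict_mono (s :: nat \<Rightarrow> nat) \<and>
        (\<lambda>n. Re (ip (K (u (s n)) - v) (K (u (s n)) - v))) \<longlonglongrightarrow> 0"
    and eig_finite_dim: "\<exists>B. finite B \<and> {f \<in> H. K f = scale (of_real \<kappa>) f} \<subseteq> span B"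
    and H_infinite_dim: "\<exists>C. C \<subseteq> H \<and> independent C \<and> finite C \<and> card C = N"
begin

definition Eig :: "real \<Rightarrow> 'b set" where
  "Eig \<kappa> = {f \<in> H. K f = scale (of_real \<kappa>) f}"

lemma nrm_zero_iff: "f \<in> H \<Longrightarrow> nrm f = 0 \<longleftrightarrow> f = 0"
  using ip_pos[of f] ip_zero(1)[of 0] H_closed(1) by (cases "f = 0") (auto simp: nrm_def)

lemma K_nrm: "f \<in> H \<Longrightarrow> nrm (K f) \<le> nrm f"
  by (simp add: nrm_def K_contr)

lemma K_diff: "f \<in> H \<Longrightarrow> g \<in> H \<Longrightarrow> K (f - g) = K f - K g"
  using K_add[of "f - g" g] by (simp add: H_closed)

lemma K0: "K 0 = 0" using K_scale[of 0 0] H_closed(1) by simp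

lemma compact_seq:
  assumes "\<And>n. u n \<in> H" "\<And>n. nrm (u n) \<le> 1"
  obtains v s where "v \<in> H" "strict_mono (s :: nat \<Rightarrow> nat)" "(\<lambda>n. nrm (K (u (s n)) - v)) \<longlonglongrightarrow> 0"
proof -
  have "Re (ip (u n) (u n)) \<le> 1" for n
    using assms(2)[of n] by (simp add: nrm_def)
  then obtain v s where v: "v \<in> H" "strict_mono (s :: nat \<Rightarrow> nat)"
    "(\<lambda>n. Re (ip (K (u (s n)) - v) (K (u (s n)) - v))) \<longlonglongrightarrow> 0"
    using K_compact[of u] assms(1) by blast
  have "(\<lambda>n. nrm (K (u (s n)) - v)) \<longlonglongrightarrow> 0"
    using tendsto_real_sqrt[OF v(3)] by (simp add: nrm_def)
  then show ?thesis using v that by blast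
qed

lemma psd_form: "hermitian_form scale H (\<lambda>f g. ip (K f) g)"
proof
  fix f g h c
  show "f \<in> H \<Longrightarrow> g \<in> H \<Longrightarrow> ip (K g) f = cnj (ip (K f) g)"
    using K_sym[of g f] ip_sym[of "K f" g] by (simp add: K_H)
  show "f \<in> H \<Longrightarrow> Re (ip (K f) f) \<ge> 0"
    using K_pos[of f] ip_zero K0 H_closed by (cases "f = 0") (auto simp: less_imp_le)
qed (simp_all add: subspace_H K_add K_scale ip_add ip_scale K_H)

definition perp :: "'b set \<Rightarrow> 'b set" where "perp S = {f \<in> H. \<forall>g\<in>S. ip f g = 0}"

lemma perp_closed:
  assumes "S \<subseteq> H" "f \<in> perp S"
  shows "f \<in> H" "scale c f \<in> perp S" "g \<in> perp S \<Longrightarrow> f + g \<in> perp S"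
    "(\<And>g. g \<in> S \<Longrightarrow> \<exists>c. K g = scale c g) \<Longrightarrow> K f \<in> perp S"
  using assms
     apply (auto simp: perp_def H_closed ip_scale ip_add subset_iff K_H)
  by (metis K_sym ip_scale_right mult_zero_right)

lemma perp_limit:
  assumes S: "S \<subseteq> H" and v: "v \<in> H" and u: "\<And>n. u n \<in> perp S"
    and lim: "(\<lambda>n. nrm (u n - v)) \<longlonglongrightarrow> 0"
  shows "v \<in> perp S"
  unfolding perp_def
proof (intro CollectI conjI ballI v)
  fix g assume g: "g \<in> S"
  have uH: "u n \<in> H" "ip (u n) g = 0" for n using u[of n] g by (auto simp: perp_def)
  have "cmod (ip v g) \<le> nrm (u n - v) * nrm g" for n
  proof -
    have "ip v g = - ip (u n - v) g" using uH g S v by (simp add: ip_minus subset_iff)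
    then show ?thesis using cs_nrm[of "u n - v" g] uH v g S by (simp add: H_closed subset_iff)
  qed
  moreover have "(\<lambda>n. nrm (u n - v) * nrm g) \<longlonglongrightarrow> 0" using tendsto_mult_left_zero[OF lim] .
  ultimately have "cmod (ip v g) \<le> 0"
    by (intro LIMSEQ_le_const[of _ 0]) auto
  then show "ip v g = 0" by simp
qed

text \<open>By the Cauchy--Schwarz inequality for the form \<open>\<langle>K f, g\<rangle>\<close>, a maximizing sequence of the
  Rayleigh quotient consists of approximate eigenvectors.\<close>

lemma eigenvector_in_perp:
  assumes S: "S \<subseteq> H" and SK: "\<And>g. g \<in> S \<Longrightarrow> \<exists>c. K g = scale c g"
    and f0: "f0 \<in> perp S" "f0 \<noteq> 0" and t: "0 < t" "t * Re (ip f0 f0) \<le> Re (ip (K f0) f0)"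
  shows "\<exists>\<kappa>\<ge>t. \<exists>u\<in>perp S. u \<noteq> 0 \<and> u \<in> Eig \<kappa>"
proof -
  interpret kf: hermitian_form scale H "\<lambda>f g. ip (K f) g" by (rule psd_form)
  define R where "R = {Re (ip (K f) f) |f. f \<in> perp S \<and> nrm f = 1}"
  have pH: "f \<in> H" if "f \<in> perp S" for f using that by (simp add: perp_def)
  define f1 where "f1 = scale (of_real (1 / nrm f0)) f0"
  have n0: "nrm f0 > 0" using f0 pH nrm_ge0 nrm_zero_iff by (metis less_eq_real_def)
  have f1: "f1 \<in> perp S" "nrm f1 = 1"
    using perp_closed(2)[OF S f0(1)] n0 nrm_scale[OF pH[OF f0(1)]] by (auto simp: f1_def norm_divide)
  have "Re (ip (K f1) f1) = (1 / nrm f0)\<^sup>2 * Re (ip (K f0) f0)"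
    using pH[OF f0(1)] unfolding f1_def
    by (simp add: K_scale ip_scale ip_scale_right K_H H_closed power2_eq_square flip: of_real_mult)
  also have "\<dots> \<ge> (1 / nrm f0)\<^sup>2 * (t * (nrm f0)\<^sup>2)"
    using t pH[OF f0(1)] by (intro mult_left_mono) (auto simp: nrm_sq)
  finally have r1: "t \<le> Re (ip (K f1) f1)" using n0 by (simp add: power_divide)
  have R1: "Re (ip (K f1) f1) \<in> R" using f1 R_def by blast
  have bound: "x \<le> 1" if xR: "x \<in> R" for x
  proof -
    obtain f where f: "x = Re (ip (K f) f)" "f \<in> perp S" "nrm f = 1" using xR R_def by blast
    have "x \<le> cmod (ip (K f) f)" using f complex_Re_le_cmod by blast
    also have "\<dots> \<le> nrm (K f) * nrm f" using cs_nrm f pH K_H by blast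
    also have "\<dots> \<le> 1" using K_nrm[of f] f pH by simp
    finally show ?thesis .
  qed
  then have bdd: "bdd_above R" by (auto simp: bdd_above_def)
  define M where "M = Sup R"
  have tM: "t \<le> M" using r1 cSup_upper[OF R1 bdd] M_def by linarith
  then have M0: "M > 0" using t by linarith
  have "\<exists>f. f \<in> perp S \<and> nrm f = 1 \<and> M - 1 / Suc n < Re (ip (K f) f)" for n
  proof -
    have "\<exists>x\<in>R. M - 1 / Suc n < x"
      unfolding M_def using R1 bdd less_cSup_iff[of R] by (metis diff_less_eq divide_pos_pos emptyE less_add_same_cancel1 of_nat_0_less_iff zero_less_Suc zero_less_one)
    then show ?thesis using R_def by blast
  qed
  then obtain u where u: "\<And>n. u n \<in> perp S" "\<And>n. nrm (u n) = 1"
    "\<And>n. M - 1 / Suc n < Re (ip (K (u n)) (u n))" by metis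
  have uH: "u n \<in> H" for n using u pH by blast
  have Ray: "Re (ip (K f) f) \<le> M * (nrm f)\<^sup>2" if f: "f \<in> perp S" for f
  proof (cases "f = 0")
    case True then show ?thesis using K0 ip_zero H_closed by (simp add: nrm_def)
  next
    case False
    then have nf: "nrm f > 0" using f pH nrm_ge0 nrm_zero_iff by (metis less_eq_real_def)
    define g where "g = scale (of_real (1 / nrm f)) f"
    have g: "g \<in> perp S" "nrm g = 1"
      using perp_closed(2)[OF S f] nf nrm_scale[OF pH[OF f]] by (auto simp: g_def norm_divide)
    have "Re (ip (K g) g) = (1 / nrm f)\<^sup>2 * Re (ip (K f) f)"
      using pH[OF f] unfolding g_def
      by (simp add: K_scale ip_scale ip_scale_right K_H H_closed power2_eq_square flip: of_real_mult)
    moreover have "Re (ip (K g) g) \<le> M" unfolding M_def using g bdd R_def by (intro cSup_upper) auto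
    ultimately have "(1 / nrm f)\<^sup>2 * Re (ip (K f) f) \<le> M" by simp
    then show ?thesis using nf by (simp add: power_divide divide_le_eq)
  qed
  have Kp: "K f \<in> perp S" if "f \<in> perp S" for f using perp_closed(4)[OF S that SK] .
  \<comment> \<open>Cauchy-Schwarz for the form \<open>ip (K f) g\<close> at \<open>u n\<close> and
    \<open>K (u n)\<close>. With a = |K u|^2 and <K u, u> = \<open>ip (K (u n)) (u n)\<close> it
    reads a^2 \<le> <K u, u> M a, because \<open>K (u n)\<close> again lies in
    \<open>perp S\<close>.\<close>
  have Kn: "(nrm (K (u n)))\<^sup>2 \<le> M * Re (ip (K (u n)) (u n))" for n
  proof -
    define a where "a = (nrm (K (u n)))\<^sup>2"
    have KH: "K (u n) \<in> H" using uH K_H by blast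
    have "(cmod (ip (K (u n)) (K (u n))))\<^sup>2 \<le> Re (ip (K (u n)) (u n)) * Re (ip (K (K (u n))) (K (u n)))"
      using kf.cauchy_schwarz[OF uH KH] .
    also have "\<dots> \<le> Re (ip (K (u n)) (u n)) * (M * a)"
      using Ray[OF Kp[OF u(1)]] kf.ip_nonneg[OF uH] by (intro mult_left_mono) (auto simp: a_def)
    also have "cmod (ip (K (u n)) (K (u n))) = a"
      using ip_self[OF KH] nrm_sq[OF KH] ip_nonneg[OF KH] a_def by (metis abs_of_nonneg norm_of_real)
    finally have "a * a \<le> (M * Re (ip (K (u n)) (u n))) * a" by (simp add: power2_eq_square algebra_simps)
    moreover have "0 \<le> a" by (simp add: a_def)
    moreover have "0 \<le> M * Re (ip (K (u n)) (u n))" using M0 kf.ip_nonneg[OF uH] by simp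
    ultimately have "a \<le> M * Re (ip (K (u n)) (u n))"
      by (cases "a = 0") (auto simp: mult_le_cancel_right)
    then show ?thesis by (simp add: a_def)
  qed
  \<comment> \<open>By \<open>Kn\<close> the expanded square |K u|^2 - 2 M <K u, u> + M^2 is at most
    M (M - <K u, u>), which tends to 0.\<close>
  have dif: "(nrm (K (u n) - scale (of_real M) (u n)))\<^sup>2 \<le> M * (1 / Suc n)" for n
  proof -
    have KH: "K (u n) \<in> H" "scale (of_real M) (u n) \<in> H" using uH K_H H_closed by auto
    have r: "ip (u n) (K (u n)) = cnj (ip (K (u n)) (u n))" using ip_sym KH uH by blast
    have "(nrm (K (u n) - scale (of_real M) (u n)))\<^sup>2 =
       (nrm (K (u n)))\<^sup>2 - 2 * M * Re (ip (K (u n)) (u n)) + M\<^sup>2 * (nrm (u n))\<^sup>2"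
      using KH uH by (simp add: nrm_sq H_closed ip_minus ip_scale ip_scale_right r power2_eq_square[of M] algebra_simps)
    also have "\<dots> \<le> M\<^sup>2 - M * Re (ip (K (u n)) (u n))" using Kn[of n] u(2)[of n] by simp
    also have "\<dots> \<le> M\<^sup>2 - M * (M - 1 / Suc n)" using u(3)[of n] M0 by simp
    finally show ?thesis by (simp add: power2_eq_square algebra_simps)
  qed
  have lim1: "(\<lambda>n. nrm (K (u n) - scale (of_real M) (u n))) \<longlonglongrightarrow> 0"
  proof -
    have "(\<lambda>n. M * (1 / Suc n)) \<longlonglongrightarrow> 0" 
      using tendsto_mult_right_zero[OF LIMSEQ_inverse_real_of_nat, of M] by (simp only: inverse_eq_divide)
    from tendsto_sandwich[OF _ _ tendsto_const this, of "\<lambda>n. (nrm (K (u n) - scale (of_real M) (u n)))\<^sup>2"]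
    have "(\<lambda>n. (nrm (K (u n) - scale (of_real M) (u n)))\<^sup>2) \<longlonglongrightarrow> 0"
      using dif by simp
    then have "(\<lambda>n. sqrt ((nrm (K (u n) - scale (of_real M) (u n)))\<^sup>2)) \<longlonglongrightarrow> sqrt 0" by (rule tendsto_real_sqrt)
    then show ?thesis using nrm_ge0 H_closed K_H uH by simp
  qed
  \<comment> \<open>Compactness gives a limit of \<open>K (u (s n))\<close>. By \<open>lim1\<close>
    the multiples M u of the same subsequence have this limit too, and so \<open>v\<close> becomes
    an eigenvector.\<close>
  obtain v s where v: "v \<in> H" "strict_mono (s :: nat \<Rightarrow> nat)" "(\<lambda>n. nrm (K (u (s n)) - v)) \<longlonglongrightarrow> 0"
    using compact_seq[of u] uH u(2) by (metis order_refl)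
  have vp: "v \<in> perp S" using perp_limit[OF S v(1) _ v(3)] Kp u by blast
  have lim2: "(\<lambda>n. nrm (scale (of_real M) (u (s n)) - v)) \<longlonglongrightarrow> 0"
  proof (rule tendsto_sandwich[OF _ _ tendsto_const])
    show "\<forall>\<^sub>F n in sequentially. nrm (scale (of_real M) (u (s n)) - v)
       \<le> nrm (K (u (s n)) - scale (of_real M) (u (s n))) + nrm (K (u (s n)) - v)"
    proof (intro always_eventually allI)
      fix n
      have h: "K (u (s n)) \<in> H" "scale (of_real M) (u (s n)) \<in> H" using uH K_H H_closed by auto
      have "scale (of_real M) (u (s n)) - v =
         scale (-1) (K (u (s n)) - scale (of_real M) (u (s n))) + (K (u (s n)) - v)"
        by simp
      then have "nrm (scale (of_real M) (u (s n)) - v) \<le>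
         nrm (scale (-1) (K (u (s n)) - scale (of_real M) (u (s n)))) + nrm (K (u (s n)) - v)"
        using nrm_triangle h v(1) H_closed by metis
      then show "nrm (scale (of_real M) (u (s n)) - v)
       \<le> nrm (K (u (s n)) - scale (of_real M) (u (s n))) + nrm (K (u (s n)) - v)"
        using h H_closed by (subst (asm) nrm_scale) auto
    qed
    have "(\<lambda>n. nrm (K (u (s n)) - scale (of_real M) (u (s n)))) \<longlonglongrightarrow> 0"
      using LIMSEQ_subseq_LIMSEQ[OF lim1 v(2)] by (simp add: o_def)
    from tendsto_add[OF this v(3)]
    show "(\<lambda>n. nrm (K (u (s n)) - scale (of_real M) (u (s n))) + nrm (K (u (s n)) - v)) \<longlonglongrightarrow> 0" by simp
    show "\<forall>\<^sub>F n in sequentially. 0 \<le> nrm (scale (of_real M) (u (s n)) - v)"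
      using uH v H_closed nrm_ge0 by simp
  qed
  have "nrm (K v - scale (of_real M) v) \<le> nrm (scale (of_real M) (u (s n)) - v) + M * nrm (K (u (s n)) - v)" for n
  proof -
    have h: "K (u (s n)) \<in> H" "scale (of_real M) (u (s n)) \<in> H" using uH K_H H_closed by auto
    define a where "a = scale (of_real M) (u (s n)) - v"
    have aH: "a \<in> H" "K (u (s n)) - v \<in> H" unfolding a_def using h v H_closed by auto
    have "K a = scale (of_real M) (K (u (s n))) - K v"
      unfolding a_def using h v uH by (simp add: K_diff K_scale)
    then have "K v - scale (of_real M) v = scale (-1) (K a) + scale (of_real M) (K (u (s n)) - v)"
      by (simp add: scale_right_diff_distrib)
    then have "nrm (K v - scale (of_real M) v) \<le> nrm (scale (-1) (K a)) + nrm (scale (of_real M) (K (u (s n)) - v))"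
      using nrm_triangle aH H_closed K_H by metis
    also have "\<dots> = nrm (K a) + M * nrm (K (u (s n)) - v)"
      using M0 by (subst (1 2) nrm_scale) (simp_all add: aH K_H)
    finally show ?thesis using K_nrm[OF aH(1)] a_def by simp
  qed
  moreover have "(\<lambda>n. nrm (scale (of_real M) (u (s n)) - v) + M * nrm (K (u (s n)) - v)) \<longlonglongrightarrow> 0"
    using tendsto_add[OF lim2 tendsto_mult_right_zero[OF v(3), of M]] by simp
  ultimately have "nrm (K v - scale (of_real M) v) \<le> 0"
    by (intro LIMSEQ_le_const[of _ 0]) auto
  then have "K v - scale (of_real M) v = 0"
    using nrm_zero_iff nrm_ge0 v(1) K_H H_closed by (metis antisym)
  then have eig: "v \<in> Eig M" using v(1) by (simp add: Eig_def)
  \<comment> \<open>|M u| = M \<ge> t > 0 keeps the limit away from 0.\<close>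
  have "v \<noteq> 0"
  proof
    assume "v = 0"
    then have "(\<lambda>n. nrm (scale (of_real M) (u (s n)))) \<longlonglongrightarrow> 0" using lim2 by simp
    moreover have "nrm (scale (of_real M) (u (s n))) = M" for n using nrm_scale[OF uH] u(2) M0 by simp
    ultimately have "(\<lambda>n::nat. M) \<longlonglongrightarrow> 0" by simp
    then show False using M0 LIMSEQ_const_iff[of M 0] by simp
  qed
  then show ?thesis using eig vp tM by blast
qed


lemma Eig_H: "f \<in> Eig \<kappa> \<Longrightarrow> f \<in> H" by (simp add: Eig_def)

lemma Eig_K: "f \<in> Eig \<kappa> \<Longrightarrow> K f = scale (of_real \<kappa>) f" by (simp add: Eig_def)

lemma subspace_Eig: "subspace (Eig \<kappa>)"
  by (auto simp: subspace_def Eig_def H_closed K0 K_add K_scale scale_right_distrib mult.commute)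

lemma Eig_basis:
  obtains B where "B \<subseteq> Eig \<kappa>" "finite B" "independent B" "span B = Eig \<kappa>" "card B = dim (Eig \<kappa>)"
proof -
  obtain B where B: "B \<subseteq> Eig \<kappa>" "independent B" "Eig \<kappa> \<subseteq> span B" "card B = dim (Eig \<kappa>)"
    by (rule basis_exists)
  obtain C where C: "finite C" "Eig \<kappa> \<subseteq> span C"
    using eig_finite_dim[of \<kappa>] by (auto simp: Eig_def)
  then have "finite B" using independent_span_bound[of C B] B by blast
  then show ?thesis using that B subspace_Eig by (meson span_subspace)
qed

lemma dim_Eig_pos_iff: "dim (Eig \<kappa>) > 0 \<longleftrightarrow> (\<exists>u\<in>Eig \<kappa>. u \<noteq> 0)"
proof -
  obtain B where B: "B \<subseteq> Eig \<kappa>" "finite B" "independent B" "span B = Eig \<kappa>" "card B = dim (Eig \<kappa>)"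
    by (rule Eig_basis)
  have "card B > 0 \<longleftrightarrow> B \<noteq> {}" using B(2) by (simp add: card_gt_0_iff)
  moreover have "B \<noteq> {} \<longleftrightarrow> (\<exists>u\<in>span B. u \<noteq> 0)"
    using B(3) dependent_zero span_base by (metis empty_iff ex_in_conv singletonD span_empty)
  ultimately show ?thesis using B by simp
qed

lemma Eig_pos: "u \<in> Eig \<kappa> \<Longrightarrow> u \<noteq> 0 \<Longrightarrow> \<kappa> > 0"
proof -
  assume u: "u \<in> Eig \<kappa>" "u \<noteq> 0"
  have "Re (ip (K u) u) = \<kappa> * Re (ip u u)" using Eig_H[OF u(1)] Eig_K[OF u(1)] by (simp add: ip_scale)
  then show "\<kappa> > 0" using K_pos[OF Eig_H[OF u(1)] u(2)] ip_pos[OF Eig_H[OF u(1)] u(2)]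
    by (simp add: zero_less_mult_iff)
qed

lemma Eig_orthogonal:
  assumes u: "u \<in> Eig \<kappa>" and v: "v \<in> Eig \<kappa>'" and ne: "\<kappa> \<noteq> \<kappa>'"
  shows "ip u v = 0"
proof -
  have "of_real \<kappa> * ip u v = of_real \<kappa>' * ip u v"
    
    using K_sym[OF Eig_H[OF u] Eig_H[OF v]] Eig_H[OF u] Eig_H[OF v] Eig_K[OF u] Eig_K[OF v] by (simp add: ip_scale ip_scale_right)
  then show ?thesis using ne by simp
qed

lemma ip_sum_right:
  "(\<And>i. i \<in> I \<Longrightarrow> f i \<in> H) \<Longrightarrow> h \<in> H \<Longrightarrow> ip h (\<Sum>i\<in>I. f i) = (\<Sum>i\<in>I. ip h (f i))"
proof (induction I rule: infinite_finite_induct)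
  case (insert i I)
  have "(\<Sum>i\<in>I. f i) \<in> H" using insert subspace_H by (simp add: subspace_sum)
  then show ?case using insert by (simp add: ip_add_right)
qed (simp_all add: ip_zero)

lemma ip_Eig_sum:
  assumes F: "finite F" and f: "\<And>\<kappa>. \<kappa> \<in> F \<Longrightarrow> f \<kappa> \<in> Eig \<kappa>" and g: "\<And>\<kappa>. \<kappa> \<in> F \<Longrightarrow> g \<kappa> \<in> Eig \<kappa>"
  shows "ip (\<Sum>\<kappa>\<in>F. f \<kappa>) (\<Sum>\<kappa>\<in>F. g \<kappa>) = (\<Sum>\<kappa>\<in>F. ip (f \<kappa>) (g \<kappa>))"
proof -
  have gH: "(\<Sum>\<kappa>\<in>F. g \<kappa>) \<in> H"
    by (intro subspace_sum[OF subspace_H]) (blast intro: Eig_H g)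
  have "ip (f \<kappa>) (\<Sum>\<kappa>\<in>F. g \<kappa>) = ip (f \<kappa>) (g \<kappa>)" if k: "\<kappa> \<in> F" for \<kappa>
  proof -
    have "ip (f \<kappa>) (\<Sum>\<kappa>\<in>F. g \<kappa>) = (\<Sum>\<kappa>'\<in>F. ip (f \<kappa>) (g \<kappa>'))"
      by (rule ip_sum_right) (rule Eig_H[OF g], assumption, rule Eig_H[OF f[OF k]])
    also have "\<dots> = (\<Sum>\<kappa>'\<in>F. if \<kappa>' = \<kappa> then ip (f \<kappa>) (g \<kappa>) else 0)"
      by (rule sum.cong) (simp_all add: Eig_orthogonal[OF f[OF k] g])
    finally show ?thesis using F k by simp
  qed
  moreover have "ip (\<Sum>\<kappa>\<in>F. f \<kappa>) (\<Sum>\<kappa>\<in>F. g \<kappa>) = (\<Sum>\<kappa>\<in>F. ip (f \<kappa>) (\<Sum>\<kappa>\<in>F. g \<kappa>))"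
    by (rule ip_sum) (rule Eig_H[OF f], assumption, rule gH)
  ultimately show ?thesis by simp
qed

lemma K_sum: "(\<And>i. i \<in> I \<Longrightarrow> f i \<in> H) \<Longrightarrow> K (\<Sum>i\<in>I. f i) = (\<Sum>i\<in>I. K (f i))"
proof (induction I rule: infinite_finite_induct)
  case (insert i I)
  have "(\<Sum>i\<in>I. f i) \<in> H" using insert subspace_H by (simp add: subspace_sum)
  then show ?case using insert by (simp add: K_add)
qed (simp_all add: K0)

text \<open>Large eigenvalues are counted because a large \<kappa> of the resolvent stands for the
  small eigenvalue \<mu>0 + 1/\<kappa> of the differential operator.\<close>

definition spec :: "real \<Rightarrow> real set" where
  "spec t = {\<kappa>. t \<le> \<kappa> \<and> 0 < dim (Eig \<kappa>)}"

definition count :: "real \<Rightarrow> nat" where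
  "count t = (\<Sum>\<kappa>\<in>spec t. dim (Eig \<kappa>))"

text \<open>Infinitely many eigenvalues above t would give orthonormal eigenvectors whose images
  under \<open>K\<close> are pairwise at distance at least t, so no subsequence of the images
  converges.\<close>

lemma finite_spec:
  assumes t: "0 < t"
  shows "finite (spec t)"
proof (rule ccontr)
  assume inf: "infinite (spec t)"
  then obtain k :: "nat \<Rightarrow> real" where k: "inj k" "range k \<subseteq> spec t"
    using infinite_countable_subset by blast
  have "\<exists>u. u \<in> Eig (k n) \<and> nrm u = 1" for n
  proof -
    have "0 < dim (Eig (k n))" using k spec_def by blast
    then obtain u where u: "u \<in> Eig (k n)" "u \<noteq> 0" using dim_Eig_pos_iff by blast
    have nu: "nrm u > 0" using nrm_zero_iff nrm_ge0 u Eig_H by (metis less_eq_real_def)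
    have "scale (of_real (1 / nrm u)) u \<in> Eig (k n)" using u subspace_Eig subspace_scale by blast
    moreover have "nrm (scale (of_real (1 / nrm u)) u) = 1"
      using nu u Eig_H by (subst nrm_scale) (auto simp: norm_divide)
    ultimately show ?thesis by blast
  qed
  then obtain u where u: "\<And>n. u n \<in> Eig (k n)" "\<And>n. nrm (u n) = 1" by metis
  have uH: "u n \<in> H" for n using u Eig_H by blast
  obtain v s where v: "v \<in> H" "strict_mono (s :: nat \<Rightarrow> nat)" "(\<lambda>n. nrm (K (u (s n)) - v)) \<longlonglongrightarrow> 0"
    using compact_seq[of u] uH u(2) by (metis order_refl)
  have "\<forall>\<^sub>F n in sequentially. nrm (K (u (s n)) - v) < t / 2"
    using order_tendstoD(2)[OF v(3), of "t / 2"] t by simp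
  then obtain n where nn: "\<And>m. n \<le> m \<Longrightarrow> nrm (K (u (s m)) - v) < t / 2"
    unfolding eventually_sequentially by blast
  have n: "nrm (K (u (s n)) - v) < t / 2" "nrm (K (u (s (Suc n))) - v) < t / 2"
    by (rule nn, simp)+
  define a b where "a = K (u (s n))" and "b = K (u (s (Suc n)))"
  have ab: "a \<in> H" "b \<in> H" unfolding a_def b_def using uH K_H by auto
  have abv: "a - v \<in> H" "b - v \<in> H" using ab v(1) H_closed by auto
  have "a - b = (a - v) + scale (-1) (b - v)" by simp
  then have "nrm (a - b) \<le> nrm (a - v) + nrm (scale (-1) (b - v))"
    using nrm_triangle[OF abv(1) H_closed(3)[OF abv(2)]] by (simp only:)
  also have "\<dots> = nrm (a - v) + nrm (b - v)" by (simp only: nrm_scale[OF abv(2)]) simp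
  also have "\<dots> < t" using n by (simp add: a_def b_def)
  finally have lt: "nrm (a - b) < t" .
  have "s n \<noteq> s (Suc n)" using v(2) by (metis n_not_Suc_n strict_mono_eq)
  then have kk: "k (s n) \<noteq> k (s (Suc n))" using k(1) by (simp add: inj_eq)
  have aE: "a \<in> Eig (k (s n))" "b \<in> Eig (k (s (Suc n)))"
    unfolding a_def b_def Eig_K[OF u(1)] by (rule subspace_scale[OF subspace_Eig u(1)])+
  have o: "ip a b = 0" "ip b a = 0"
    using Eig_orthogonal[OF aE kk] Eig_orthogonal[OF aE(2,1) kk[symmetric]] by auto
  have "(nrm (a - b))\<^sup>2 = (nrm a)\<^sup>2 + (nrm b)\<^sup>2"
    using ab o by (simp add: nrm_sq H_closed ip_minus)
  moreover have "nrm a = \<bar>k (s n)\<bar>" unfolding a_def by (simp add: Eig_K[OF u(1)] nrm_scale uH u(2))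
  moreover have "t \<le> k (s n)" using k(2) spec_def by auto
  ultimately have "t\<^sup>2 \<le> (nrm (a - b))\<^sup>2"
    using power_mono[of t "\<bar>k (s n)\<bar>" 2] t by (simp add: add_increasing2)
  then have "t \<le> nrm (a - b)"
    by (rule power2_le_imp_le) (simp add: nrm_ge0 ab H_closed)
  then show False using lt by simp
qed

text \<open>Eigenspaces are orthogonal for \<open>ip\<close> and invariant under \<open>K\<close>,
  so both forms split into sums over the eigenvalues; hence the Rayleigh quotient is at least t on
  the whole span.\<close>

lemma eigenbasis:
  assumes t: "0 < t"
  obtains B where "finite B" "independent B" "card B = count t"
    "\<And>b. b \<in> B \<Longrightarrow> \<exists>\<kappa>\<in>spec t. b \<in> Eig \<kappa>"
    "\<And>u \<kappa>. t \<le> \<kappa> \<Longrightarrow> u \<in> Eig \<kappa> \<Longrightarrow> u \<in> span B"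
    "\<And>f. f \<in> span B \<Longrightarrow> f \<in> H \<and> t * Re (ip f f) \<le> Re (ip (K f) f)"
proof -
  have "\<exists>B. B \<subseteq> Eig \<kappa> \<and> finite B \<and> independent B \<and> span B = Eig \<kappa> \<and> card B = dim (Eig \<kappa>)" for \<kappa>
    by (rule Eig_basis[of \<kappa>]) blast
  then obtain E where E: "\<And>\<kappa>. E \<kappa> \<subseteq> Eig \<kappa>" "\<And>\<kappa>. finite (E \<kappa>)" "\<And>\<kappa>. independent (E \<kappa>)"
    "\<And>\<kappa>. span (E \<kappa>) = Eig \<kappa>" "\<And>\<kappa>. card (E \<kappa>) = dim (Eig \<kappa>)"
    by metis
  define F where "F = spec t"
  have F: "finite F" unfolding F_def using finite_spec t by blast
  define B where "B = (\<Union>\<kappa>\<in>F. E \<kappa>)"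
  have finB: "finite B" unfolding B_def using F E by blast
  have disj: "E \<kappa> \<inter> E \<kappa>' = {}" if "\<kappa> \<noteq> \<kappa>'" for \<kappa> \<kappa>'
  proof (rule ccontr)
    assume "E \<kappa> \<inter> E \<kappa>' \<noteq> {}"
    then obtain b where b: "b \<in> E \<kappa>" "b \<in> E \<kappa>'" by blast
    then have "ip b b = 0" using Eig_orthogonal E(1) that by blast
    moreover have "b \<noteq> 0" using b E(3) dependent_zero by blast
    moreover have "b \<in> H" using b E(1) Eig_H by blast
    ultimately show False using ip_pos[of b] by simp
  qed
  have split: "(\<Sum>b\<in>B. scale (c b) b) = (\<Sum>\<kappa>\<in>F. \<Sum>b\<in>E \<kappa>. scale (c b) b)" for c
    unfolding B_def using F E(2) disj by (intro sum.UNION_disjoint) auto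
  have part: "(\<Sum>b\<in>E \<kappa>. scale (c b) b) \<in> Eig \<kappa>" for c \<kappa>
    using E(1) by (intro subspace_sum[OF subspace_Eig] subspace_scale[OF subspace_Eig]) blast
  have indep: "independent B"
  proof (rule independent_if_scalars_zero[OF finB])
    fix c b assume z: "(\<Sum>b\<in>B. scale (c b) b) = 0" and b: "b \<in> B"
    define p where "p \<kappa> = (\<Sum>b\<in>E \<kappa>. scale (c b) b)" for \<kappa>
    have pE: "p \<kappa> \<in> Eig \<kappa>" for \<kappa> unfolding p_def by (rule part)
    have s0: "(\<Sum>\<kappa>\<in>F. p \<kappa>) = 0" using z split[of c] p_def by simp
    obtain \<kappa> where k: "\<kappa> \<in> F" "b \<in> E \<kappa>" using b B_def by blast
    have "ip (\<Sum>\<kappa>\<in>F. p \<kappa>) (\<Sum>\<kappa>\<in>F. p \<kappa>) = (\<Sum>\<kappa>\<in>F. ip (p \<kappa>) (p \<kappa>))"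
      using ip_Eig_sum[OF F pE pE] .
    then have "(\<Sum>\<kappa>\<in>F. Re (ip (p \<kappa>) (p \<kappa>))) = 0"
      unfolding s0 ip_zero(1)[OF H_closed(1)] by (simp flip: Re_sum)
    then have "Re (ip (p \<kappa>) (p \<kappa>)) = 0"
      using sum_nonneg_eq_0_iff[OF F, of "\<lambda>\<kappa>. Re (ip (p \<kappa>) (p \<kappa>))"] ip_nonneg[OF Eig_H[OF pE]] k by blast
    then have "p \<kappa> = 0" using ip_pos[OF Eig_H[OF pE]] by force
    then show "c b = 0"
      using p_def by (intro independentD[OF E(3) E(2) order_refl _ k(2)]) simp
  qed
  have card: "card B = count t"
    unfolding B_def count_def F_def[symmetric] using F E(2,5) disj by (subst card_UN_disjoint) auto
  have ray: "f \<in> H \<and> t * Re (ip f f) \<le> Re (ip (K f) f)" if f: "f \<in> span B" for f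
  proof -
    obtain c where c: "f = (\<Sum>b\<in>B. scale (c b) b)" using f span_finite[OF finB] by auto
    define p where "p \<kappa> = (\<Sum>b\<in>E \<kappa>. scale (c b) b)" for \<kappa>
    have pE: "p \<kappa> \<in> Eig \<kappa>" for \<kappa> unfolding p_def by (rule part)
    have fp: "f = (\<Sum>\<kappa>\<in>F. p \<kappa>)" using c split[of c] p_def by simp
    have fH: "f \<in> H"
      unfolding fp by (intro subspace_sum[OF subspace_H]) (blast intro: Eig_H pE)
    have "K f = (\<Sum>\<kappa>\<in>F. K (p \<kappa>))" unfolding fp by (rule K_sum) (rule Eig_H[OF pE])
    moreover have KpE: "K (p \<kappa>) \<in> Eig \<kappa>" for \<kappa>
      unfolding Eig_K[OF pE] by (rule subspace_scale[OF subspace_Eig pE])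
    ultimately have "ip (K f) f = (\<Sum>\<kappa>\<in>F. ip (K (p \<kappa>)) (p \<kappa>))"
      using ip_Eig_sum[OF F KpE pE] unfolding fp by simp
    also have "\<dots> = (\<Sum>\<kappa>\<in>F. of_real \<kappa> * ip (p \<kappa>) (p \<kappa>))"
      by (rule sum.cong) (simp_all add: Eig_K[OF pE] ip_scale Eig_H[OF pE])
    finally have "Re (ip (K f) f) = (\<Sum>\<kappa>\<in>F. \<kappa> * Re (ip (p \<kappa>) (p \<kappa>)))" by simp
    also have "\<dots> \<ge> (\<Sum>\<kappa>\<in>F. t * Re (ip (p \<kappa>) (p \<kappa>)))"
      using ip_nonneg[OF Eig_H[OF pE]] by (intro sum_mono mult_right_mono) (auto simp: F_def spec_def)
    also have "(\<Sum>\<kappa>\<in>F. t * Re (ip (p \<kappa>) (p \<kappa>))) = t * Re (ip f f)"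
      using ip_Eig_sum[OF F pE pE] unfolding fp by (simp add: sum_distrib_left)
    finally show ?thesis using fH by simp
  qed
  have inB: "u \<in> span B" if u: "t \<le> \<kappa>" "u \<in> Eig \<kappa>" for u \<kappa>
  proof (cases "u = 0")
    case True
    then show ?thesis by (simp add: span_zero)
  next
    case False
    then have "\<kappa> \<in> F" using u dim_Eig_pos_iff F_def spec_def by blast
    then have "E \<kappa> \<subseteq> B" using B_def by blast
    then show ?thesis using span_mono[of "E \<kappa>" B] E(4) u by blast
  qed
  have eig: "\<exists>\<kappa>\<in>spec t. b \<in> Eig \<kappa>" if "b \<in> B" for b
    using that E(1) unfolding B_def F_def by blast
  show ?thesis by (rule that[OF finB indep card]) (rule eig inB ray; assumption)+
qed

lemma perp_span:
  assumes S: "S \<subseteq> H" and u: "u \<in> perp S" and g: "g \<in> span S"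
  shows "ip u g = 0"
proof -
  have uH: "u \<in> H" using u perp_def by blast
  have "g \<in> H \<and> ip u g = 0"
    using g
  proof (induction rule: span_induct_alt)
    case base
    then show ?case using ip_zero H_closed uH by blast
  next
    case (step c x y)
    have "x \<in> H" "ip u x = 0" using step S u by (auto simp: perp_def)
    then show ?case using step uH by (simp add: H_closed ip_add_right ip_scale_right)
  qed
  then show ?thesis by simp
qed

lemma exists_in_perp:
  assumes B: "finite B" "B \<subseteq> H" and C: "C \<subseteq> H" "independent C" "finite C" and less: "card B < card C"
  obtains f where "f \<in> span C" "f \<noteq> 0" "f \<in> perp B"
proof -
  have sC: "span C \<subseteq> H" using C(1) subspace_H by (rule span_minimal)
  have "\<exists>C'. independent C' \<and> finite C' \<and> C' \<subseteq> span C \<and> card C \<le> card C' + card B \<and>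
      (\<forall>b\<in>B. \<forall>c\<in>C'. ip c b = 0)"
  proof (rule independent_kernel[OF B(1) C(2,3)])
    fix b x y c
    show "b \<in> B \<Longrightarrow> x \<in> span C \<Longrightarrow> y \<in> span C \<Longrightarrow> ip (x + y) b = ip x b + ip y b"
      using sC B(2) by (intro ip_add) auto
    show "b \<in> B \<Longrightarrow> x \<in> span C \<Longrightarrow> ip (scale c x) b = c * ip x b"
      using sC B(2) by (intro ip_scale) auto
  qed
  then obtain C' where C': "independent C'" "C' \<subseteq> span C" "card C \<le> card C' + card B"
    "\<forall>b\<in>B. \<forall>c\<in>C'. ip c b = 0" by blast
  have "C' \<noteq> {}" using less C'(3) by auto
  then obtain f where f: "f \<in> C'" by blast
  have "f \<noteq> 0" using f C'(1) dependent_zero by blast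
  moreover have "f \<in> perp B" using f C' sC by (auto simp: perp_def)
  ultimately show ?thesis using f C'(2) by (intro that) auto
qed

text \<open>A vector in the span orthogonal to all eigenvectors would produce a new eigenvector.\<close>

theorem count_maximal:
  assumes t: "0 < t" and C: "C \<subseteq> H" "independent C" "finite C"
    and ray: "\<And>f. f \<in> span C \<Longrightarrow> t * Re (ip f f) \<le> Re (ip (K f) f)"
  shows "card C \<le> count t"
proof (rule ccontr)
  assume less: "\<not> card C \<le> count t"
  obtain B where B: "finite B" "independent B" "card B = count t"
    "\<And>b. b \<in> B \<Longrightarrow> \<exists>\<kappa>\<in>spec t. b \<in> Eig \<kappa>"
    "\<And>u \<kappa>. t \<le> \<kappa> \<Longrightarrow> u \<in> Eig \<kappa> \<Longrightarrow> u \<in> span B"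
    using eigenbasis[OF t] by metis
  have BH: "B \<subseteq> H" using B(4) Eig_H by blast
  have BK: "\<And>b. b \<in> B \<Longrightarrow> \<exists>c. K b = scale c b" using B(4) Eig_K by blast
  obtain f where f: "f \<in> span C" "f \<noteq> 0" "f \<in> perp B"
    by (rule exists_in_perp[OF B(1) BH C]) (use less B(3) in simp)
  obtain \<kappa> u where u: "\<kappa> \<ge> t" "u \<in> perp B" "u \<noteq> 0" "u \<in> Eig \<kappa>"
    using eigenvector_in_perp[OF BH BK f(3,2) t ray[OF f(1)]] by blast
  have "u \<in> span B" using B(5) u by blast
  then have "ip u u = 0" using perp_span[OF BH] u by blast
  then show False using ip_pos[of u] u Eig_H by force
qed

text \<open>The eigenvectors found so far span a finite-dimensional space, so some f \<noteq> 0 is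
  orthogonal to them. Positivity of \<open>K\<close> at f yields one more eigenvalue, and it lies
  below t because all eigenvectors for \<kappa> \<ge> t are already in the span.\<close>

theorem count_unbounded: "\<exists>t>0. n \<le> count t"
proof (induction n)
  case 0
  then show ?case using zero_less_one by blast
next
  case (Suc n)
  then obtain t where t: "t > 0" "n \<le> count t" by blast
  obtain B where B: "finite B" "independent B" "card B = count t"
    "\<And>b. b \<in> B \<Longrightarrow> \<exists>\<kappa>\<in>spec t. b \<in> Eig \<kappa>"
    "\<And>u \<kappa>. t \<le> \<kappa> \<Longrightarrow> u \<in> Eig \<kappa> \<Longrightarrow> u \<in> span B"
    "\<And>f. f \<in> span B \<Longrightarrow> f \<in> H \<and> t * Re (ip f f) \<le> Re (ip (K f) f)"
    using eigenbasis[OF t(1)] by metis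
  have BH: "B \<subseteq> H" using B(4) Eig_H by blast
  have BK: "\<And>b. b \<in> B \<Longrightarrow> \<exists>c. K b = scale c b" using B(4) Eig_K by blast
  obtain C where C: "C \<subseteq> H" "independent C" "finite C" "card C = Suc (count t)"
    using H_infinite_dim[of "Suc (count t)"] by blast
  have "card B < card C" using B(3) C(4) by simp
  then obtain f where f: "f \<in> span C" "f \<noteq> 0" "f \<in> perp B"
    by (rule exists_in_perp[OF B(1) BH C(1-3)])
  have fH: "f \<in> H" using f(3) perp_def by blast
  \<comment> \<open>No positive lower bound is known in advance; the Rayleigh quotient of f itself
    is taken as threshold.\<close>
  define t' where "t' = Re (ip (K f) f) / Re (ip f f)"
  have t': "t' > 0" "t' * Re (ip f f) \<le> Re (ip (K f) f)"
    unfolding t'_def using ip_pos[OF fH f(2)] K_pos[OF fH f(2)] by auto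
  obtain \<kappa> u where u: "u \<in> perp B" "u \<noteq> 0" "u \<in> Eig \<kappa>"
    using eigenvector_in_perp[OF BH BK f(3,2) t'] by blast
  have k0: "\<kappa> > 0" using Eig_pos u by blast
  have "\<kappa> < t"
  proof (rule ccontr)
    assume "\<not> \<kappa> < t"
    then have "u \<in> span B" using B(5)[of \<kappa> u] u by simp
    then have "ip u u = 0" using perp_span[OF BH] u by blast
    then show False using ip_pos[of u] u Eig_H by force
  qed
  then have "insert \<kappa> (spec t) \<subseteq> spec \<kappa>" "\<kappa> \<notin> spec t"
    using dim_Eig_pos_iff[of \<kappa>] u by (auto simp: spec_def)
  then have "dim (Eig \<kappa>) + count t \<le> count \<kappa>"
    unfolding count_def
    using sum_mono2[OF finite_spec[OF k0], of "insert \<kappa> (spec t)" "\<lambda>\<kappa>. dim (Eig \<kappa>)"] finite_spec[OF t(1)]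
    by simp
  moreover have "dim (Eig \<kappa>) > 0" using dim_Eig_pos_iff u by blast
  ultimately show ?case using t(2) k0 by (intro exI[of _ \<kappa>]) auto
qed

end

section \<open>Recovering ordered eigenvalues from their counting function\<close>

section \<open>Interlacing sequences\<close>


text \<open>The condition \<open>0 < m \<mu>\<close> removes zero summands only, but it makes the
  index set finite; a sum over an infinite set would be 0 by default.\<close>

definition mass_upto :: "(real \<Rightarrow> nat) \<Rightarrow> real \<Rightarrow> nat" where
  "mass_upto m c = (\<Sum>\<mu> | \<mu> \<le> c \<and> 0 < m \<mu>. m \<mu>)"

definition enumerates :: "(real \<Rightarrow> nat) \<Rightarrow> (nat \<Rightarrow> real) \<Rightarrow> bool" where
  "enumerates m l \<longleftrightarrow> mono l \<and> (\<forall>\<mu>. finite {k. l k = \<mu>} \<and> card {k. l k = \<mu>} = m \<mu>)"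

locale discrete_mass =
  fixes m :: "real \<Rightarrow> nat"
  assumes fin: "\<And>c. finite {\<mu>. \<mu> \<le> c \<and> 0 < m \<mu>}"
    and unbounded: "\<And>n. \<exists>c. n \<le> mass_upto m c"
begin

lemma mass_upto_mono: "c \<le> d \<Longrightarrow> mass_upto m c \<le> mass_upto m d"
  unfolding mass_upto_def by (rule sum_mono2[OF fin]) auto

text \<open>By monotonicity the indices with \<open>l k \<le> c\<close> form an initial segment,
  whose length is the mass up to c. The inequality is strict because indices start at 0. The
  equivalence determines \<open>l\<close>, so it settles the definite description in
  \<open>eigval\<close>.\<close>

lemma enumerates_le_iff:
  assumes l: "enumerates m l"
  shows "l k \<le> c \<longleftrightarrow> k < mass_upto m c"
proof -
  let ?S = "{\<mu>. \<mu> \<le> c \<and> 0 < m \<mu>}"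
  have fib: "finite {k. l k = \<mu>}" "card {k. l k = \<mu>} = m \<mu>" for \<mu> using l by (auto simp: enumerates_def)
  have "0 < m (l k)" for k
  proof -
    have "k \<in> {i. l i = l k}" by simp
    then have "0 < card {i. l i = l k}" using fib(1)[of "l k"] card_gt_0_iff by blast
    then show ?thesis using fib(2) by simp
  qed
  then have eq: "{k. l k \<le> c} = (\<Union>\<mu>\<in>?S. {k. l k = \<mu>})" by auto
  have finA: "finite {k. l k \<le> c}" unfolding eq using fin fib by blast
  have "card {k. l k \<le> c} = mass_upto m c"
    unfolding eq mass_upto_def by (subst card_UN_disjoint) (auto simp: fin fib)
  moreover obtain n where n: "{k. l k \<le> c} = {..<n}"
  proof -
    have dc: "l j \<le> c" if "j \<le> i" "l i \<le> c" for i j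
      using l that unfolding enumerates_def mono_def by (meson order_trans)
    define n where "n = (LEAST n. c < l n)"
    obtain n0 where "n0 \<notin> {k. l k \<le> c}" using finA ex_new_if_finite by blast
    then have "c < l n0" by simp
    then have L: "c < l n" unfolding n_def by (rule LeastI)
    have "l i \<le> c \<longleftrightarrow> i < n" for i
      using L dc[of n i] not_less_Least[of i "\<lambda>n. c < l n"] unfolding n_def by (meson not_le)
    then show ?thesis using that by auto
  qed
  ultimately have "n = mass_upto m c" by simp
  then show ?thesis using n by blast
qed

lemma enumerates_unique:
  assumes "enumerates m l" "enumerates m l'"
  shows "l = l'"
proof (rule ext, rule antisym)
  fix k
  show "l k \<le> l' k" "l' k \<le> l k"
    using enumerates_le_iff[OF assms(1)] enumerates_le_iff[OF assms(2)] by blast+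
qed

text \<open>The counting function is inverted: \<open>l k\<close> is the least atom whose cumulated
  mass exceeds k. It is attained because only finitely many atoms lie below any bound.\<close>

lemma enumerates_exists: "\<exists>l. enumerates m l"
proof -
  define A where "A k = {\<mu>. 0 < m \<mu> \<and> k < mass_upto m \<mu>}" for k
  \<comment> \<open>A finite nonempty set of atoms that is closed downwards has as total mass the
    cumulated mass at its maximum. It is applied to the atoms up to c and to those strictly below
    \<mu>.\<close>
  have Max_mass: "\<exists>\<mu>\<in>S. (\<forall>\<nu>\<in>S. \<nu> \<le> \<mu>) \<and> (\<Sum>\<nu>\<in>S. m \<nu>) = mass_upto m \<mu>"
    if S: "finite S" "S \<noteq> {}" "\<And>\<mu> \<nu>. \<mu> \<in> S \<Longrightarrow> \<nu> \<le> \<mu> \<Longrightarrow> 0 < m \<nu> \<Longrightarrow> \<nu> \<in> S" "\<And>\<mu>. \<mu> \<in> S \<Longrightarrow> 0 < m \<mu>" for S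
  proof (intro bexI conjI ballI)
    show M: "Max S \<in> S" using S by simp
    have e: "{\<nu>. \<nu> \<le> Max S \<and> 0 < m \<nu>} = S"
      using S(3)[OF M] S(4) Max_ge[OF S(1)] by blast
    show "(\<Sum>\<nu>\<in>S. m \<nu>) = mass_upto m (Max S)" unfolding mass_upto_def e ..
  qed (use S in simp)
  have reach: "\<exists>\<mu>\<in>A k. \<mu> \<le> c" if k: "k < mass_upto m c" for k c
  proof -
    let ?S = "{\<mu>. \<mu> \<le> c \<and> 0 < m \<mu>}"
    have "?S \<noteq> {}"
    proof
      assume "?S = {}"
      then have "mass_upto m c = 0" unfolding mass_upto_def by (simp only: sum.empty)
      then show False using k by simp
    qed
    then have "\<exists>\<mu>\<in>?S. (\<forall>\<nu>\<in>?S. \<nu> \<le> \<mu>) \<and> (\<Sum>\<nu>\<in>?S. m \<nu>) = mass_upto m \<mu>"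
      by (intro Max_mass fin) auto
    then obtain \<mu> where \<mu>: "\<mu> \<in> ?S" "mass_upto m c = mass_upto m \<mu>"
      unfolding mass_upto_def[of m c] by blast
    then show ?thesis using k by (intro bexI[of _ \<mu>]) (auto simp: A_def)
  qed
  have "\<exists>\<mu>\<in>A k. \<forall>\<nu>\<in>A k. \<mu> \<le> \<nu>" for k
  proof -
    obtain c where "k < mass_upto m c" using unbounded[of "Suc k"] by (auto simp: Suc_le_eq)
    then obtain \<mu>0 where mu0: "\<mu>0 \<in> A k" using reach by blast
    let ?F = "{\<mu> \<in> A k. \<mu> \<le> \<mu>0}"
    have finF: "finite ?F" by (rule finite_subset[OF _ fin[of \<mu>0]]) (auto simp: A_def)
    have "\<mu>0 \<in> ?F" using mu0 by simp
    then have F: "Min ?F \<in> ?F" using Min_in[OF finF] by blast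
    have F2: "Min ?F \<le> \<nu>" if "\<nu> \<in> ?F" for \<nu> using Min_le[OF finF that] .
    have "Min ?F \<le> \<nu>" if "\<nu> \<in> A k" for \<nu>
    proof (cases "\<nu> \<le> \<mu>0")
      case True
      then show ?thesis using F2 that by blast
    next
      case False
      then show ?thesis using F by force
    qed
    then show ?thesis using F by blast
  qed
  then obtain l where l: "\<And>k. l k \<in> A k" "\<And>k \<nu>. \<nu> \<in> A k \<Longrightarrow> l k \<le> \<nu>" by metis
  have le: "l k \<le> c \<longleftrightarrow> k < mass_upto m c" for k c
  proof
    assume "l k \<le> c"
    then show "k < mass_upto m c" using l(1)[of k] mass_upto_mono[of "l k" c] by (auto simp: A_def)
  next
    assume "k < mass_upto m c"
    then show "l k \<le> c" using reach l(2) by (meson order_trans)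
  qed
  have "mono l"
  proof (rule monoI)
    fix i j :: nat assume "i \<le> j"
    then have "l j \<in> A i" using l(1)[of j] by (auto simp: A_def)
    then show "l i \<le> l j" by (rule l(2))
  qed
  moreover have "finite {k. l k = \<mu>} \<and> card {k. l k = \<mu>} = m \<mu>" for \<mu>
  proof -
    let ?S = "{\<nu>. \<nu> < \<mu> \<and> 0 < m \<nu>}"
    have finS: "finite ?S" by (rule finite_subset[OF _ fin[of \<mu>]]) auto
    \<comment> \<open>n is the mass strictly below \<mu>, so the indices with value \<mu> will be
      those from n up to n + m \<mu>, the latter excluded.\<close>
    define n where "n = (\<Sum>\<nu>\<in>?S. m \<nu>)"
    have total: "mass_upto m \<mu> = n + m \<mu>"
    proof (cases "0 < m \<mu>")
      case True
      then have "{\<nu>. \<nu> \<le> \<mu> \<and> 0 < m \<nu>} = insert \<mu> ?S" by auto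
      then show ?thesis using finS by (simp add: mass_upto_def n_def)
    next
      case False
      then have "{\<nu>. \<nu> \<le> \<mu> \<and> 0 < m \<nu>} = ?S" by (auto simp: order.order_iff_strict)
      then show ?thesis using False by (simp add: mass_upto_def n_def)
    qed
    have "l k < \<mu> \<longleftrightarrow> k < n" for k
    proof
      assume lk: "l k < \<mu>"
      have "mass_upto m (l k) \<le> n"
        unfolding mass_upto_def n_def using lk by (intro sum_mono2 finS) auto
      then show "k < n" using le[of k "l k"] by simp
    next
      assume k: "k < n"
      have "?S \<noteq> {}"
      proof
        assume "?S = {}"
        then have "n = 0" unfolding n_def by (simp only: sum.empty)
        then show False using k by simp
      qed
      then have "\<exists>\<nu>\<in>?S. (\<forall>\<nu>'\<in>?S. \<nu>' \<le> \<nu>) \<and> (\<Sum>\<nu>\<in>?S. m \<nu>) = mass_upto m \<nu>"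
        by (intro Max_mass finS) auto
      then obtain \<nu> where \<nu>: "\<nu> \<in> ?S" "n = mass_upto m \<nu>"
        unfolding n_def by blast
      then show "l k < \<mu>" using k le[of k \<nu>] by simp
    qed
    then have "\<not> l k < \<mu> \<longleftrightarrow> n \<le> k" for k by (simp add: not_less)
    moreover have "l k \<le> \<mu> \<longleftrightarrow> k < n + m \<mu>" for k using le[of k \<mu>] total by simp
    ultimately have "l k = \<mu> \<longleftrightarrow> n \<le> k \<and> k < n + m \<mu>" for k
      by (metis linorder_not_less order.antisym order.refl)
    then have "{k. l k = \<mu>} = {n..<n + m \<mu>}"
      by (intro set_eqI) (simp only: mem_Collect_eq atLeastLessThan_iff)
    then show ?thesis by simp
  qed
  ultimately show ?thesis unfolding enumerates_def by blast
qed

lemma the_enumeration: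
  "enumerates m (THE l. enumerates m l)"
  "(THE l. enumerates m l) k \<le> c \<longleftrightarrow> k < mass_upto m c"
proof -
  show *: "enumerates m (THE l. enumerates m l)"
    using theI'[OF ex_ex1I, of "enumerates m"] enumerates_exists enumerates_unique by blast
  show "(THE l. enumerates m l) k \<le> c \<longleftrightarrow> k < mass_upto m c"
    by (rule enumerates_le_iff[OF *])
qed

text \<open>\<open>c'\<close> plays the part of the left limit at c: no atom lies strictly between
  the two. The point c - 1 is added only to have a maximum when there is no atom below c.\<close>

lemma mass_upto_left:
  obtains c' where "c' < c" "mass_upto m c = mass_upto m c' + m c"
    "\<And>b. b < c \<Longrightarrow> mass_upto m b \<le> mass_upto m c'"
proof -
  let ?S = "{\<nu>. \<nu> < c \<and> 0 < m \<nu>}"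
  have finS: "finite ?S" by (rule finite_subset[OF _ fin[of c]]) auto
  define c' where "c' = Max (insert (c - 1) ?S)"
  have c': "c' < c" "\<And>\<nu>. \<nu> \<in> ?S \<Longrightarrow> \<nu> \<le> c'"
    unfolding c'_def using finS by (simp_all add: Max_less_iff Max_ge)
  then have S: "?S = {\<nu>. \<nu> \<le> c' \<and> 0 < m \<nu>}" by auto
  have "mass_upto m c = mass_upto m c' + m c"
  proof (cases "0 < m c")
    case True
    then have "{\<nu>. \<nu> \<le> c \<and> 0 < m \<nu>} = insert c ?S" by auto
    then show ?thesis using finS by (simp add: mass_upto_def flip: S)
  next
    case False
    then have "{\<nu>. \<nu> \<le> c \<and> 0 < m \<nu>} = ?S" by (auto simp: order.order_iff_strict)
    then show ?thesis using False by (simp add: mass_upto_def flip: S)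
  qed
  moreover have "mass_upto m b \<le> mass_upto m c'" if "b < c" for b
    using that unfolding mass_upto_def S[symmetric] by (intro sum_mono2[OF finS]) auto
  ultimately show ?thesis using c'(1) that by blast
qed

end


text \<open>\<open>k\<close> counts from 0 and stands for j = k + 1. The implication
  \<open>d \<le> k \<longrightarrow> ...\<close> guards the truncated difference and merges the two
  cases of the range.\<close>

lemma interlacing_range:
  assumes D: "discrete_mass mD" and F: "\<And>m. m \<in> \<F> \<Longrightarrow> discrete_mass m"
    and inter: "\<And>m c. m \<in> \<F> \<Longrightarrow> mass_upto mD c \<le> mass_upto m c \<and> mass_upto m c \<le> mass_upto mD c + d"
    and attain: "\<And>c. \<exists>m\<in>\<F>. mD c + d \<le> m c"
    and eD: "\<And>k c. lD k \<le> c \<longleftrightarrow> k < mass_upto mD c"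
    and eF: "\<And>m k c. m \<in> \<F> \<Longrightarrow> l m k \<le> c \<longleftrightarrow> k < mass_upto m c"
  shows "(\<lambda>m. l m k) ` \<F> = {c. c \<le> lD k \<and> (d \<le> k \<longrightarrow> lD (k - d) \<le> c)}"
proof (intro equalityI subsetI)
  fix x assume "x \<in> (\<lambda>m. l m k) ` \<F>"
  then obtain m where m: "m \<in> \<F>" "x = l m k" by blast
  have "l m k \<le> lD k"
    using inter[OF m(1), of "lD k"] eF[OF m(1), of k "lD k"] eD[of k "lD k"] by auto
  moreover have "lD (k - d) \<le> l m k" if "d \<le> k"
    using inter[OF m(1), of "l m k"] eF[OF m(1), of k "l m k"] eD[of "k - d" "l m k"] that by auto
  ultimately show "x \<in> {c. c \<le> lD k \<and> (d \<le> k \<longrightarrow> lD (k - d) \<le> c)}" using m by simp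
next
  fix c assume c: "c \<in> {c. c \<le> lD k \<and> (d \<le> k \<longrightarrow> lD (k - d) \<le> c)}"
  obtain m where m: "m \<in> \<F>" "mD c + d \<le> m c" using attain by blast
  obtain c1 where c1: "c1 < c" "mass_upto mD c = mass_upto mD c1 + mD c"
    using discrete_mass.mass_upto_left[OF D, of c] by blast
  obtain c2 where c2: "c2 < c" "mass_upto m c = mass_upto m c2 + m c"
    "\<And>b. b < c \<Longrightarrow> mass_upto m b \<le> mass_upto m c2"
    using discrete_mass.mass_upto_left[OF F[OF m(1)], of c] by blast
  have k1: "\<not> k < mass_upto mD c1" using eD[of k c1] c c1 by auto
  \<comment> \<open>The d extra units at c use up the room that interlacing leaves, so below c there
    is no more mass than for \<open>mD\<close>.\<close>
  have "mass_upto m c2 \<le> mass_upto mD c1"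
    using inter[OF m(1), of c] c1(2) c2(2) m(2) by linarith
  then have below: "\<not> l m k \<le> b" if "b < c" for b
    using c2(3)[OF that] k1 eF[OF m(1), of k b] by linarith
  have "k < mass_upto m c"
  proof -
    have "mass_upto mD c1 \<le> mass_upto m c2" using inter[OF m(1), of c1] c2(3)[OF c1(1)] by linarith
    then have "mass_upto mD c + d \<le> mass_upto m c" using c1 c2 m(2) by linarith
    moreover have "k - d < mass_upto mD c" if "d \<le> k" using c eD[of "k - d" c] that by auto
    ultimately show ?thesis by linarith
  qed
  then have "l m k \<le> c" using eF[OF m(1)] by blast
  moreover have "c \<le> l m k" using below by (meson not_le order_refl)
  ultimately show "c \<in> (\<lambda>m. l m k) ` \<F>" using m(1) by (intro image_eqI[of _ _ m]) auto
qed

section \<open>Calculus with derivatives that exist only as integrable functions\<close>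

section \<open>Absolutely continuous functions and linear differential equations\<close>


text \<open>The L^1 version of \<open>has_weak_deriv\<close>. The product rule is proved in this
  class, and square integrability is restored afterwards.\<close>

definition ac_deriv :: "real \<Rightarrow> (real \<Rightarrow> 'a::euclidean_space) \<Rightarrow> (real \<Rightarrow> 'a) \<Rightarrow> bool" where
  "ac_deriv T f g \<longleftrightarrow> g absolutely_integrable_on {0..T} \<and>
     (\<forall>t\<in>{0..T}. (g has_integral (f t - f 0)) {0..t})"

lemma L2_absolutely_integrable:
  assumes "L2 T g"
  shows "g absolutely_integrable_on {0..T}"
proof (rule measurable_bounded_by_integrable_imp_absolutely_integrable)
  show "g \<in> borel_measurable (lebesgue_on {0..T})" using assms by (simp add: L2_def)
  have "integrable (lebesgue_on {0..T}) (\<lambda>t. 1 + (norm (g t))\<^sup>2)"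
    using assms by (intro Bochner_Integration.integrable_add) (auto simp: L2_def)
  then show "(\<lambda>t. 1 + (norm (g t))\<^sup>2) integrable_on {0..T}"
    by (simp add: integrable_on_lebesgue_on)
  show "norm (g x) \<le> 1 + (norm (g x))\<^sup>2" for x
  proof -
    have "0 \<le> (norm (g x) - 1)\<^sup>2 + norm (g x)" by simp
    then show ?thesis by (simp add: power2_eq_square algebra_simps)
  qed
qed simp

lemma has_weak_deriv_ac_deriv: "has_weak_deriv T f g \<Longrightarrow> ac_deriv T f g"
  by (simp add: has_weak_deriv_def ac_deriv_def L2_absolutely_integrable)

lemma ac_deriv_increment:
  assumes f: "ac_deriv T f g" and st: "0 \<le> s" "s \<le> t" "t \<le> T"
  shows "(g has_integral (f t - f s)) {s..t}"
proof -
  have t: "(g has_integral (f t - f 0)) {0..t}" and s: "(g has_integral (f s - f 0)) {0..s}"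
    using f st by (auto simp: ac_deriv_def)
  have i: "g integrable_on {0..t}" using t by blast
  then have "g integrable_on {s..t}" using st by (rule_tac integrable_on_subinterval) auto
  moreover have "integral {0..s} g + integral {s..t} g = integral {0..t} g"
    using Henstock_Kurzweil_Integration.integral_combine[OF st(1,2) i] .
  then have "integral {s..t} g = f t - f s"
    using integral_unique[OF t] integral_unique[OF s] by (simp add: algebra_simps)
  ultimately show ?thesis by (simp add: has_integral_iff)
qed

lemma ac_deriv_continuous:
  assumes "ac_deriv T f g"
  shows "continuous_on {0..T} f"
proof -
  have "g integrable_on {0..T}"
    using assms by (simp add: ac_deriv_def set_lebesgue_integral_eq_integral(1))
  then have "continuous_on {0..T} (\<lambda>t. f 0 + integral {0..t} g)"
    by (intro continuous_intros indefinite_integral_continuous_1)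
  then show ?thesis
  proof (rule continuous_on_eq)
    fix t assume "t \<in> {0..T}"
    then have "integral {0..t} g = f t - f 0"
      using assms by (intro integral_unique) (simp add: ac_deriv_def)
    then show "f 0 + integral {0..t} g = f t" by simp
  qed
qed

text \<open>Increments bounded by an arbitrarily small multiple of those of a fixed function V add
  up to nothing. V takes the place of t because the derivatives below are unbounded and merely
  integrable.\<close>

lemma constant_of_small_increments:
  fixes D :: "real \<Rightarrow> 'a::real_normed_vector" and V :: "real \<Rightarrow> real"
  assumes small: "\<And>e. 0 < e \<Longrightarrow> \<exists>d>0. \<forall>s t. 0 \<le> s \<longrightarrow> s \<le> t \<longrightarrow> t \<le> T \<longrightarrow> t - s < d \<longrightarrow>
      norm (D t - D s) \<le> e * (V t - V s)"
    and t: "0 \<le> t" "t \<le> T"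
  shows "D t = D 0"
proof -
  have bound: "norm (D t - D 0) \<le> e * (V t - V 0)" if e: "0 < e" for e
  proof -
    obtain d where d: "0 < d" "\<And>s t. 0 \<le> s \<Longrightarrow> s \<le> t \<Longrightarrow> t \<le> T \<Longrightarrow> t - s < d \<Longrightarrow>
      norm (D t - D s) \<le> e * (V t - V s)"
      using small[OF e] by blast
    \<comment> \<open>The bound is chained along steps of length d/2, which is safely below d; the
      increments of V telescope.\<close>
    have step: "\<forall>u. 0 \<le> u \<and> u \<le> T \<and> u \<le> real n * (d / 2) \<longrightarrow> norm (D u - D 0) \<le> e * (V u - V 0)" for n
    proof (induction n)
      case 0
      show ?case
      proof (intro allI impI)
        fix u assume "0 \<le> u \<and> u \<le> T \<and> u \<le> real 0 * (d / 2)"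
        then have "u = 0" by simp
        then show "norm (D u - D 0) \<le> e * (V u - V 0)" by simp
      qed
    next
      case (Suc n)
      show ?case
      proof (intro allI impI)
        fix u assume u: "0 \<le> u \<and> u \<le> T \<and> u \<le> real (Suc n) * (d / 2)"
        define s where "s = max 0 (u - d / 2)"
        have s: "0 \<le> s" "s \<le> u" "u \<le> T" "u - s < d" using u d(1) by (auto simp: s_def)
        have "s \<le> real n * (d / 2)" using u d(1) by (auto simp: s_def algebra_simps max_def)
        then have "norm (D s - D 0) \<le> e * (V s - V 0)" using Suc s by auto
        moreover have "norm (D u - D s) \<le> e * (V u - V s)" by (rule d(2)[OF s])
        moreover have "norm (D u - D 0) \<le> norm (D u - D s) + norm (D s - D 0)"
          using norm_triangle_ineq[of "D u - D s" "D s - D 0"] by simp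
        ultimately show "norm (D u - D 0) \<le> e * (V u - V 0)" by (simp add: algebra_simps)
      qed
    qed
    obtain n where "t / (d / 2) \<le> real n" using real_arch_simple by blast
    then have "t \<le> real n * (d / 2)" using d(1) by (simp add: field_simps)
    then show ?thesis using step t by blast
  qed
  have "norm (D t - D 0) \<le> 0"
  proof (rule field_le_epsilon)
    fix e :: real assume e: "0 < e"
    define c where "c = e / (\<bar>V t - V 0\<bar> + 1)"
    have c: "0 < c" using e by (simp add: c_def)
    have "norm (D t - D 0) \<le> c * (V t - V 0)" by (rule bound[OF c])
    also have "\<dots> \<le> c * (\<bar>V t - V 0\<bar> + 1)" using c by (intro mult_left_mono) auto
    also have "\<dots> = e" by (simp add: c_def)
    finally show "norm (D t - D 0) \<le> 0 + e" by simp
  qed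
  then show ?thesis by simp
qed

lemma continuous_borel_measurable_lebesgue_on:
  fixes f :: "real \<Rightarrow> 'a::euclidean_space"
  shows "continuous_on {0..T} f \<Longrightarrow> f \<in> borel_measurable (lebesgue_on {0..T})"
  by (rule continuous_imp_measurable_on_sets_lebesgue) auto

lemma continuous_bounded_image:
  fixes f :: "real \<Rightarrow> 'a::euclidean_space"
  shows "continuous_on {0..T} f \<Longrightarrow> bounded (f ` {0..T})"
  by (simp add: compact_continuous_image compact_imp_bounded)

lemma absolutely_integrable_continuous_bilinear:
  fixes h :: "'a::euclidean_space \<Rightarrow> 'b::euclidean_space \<Rightarrow> 'c::euclidean_space" and T :: real
  assumes h: "bounded_bilinear h"
  shows "continuous_on {0..T} f \<Longrightarrow> g absolutely_integrable_on {0..T} \<Longrightarrow>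
      (\<lambda>t. h (f t) (g t)) absolutely_integrable_on {0..T}"
    and "continuous_on {0..T} g \<Longrightarrow> f absolutely_integrable_on {0..T} \<Longrightarrow>
      (\<lambda>t. h (f t) (g t)) absolutely_integrable_on {0..T}"
proof -
  have b: "bilinear h" using h by (simp add: bilinear_conv_bounded_bilinear)
  then have b': "bilinear (\<lambda>x y. h y x)" by (simp add: bilinear_def)
  show "continuous_on {0..T} f \<Longrightarrow> g absolutely_integrable_on {0..T} \<Longrightarrow>
      (\<lambda>t. h (f t) (g t)) absolutely_integrable_on {0..T}"
    by (rule absolutely_integrable_bounded_measurable_product[OF b])
      (auto simp: continuous_borel_measurable_lebesgue_on continuous_bounded_image)
  show "continuous_on {0..T} g \<Longrightarrow> f absolutely_integrable_on {0..T} \<Longrightarrow>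
      (\<lambda>t. h (f t) (g t)) absolutely_integrable_on {0..T}"
    by (rule absolutely_integrable_bounded_measurable_product[OF b'])
      (auto simp: continuous_borel_measurable_lebesgue_on continuous_bounded_image)
qed

text \<open>No differentiation almost everywhere is involved. On a short interval f and g can be
  frozen at end points, with an error that uniform continuity makes small relative to the integral
  of |f'| + |g'|.\<close>

lemma ac_deriv_bilinear:
  fixes h :: "'a::euclidean_space \<Rightarrow> 'b::euclidean_space \<Rightarrow> 'c::euclidean_space"
  assumes h: "bounded_bilinear h" and f: "ac_deriv T f f'" and g: "ac_deriv T g g'"
  shows "ac_deriv T (\<lambda>t. h (f t) (g t)) (\<lambda>t. h (f' t) (g t) + h (f t) (g' t))"
proof -
  interpret bounded_bilinear h by (rule h)
  obtain K where K: "0 < K" "\<And>a b. norm (h a b) \<le> norm a * norm b * K" using pos_bounded by blast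
  have cf: "continuous_on {0..T} f" and cg: "continuous_on {0..T} g"
    using f g by (simp_all add: ac_deriv_continuous)
  have af: "f' absolutely_integrable_on {0..T}" and ag: "g' absolutely_integrable_on {0..T}"
    using f g by (simp_all add: ac_deriv_def)
  define I where "I = (\<lambda>t. h (f' t) (g t) + h (f t) (g' t))"
  \<comment> \<open>V dominates the increments of D, the defect in the integrated product rule, up
    to the factor e.\<close>
  define V where "V t = integral {0..t} (\<lambda>r. norm (f' r) + norm (g' r))" for t
  define D where "D t = h (f t) (g t) - integral {0..t} I" for t
  have aI: "I absolutely_integrable_on {0..T}"
    unfolding I_def using absolutely_integrable_continuous_bilinear[OF h] cf cg af ag
    by (intro set_integral_add) auto
  have iI: "I integrable_on {0..T}" using aI by (simp add: set_lebesgue_integral_eq_integral(1))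
  have iV: "(\<lambda>r. norm (f' r) + norm (g' r)) integrable_on {0..T}"
    using af ag by (intro integrable_add) (simp_all add: absolutely_integrable_on_def)
  have Dconst: "D t = D 0" if t: "0 \<le> t" "t \<le> T" for t
  proof (rule constant_of_small_increments[OF _ t, of D V])
    fix e :: real assume e: "0 < e"
    define e' where "e' = e / K"
    have e': "0 < e'" using e K by (simp add: e'_def)
    obtain d1 where d1: "0 < d1"
      "\<forall>x\<in>{0..T}. \<forall>y\<in>{0..T}. dist y x < d1 \<longrightarrow> dist (f y) (f x) < e'"
      using compact_uniformly_continuous[OF cf compact_Icc] e' unfolding uniformly_continuous_on_def
      by (elim allE[of _ e'] impE) auto
    obtain d2 where d2: "0 < d2"
      "\<forall>x\<in>{0..T}. \<forall>y\<in>{0..T}. dist y x < d2 \<longrightarrow> dist (g y) (g x) < e'"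
      using compact_uniformly_continuous[OF cg compact_Icc] e' unfolding uniformly_continuous_on_def
      by (elim allE[of _ e'] impE) auto
    have "norm (D t - D s) \<le> e * (V t - V s)" if st: "0 \<le> s" "s \<le> t" "t \<le> T" "t - s < min d1 d2" for s t
    proof -
      have I1: "((\<lambda>r. h (f' r) (g s)) has_integral h (f t - f s) (g s)) {s..t}"
        using has_integral_linear[OF ac_deriv_increment[OF f st(1-3)] bounded_linear_left[of "g s"]]
        by (simp add: o_def)
      have I2: "((\<lambda>r. h (f t) (g' r)) has_integral h (f t) (g t - g s)) {s..t}"
        using has_integral_linear[OF ac_deriv_increment[OF g st(1-3)] bounded_linear_right[of "f t"]]
        by (simp add: o_def)
      have It: "I integrable_on {0..t}" and Ist: "I integrable_on {s..t}"
        using iI st by (auto elim!: integrable_on_subinterval)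
      have Vt: "(\<lambda>r. norm (f' r) + norm (g' r)) integrable_on {0..t}"
        and Vst: "(\<lambda>r. norm (f' r) + norm (g' r)) integrable_on {s..t}"
        using iV st by (auto elim!: integrable_on_subinterval)
      have "((\<lambda>r. h (f' r) (g s) + h (f t) (g' r) - I r) has_integral
          (h (f t - f s) (g s) + h (f t) (g t - g s) - integral {s..t} I)) {s..t}"
        by (intro has_integral_diff has_integral_add I1 I2 integrable_integral Ist)
      moreover have "h (f t - f s) (g s) + h (f t) (g t - g s) - integral {s..t} I = D t - D s"
        using Henstock_Kurzweil_Integration.integral_combine[OF st(1,2) It] by (simp add: D_def diff_left diff_right algebra_simps)
      ultimately have hi: "((\<lambda>r. h (f' r) (g s) + h (f t) (g' r) - I r) has_integral (D t - D s)) {s..t}"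
        by simp
      have "norm (integral {s..t} (\<lambda>r. h (f' r) (g s) + h (f t) (g' r) - I r))
          \<le> integral {s..t} (\<lambda>r. e * (norm (f' r) + norm (g' r)))"
      proof (rule integral_norm_bound_integral)
        show "(\<lambda>r. h (f' r) (g s) + h (f t) (g' r) - I r) integrable_on {s..t}" using hi by blast
        show "(\<lambda>r. e * (norm (f' r) + norm (g' r))) integrable_on {s..t}"
          using integrable_on_cmult_left[OF Vst, of e] by simp
        fix r assume r: "r \<in> {s..t}"
        \<comment> \<open>f is frozen at t and g at s, so the difference of the products is exact
          and the integrand contains only differences over the short interval.\<close>
        have eq: "h (f' r) (g s) + h (f t) (g' r) - I r = h (f' r) (g s - g r) + h (f t - f r) (g' r)"
          by (simp add: I_def diff_left diff_right)
        have "dist (g s) (g r) < e'" by (rule d2(2)[rule_format]) (use r st in \<open>auto simp: dist_real_def\<close>)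
        then have n1: "norm (h (f' r) (g s - g r)) \<le> norm (f' r) * e' * K"
          using K(1) by (intro order_trans[OF K(2)] mult_right_mono mult_left_mono) (auto simp: dist_norm)
        have "dist (f t) (f r) < e'" by (rule d1(2)[rule_format]) (use r st in \<open>auto simp: dist_real_def\<close>)
        then have n2: "norm (h (f t - f r) (g' r)) \<le> e' * norm (g' r) * K"
          using K(1) by (intro order_trans[OF K(2)] mult_right_mono) (auto simp: dist_norm)
        have "norm (h (f' r) (g s - g r) + h (f t - f r) (g' r)) \<le> norm (f' r) * e' * K + e' * norm (g' r) * K"
          by (rule order_trans[OF norm_triangle_ineq add_mono[OF n1 n2]])
        also have "\<dots> = e * (norm (f' r) + norm (g' r))"
          using K(1) by (simp add: e'_def field_simps)
        finally show "norm (h (f' r) (g s) + h (f t) (g' r) - I r) \<le> e * (norm (f' r) + norm (g' r))"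
          unfolding eq .
      qed
      also have "\<dots> = e * (V t - V s)"
        using Henstock_Kurzweil_Integration.integral_combine[OF st(1,2) Vt] by (simp add: V_def)
      finally show ?thesis using integral_unique[OF hi] by simp
    qed
    then show "\<exists>d>0. \<forall>s t. 0 \<le> s \<longrightarrow> s \<le> t \<longrightarrow> t \<le> T \<longrightarrow> t - s < d \<longrightarrow> norm (D t - D s) \<le> e * (V t - V s)"
      using d1(1) d2(1) by (intro exI[of _ "min d1 d2"]) auto
  qed
  have "(I has_integral (h (f t) (g t) - h (f 0) (g 0))) {0..t}" if t: "t \<in> {0..T}" for t
  proof -
    have "I integrable_on {0..t}" using iI t by (auto elim!: integrable_on_subinterval)
    moreover have "integral {0..t} I = h (f t) (g t) - h (f 0) (g 0)"
      using Dconst[of t] t by (simp add: D_def algebra_simps)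
    ultimately show ?thesis by (simp add: has_integral_iff)
  qed
  then show ?thesis using aI by (simp add: ac_deriv_def I_def)
qed

text \<open>The coefficient is only integrable, so the interval is cut by the values of the integral
  E of k, not by length: while E grows by at most 1/2, the maximum of |w| is at most half of
  itself.\<close>

lemma gronwall_zero:
  fixes w :: "real \<Rightarrow> 'a::real_normed_vector" and k :: "real \<Rightarrow> real"
  assumes k: "k integrable_on {0..T}" "\<And>t. t \<in> {0..T} \<Longrightarrow> 0 \<le> k t"
    and w: "continuous_on {0..T} w" "w 0 = 0"
    and kw: "(\<lambda>r. k r * norm (w r)) integrable_on {0..T}"
    and incr: "\<And>s t. 0 \<le> s \<Longrightarrow> s \<le> t \<Longrightarrow> t \<le> T \<Longrightarrow>
      norm (w t - w s) \<le> integral {s..t} (\<lambda>r. k r * norm (w r))"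
    and t: "t \<in> {0..T}"
  shows "w t = 0"
proof -
  define E where "E t = integral {0..t} k" for t
  have contE: "continuous_on {0..T} E" unfolding E_def using k(1) by (rule indefinite_integral_continuous_1)
  have E0: "E 0 = 0" by (simp add: E_def)
  have Ediff: "integral {s..t} k = E t - E s" if "0 \<le> s" "s \<le> t" "t \<le> T" for s t
  proof -
    have "k integrable_on {0..t}" using k(1) that by (auto elim!: integrable_on_subinterval)
    then show ?thesis using Henstock_Kurzweil_Integration.integral_combine[OF that(1,2)] by (simp add: E_def algebra_simps)
  qed
  have step: "\<forall>t\<in>{0..T}. E t \<le> real n / 2 \<longrightarrow> w t = 0" for n
  proof (induction n)
    case 0
    show ?case
    proof (intro ballI impI)
      fix t assume t: "t \<in> {0..T}" and E: "E t \<le> real 0 / 2"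
      obtain p where p: "p \<in> {0..t}" "\<And>s. s \<in> {0..t} \<Longrightarrow> norm (w s) \<le> norm (w p)"
        using continuous_attains_sup[of "{0..t}" "\<lambda>s. norm (w s)"] w(1) t
        by (force intro: continuous_on_norm continuous_on_subset)
      have kp: "k integrable_on {0..p}" "(\<lambda>r. k r * norm (w r)) integrable_on {0..p}"
        using k(1) kw p t by (auto elim!: integrable_on_subinterval)
      have kt: "k integrable_on {0..t}" "k integrable_on {p..t}" using k(1) p t by (auto elim!: integrable_on_subinterval)
      have "0 \<le> integral {p..t} k" using k(2) p t kt by (intro integral_nonneg) auto
      then have Ep: "E p \<le> 0" using Ediff[of p t] p t E by auto
      have "norm (w p - w 0) \<le> integral {0..p} (\<lambda>r. k r * norm (w r))" using incr[of 0 p] p t by auto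
      also have "\<dots> \<le> integral {0..p} (\<lambda>r. k r * norm (w p))"
        using kp p t k(2) by (intro integral_le integrable_on_mult_left mult_left_mono) auto
      also have "\<dots> = E p * norm (w p)" by (simp add: E_def)
      also have "\<dots> \<le> 0" using Ep by (simp add: mult_nonpos_nonneg)
      finally have "w p = 0" using w(2) by simp
      then show "w t = 0" using p(2)[of t] t by simp
    qed
  next
    case (Suc n)
    show ?case
    proof (intro ballI impI)
      fix t assume t: "t \<in> {0..T}" and E: "E t \<le> real (Suc n) / 2"
      obtain p where p: "p \<in> {0..t}" "\<And>s. s \<in> {0..t} \<Longrightarrow> norm (w s) \<le> norm (w p)"
        using continuous_attains_sup[of "{0..t}" "\<lambda>s. norm (w s)"] w(1) t
        by (force intro: continuous_on_norm continuous_on_subset)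
      have kt: "k integrable_on {p..t}" using k(1) p t by (auto elim!: integrable_on_subinterval)
      have "0 \<le> integral {p..t} k" using k(2) p t kt by (intro integral_nonneg) auto
      then have Ep: "E p \<le> real (Suc n) / 2" using Ediff[of p t] p t E by auto
      have "w p = 0"
      proof (cases "E p \<le> real n / 2")
        case True
        then show ?thesis using Suc p t by auto
      next
        case False
        moreover have "continuous_on {0..p} E" using contE by (rule continuous_on_subset) (use p t in auto)
        \<comment> \<open>E passes the value n/2 at q, where w vanishes by the induction hypothesis;
          from q to p the integral of k is at most 1/2.\<close>
        ultimately obtain q where q: "0 \<le> q" "q \<le> p" "E q = real n / 2"
          using IVT'[of E 0 "real n / 2" p] E0 p by auto
        then have wq: "w q = 0" using Suc p t by auto
        have kq: "k integrable_on {q..p}" "(\<lambda>r. k r * norm (w r)) integrable_on {q..p}"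
          using k(1) kw p q t by (auto elim!: integrable_on_subinterval)
        have "norm (w p - w q) \<le> integral {q..p} (\<lambda>r. k r * norm (w r))" using incr[of q p] p q t by auto
        also have "\<dots> \<le> integral {q..p} (\<lambda>r. k r * norm (w p))"
          using kq p q t k(2) by (intro integral_le integrable_on_mult_left mult_left_mono) auto
        also have "\<dots> = (E p - E q) * norm (w p)" using Ediff[of q p] p q t by simp
        also have "\<dots> \<le> (1 / 2) * norm (w p)"
          using Ep q by (intro mult_right_mono) (auto simp: field_simps)
        finally show ?thesis using wq by simp
      qed
      then show "w t = 0" using p(2)[of t] t by simp
    qed
  qed
  obtain n where "2 * E t \<le> real n" using real_arch_simple by blast
  then show ?thesis using step[of n] t by auto
qed

text \<open>The exponential weight with rate 2L turns the Picard operator into a contraction with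
  factor 1/2 on the whole interval, so no continuation of local solutions is needed.\<close>

lemma lipschitz_ode_solution:
  fixes F :: "real \<Rightarrow> 'a::euclidean_space \<Rightarrow> 'a"
  assumes T: "0 < T"
    and cont: "\<And>z. continuous_on {0..T} z \<Longrightarrow> continuous_on {0..T} (\<lambda>t. F t (z t))"
    and lip: "0 < L" "\<And>t z w. t \<in> {0..T} \<Longrightarrow> norm (F t z - F t w) \<le> L * norm (z - w)"
  shows "\<exists>z. z 0 = z0 \<and> (\<forall>t\<in>{0..T}. (z has_vector_derivative F t (z t)) (at t within {0..T}))"
proof -
  define G where "G w t = exp (- 2 * L * t) *\<^sub>R (z0 + integral {0..t} (\<lambda>s. F s (exp (2 * L * s) *\<^sub>R w s)))"
    for w :: "real \<Rightarrow> 'a" and t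
  have cFw: "continuous_on {0..T} (\<lambda>s. F s (exp (2 * L * s) *\<^sub>R w s))"
    if "continuous_on {0..T} w" for w :: "real \<Rightarrow> 'a"
    using that by (intro cont continuous_intros)
  \<comment> \<open>\<open>clamp\<close> extends G constantly beyond the end points. The unknown
    then lives in the complete space of bounded continuous functions on the line.\<close>
  have "\<exists>g :: real \<Rightarrow>\<^sub>C 'a. \<forall>x. apply_bcontfun g x = G (apply_bcontfun w) (clamp 0 T x)" for w
  proof -
    have "continuous_on {0..T} (G (apply_bcontfun w))"
      unfolding G_def
      by (intro continuous_intros indefinite_integral_continuous_1 integrable_continuous_interval cFw) auto
    then have "continuous_on (cbox 0 T) (G (apply_bcontfun w))" by simp
    from continuous_on_cbox_bcontfunE[OF this]
    obtain g :: "real \<Rightarrow>\<^sub>C 'a" where "\<And>x. apply_bcontfun g x = G (apply_bcontfun w) (clamp 0 T x)" by metis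
    then show ?thesis by blast
  qed
  then obtain \<Phi> :: "(real \<Rightarrow>\<^sub>C 'a) \<Rightarrow> (real \<Rightarrow>\<^sub>C 'a)"
    where \<Phi>: "\<And>w x. apply_bcontfun (\<Phi> w) x = G (apply_bcontfun w) (clamp 0 T x)" by metis
  have contr: "dist (\<Phi> v) (\<Phi> w) \<le> (1 / 2) * dist v w" for v w
  proof (rule dist_bound)
    fix x
    define t where "t = clamp 0 T x"
    have t: "t \<in> {0..T}" using clamp_in_interval[of 0 T x] T by (simp add: t_def)
    have sub: "{0..t} \<subseteq> {0..T}" using t by auto
    let ?f = "\<lambda>w s. F s (exp (2 * L * s) *\<^sub>R apply_bcontfun w s)"
    have cv: "continuous_on {0..t} (?f w)" for w
      by (rule continuous_on_subset[OF cFw sub]) auto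
    have "norm (integral {0..t} (?f v) - integral {0..t} (?f w)) = norm (integral {0..t} (\<lambda>s. ?f v s - ?f w s))"
      by (subst integral_diff) (auto intro: integrable_continuous_interval cv)
    also have "\<dots> \<le> integral {0..t} (\<lambda>s. L * exp (2 * L * s) * dist v w)"
    proof (rule integral_norm_bound_integral)
      show "(\<lambda>s. ?f v s - ?f w s) integrable_on {0..t}"
        by (intro integrable_continuous_interval continuous_intros cv)
      show "(\<lambda>s. L * exp (2 * L * s) * dist v w) integrable_on {0..t}"
        by (intro integrable_continuous_interval continuous_intros)
      fix s assume s: "s \<in> {0..t}"
      have "norm (?f v s - ?f w s) \<le> L * norm (exp (2 * L * s) *\<^sub>R apply_bcontfun v s - exp (2 * L * s) *\<^sub>R apply_bcontfun w s)"
        using s t by (intro lip(2)) auto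
      also have "\<dots> = L * exp (2 * L * s) * dist (apply_bcontfun v s) (apply_bcontfun w s)"
        by (simp add: dist_norm flip: scaleR_diff_right)
      also have "\<dots> \<le> L * exp (2 * L * s) * dist v w"
        using lip(1) by (intro mult_left_mono dist_bounded) auto
      finally show "norm (?f v s - ?f w s) \<le> L * exp (2 * L * s) * dist v w" .
    qed
    also have "\<dots> = (exp (2 * L * t) - 1) / 2 * dist v w"
    proof -
      have "((\<lambda>s. L * exp (2 * L * s) * dist v w) has_integral
          (exp (2 * L * t) / 2 * dist v w - exp (2 * L * 0) / 2 * dist v w)) {0..t}"
        using t by (intro fundamental_theorem_of_calculus)
          (auto intro!: derivative_eq_intros simp flip: has_real_derivative_iff_has_vector_derivative)
      from integral_unique[OF this] show ?thesis by (simp add: left_diff_distrib diff_divide_distrib)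
    qed
    finally have n: "norm (integral {0..t} (?f v) - integral {0..t} (?f w)) \<le> (exp (2 * L * t) - 1) / 2 * dist v w" .
    have "dist (\<Phi> v x) (\<Phi> w x) = exp (- 2 * L * t) * norm (integral {0..t} (?f v) - integral {0..t} (?f w))"
      unfolding \<Phi> t_def[symmetric] G_def dist_norm by (simp flip: scaleR_diff_right)
    also have "\<dots> \<le> exp (- 2 * L * t) * ((exp (2 * L * t) - 1) / 2 * dist v w)"
      using n by (intro mult_left_mono) auto
    also have "\<dots> = (1 - exp (- 2 * L * t)) / 2 * dist v w"
    proof -
      have "exp (- 2 * L * t) * exp (2 * L * t) = 1" by (simp flip: exp_add)
      then show ?thesis by (simp add: algebra_simps diff_divide_distrib)
    qed
    also have "\<dots> \<le> 1 / 2 * dist v w" by (intro mult_right_mono) auto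
    finally show "dist (\<Phi> v x) (\<Phi> w x) \<le> 1 / 2 * dist v w" .
  qed
  obtain w where w: "\<Phi> w = w"
    using banach_fix_type[of "1 / 2" \<Phi>] contr by auto
  define z where "z t = exp (2 * L * t) *\<^sub>R apply_bcontfun w t" for t
  have cz: "continuous_on {0..T} (\<lambda>s. F s (z s))" unfolding z_def by (rule cFw) auto
  have zt: "z t = z0 + integral {0..t} (\<lambda>s. F s (z s))" if t: "t \<in> {0..T}" for t
  proof -
    have "apply_bcontfun w t = G (apply_bcontfun w) (clamp 0 T t)" using \<Phi>[of w t] w by simp
    moreover have "clamp 0 T t = t" using t by (intro clamp_cancel_cbox) simp
    ultimately have "z t = (exp (2 * L * t) * exp (- 2 * L * t)) *\<^sub>R (z0 + integral {0..t} (\<lambda>s. F s (z s)))"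
      by (simp only: z_def G_def scaleR_scaleR)
    then show ?thesis by (simp flip: exp_add)
  qed
  have "(z has_vector_derivative F t (z t)) (at t within {0..T})" if t: "t \<in> {0..T}" for t
  proof -
    have "((\<lambda>u. z0 + integral {0..u} (\<lambda>s. F s (z s))) has_vector_derivative (0 + F t (z t))) (at t within {0..T})"
      by (intro has_vector_derivative_add has_vector_derivative_const integral_has_vector_derivative cz t)
    then show ?thesis
      using zt t by (intro has_vector_derivative_transform[of t "{0..T}" z]) auto
  qed
  moreover have "z 0 = z0" using zt[of 0] T by simp
  ultimately show ?thesis by blast
qed


section \<open>Real matrices acting on complex vectors\<close>

definition mv :: "real ^ 'n ^ 'm \<Rightarrow> complex ^ 'n \<Rightarrow> complex ^ 'm" where
  "mv A v = cmat A *v v"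

lemma mv_nth: "mv A v $ i = (\<Sum>j\<in>UNIV. of_real (A $ i $ j) * v $ j)"
  by (simp add: mv_def matrix_vector_mult_def)

text \<open>With the real matrix as an argument the action is real bilinear, so the product rule and
  the estimates for bounded bilinear maps apply to P x', Q x and R x.\<close>

lemma mv_bilinear: "bounded_bilinear (mv :: real ^ 'n ^ 'm \<Rightarrow> complex ^ 'n \<Rightarrow> complex ^ 'm)"
  unfolding bilinear_conv_bounded_bilinear[symmetric] bilinear_def
  by (auto intro!: linearI
      simp: vec_eq_iff mv_nth sum.distrib[symmetric] sum_distrib_left scaleR_conv_of_real[where 'a = complex] algebra_simps
      )

lemma mv_scale: "mv A (c *s v) = c *s mv A v"
  by (simp add: vec_eq_iff mv_nth sum_distrib_left mult_ac)

lemma mv_mat1: "mv (mat 1) v = v"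
proof -
  have "of_real ((mat 1 :: real ^ 'a ^ 'a) $ i $ j) * v $ j = (if j = i then v $ j else 0)" for i j
    by (simp add: mat_def)
  then show ?thesis by (simp add: vec_eq_iff mv_nth)
qed

lemma mv_assoc: "mv A (mv B v) = mv (A ** B) v"
proof -
  have "(\<Sum>j\<in>UNIV. \<Sum>k\<in>UNIV. of_real (A $ i $ j) * (of_real (B $ j $ k) * v $ k)) =
      (\<Sum>k\<in>UNIV. \<Sum>j\<in>UNIV. of_real (A $ i $ j) * (of_real (B $ j $ k) * v $ k))" for i
    by (rule sum.swap)
  then show ?thesis
    by (simp add: vec_eq_iff mv_nth matrix_matrix_mult_def sum_distrib_left sum_distrib_right mult.assoc)
qed

interpretation mv: bounded_bilinear mv by (rule mv_bilinear)

lemma herm_mv: "herm (mv A u) v = herm u (mv (transpose A) v)"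
proof -
  have "(\<Sum>i\<in>UNIV. \<Sum>j\<in>UNIV. of_real (A $ i $ j) * u $ j * cnj (v $ i)) =
      (\<Sum>j\<in>UNIV. \<Sum>i\<in>UNIV. of_real (A $ i $ j) * u $ j * cnj (v $ i))"
    by (rule sum.swap)
  then show ?thesis
    by (simp add: herm_def mv_nth transpose_def sum_distrib_left sum_distrib_right mult_ac)
qed

lemma herm_simps:
  "herm (u + v) w = herm u w + herm v w" "herm w (u + v) = herm w u + herm w v"
  "herm (u - v) w = herm u w - herm v w" "herm w (u - v) = herm w u - herm w v"
  "herm (c *s u) w = c * herm u w" "herm w (c *s u) = cnj c * herm w u"
  "herm 0 w = 0" "herm w 0 = 0" "herm (- u) w = - herm u w" "herm w (- u) = - herm w u"
  by (simp_all add: herm_def sum.distrib sum_subtractf sum_distrib_left algebra_simps sum_negf)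

lemma herm_sym: "herm v u = cnj (herm u v)"
  by (simp add: herm_def mult.commute)

lemma Re_herm: "Re (herm u v) = u \<bullet> v"
  by (simp add: herm_def inner_vec_def inner_complex_def)

lemma herm_self: "herm u u = of_real ((norm u)\<^sup>2)"
  using arg_cong[OF herm_sym[of u u], of Im]
  by (simp add: complex_eq_iff Re_herm power2_norm_eq_inner)

lemma herm_bilinear: "bounded_bilinear herm"
  unfolding bilinear_conv_bounded_bilinear[symmetric] bilinear_def
  by (auto intro!: linearI simp: herm_def sum.distrib sum_distrib_left scaleR_conv_of_real[where 'a = complex] algebra_simps)

interpretation herm: bounded_bilinear herm by (rule herm_bilinear)

lemma vector_scalar_bounded_linear: "bounded_linear (\<lambda>v :: complex ^ 'n. c *s v)"
  by (rule linear_conv_bounded_linear[THEN iffD1], rule linearI)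
    (simp_all add: vec_eq_iff scaleR_conv_of_real[where 'a = complex] algebra_simps)

lemma of_real_vector_scalar: "complex_of_real a *s v = a *\<^sub>R v"
  by (simp add: vec_eq_iff scaleR_conv_of_real[where 'a = complex])

text \<open>Cramer's rule exhibits the entries of the inverse matrix as continuous functions of
  the entries of the matrix.\<close>

definition cramer_inverse :: "real ^ 'n ^ 'n \<Rightarrow> real ^ 'n ^ 'n" where
  "cramer_inverse A = (\<chi> k c. det (\<chi> i j. if j = k then axis c 1 $ i else A $ i $ j) / det A)"

lemma cramer_inverse:
  assumes "det A \<noteq> 0"
  shows "A ** cramer_inverse A = mat 1" "cramer_inverse A ** A = mat 1"
proof -
  have "A *v column c (cramer_inverse A) = axis c 1" for c
    by (subst cramer[OF assms]) (simp add: vec_eq_iff column_def cramer_inverse_def)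
  then show *: "A ** cramer_inverse A = mat 1"
    by (simp add: vec_eq_iff matrix_matrix_mult_def matrix_vector_mult_def column_def mat_def axis_def)
  show "cramer_inverse A ** A = mat 1" using * by (simp add: matrix_left_right_inverse)
qed

lemma continuous_on_det:
  fixes A :: "'b::topological_space \<Rightarrow> real ^ 'n ^ 'n"
  assumes "\<And>i j. continuous_on S (\<lambda>t. A t $ i $ j)"
  shows "continuous_on S (\<lambda>t. det (A t))"
  unfolding det_def by (intro continuous_intros assms)

lemma continuous_on_cramer_inverse:
  fixes A :: "real \<Rightarrow> real ^ 'n ^ 'n"
  assumes A: "continuous_on S A" and det: "\<And>t. t \<in> S \<Longrightarrow> det (A t) \<noteq> 0"
  shows "continuous_on S (\<lambda>t. cramer_inverse (A t))"
proof -
  have c: "continuous_on S (\<lambda>t. A t $ i $ j)" for i j by (intro continuous_on_component A)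
  have "continuous_on S (\<lambda>t. (\<chi> i j. if j = k then axis b 1 $ i else A t $ i $ j :: real ^ 'n ^ 'n) $ i $ j)"
    for k b i j
    by (cases "j = k") (simp_all add: c)
  then show ?thesis
    unfolding cramer_inverse_def
    by (intro continuous_on_vec_lambda continuous_on_divide continuous_on_det c ballI det)
qed

section \<open>Square integrable derivatives and regularity in H^1\<close>

lemma L2_continuous:
  fixes f :: "real \<Rightarrow> 'a::euclidean_space"
  assumes "continuous_on {0..T} f"
  shows "L2 T f"
  unfolding L2_def using assms
  by (intro conjI continuous_borel_measurable_lebesgue_on continuous_imp_integrable_real continuous_intros)

lemma L2_add:
  assumes "L2 T f" "L2 T g"
  shows "L2 T (\<lambda>t. f t + g t)"
  unfolding L2_def
proof
  show m: "(\<lambda>t. f t + g t) \<in> borel_measurable (lebesgue_on {0..T})"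
    using assms by (auto simp: L2_def)
  have "integrable (lebesgue_on {0..T}) (\<lambda>t. 2 * (norm (f t))\<^sup>2 + 2 * (norm (g t))\<^sup>2)"
    using assms by (auto simp: L2_def)
  then show "integrable (lebesgue_on {0..T}) (\<lambda>t. (norm (f t + g t))\<^sup>2)"
  proof (rule Bochner_Integration.integrable_bound)
    show "(\<lambda>t. (norm (f t + g t))\<^sup>2) \<in> borel_measurable (lebesgue_on {0..T})" using m by measurable
    have "(norm (f t + g t))\<^sup>2 \<le> 2 * (norm (f t))\<^sup>2 + 2 * (norm (g t))\<^sup>2" for t
    proof -
      have "(norm (f t + g t))\<^sup>2 \<le> (norm (f t) + norm (g t))\<^sup>2"
        by (intro power_mono norm_triangle_ineq) auto
      also have "\<dots> \<le> 2 * (norm (f t))\<^sup>2 + 2 * (norm (g t))\<^sup>2"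
        using sum_squares_bound[of "norm (f t)" "norm (g t)"] by (simp add: power2_sum)
      finally show ?thesis .
    qed
    then show "AE t in lebesgue_on {0..T}. norm ((norm (f t + g t))\<^sup>2) \<le> norm (2 * (norm (f t))\<^sup>2 + 2 * (norm (g t))\<^sup>2)"
      by auto
  qed
qed

lemma L2_continuous_bilinear:
  fixes h :: "'a::euclidean_space \<Rightarrow> 'b::euclidean_space \<Rightarrow> 'c::euclidean_space"
  assumes h: "bounded_bilinear h" and f: "continuous_on {0..T} f" and g: "L2 T g"
  shows "L2 T (\<lambda>t. h (f t) (g t))"
  unfolding L2_def
proof
  interpret bounded_bilinear h by (rule h)
  obtain K where K: "0 < K" "\<And>a b. norm (h a b) \<le> norm a * norm b * K" using pos_bounded by blast
  obtain B where B: "\<And>t. t \<in> {0..T} \<Longrightarrow> norm (f t) \<le> B"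
    using continuous_bounded_image[OF f] unfolding bounded_iff by blast
  have ag: "g absolutely_integrable_on {0..T}" using g by (rule L2_absolutely_integrable)
  have "(\<lambda>t. h (f t) (g t)) absolutely_integrable_on {0..T}"
    using absolutely_integrable_continuous_bilinear(1)[OF h f ag] .
  then show m: "(\<lambda>t. h (f t) (g t)) \<in> borel_measurable (lebesgue_on {0..T})"
    by (simp add: absolutely_integrable_measurable)
  have "integrable (lebesgue_on {0..T}) (\<lambda>t. (B * K)\<^sup>2 * (norm (g t))\<^sup>2)"
    using g by (auto simp: L2_def)
  then show "integrable (lebesgue_on {0..T}) (\<lambda>t. (norm (h (f t) (g t)))\<^sup>2)"
  proof (rule Bochner_Integration.integrable_bound)
    show "(\<lambda>t. (norm (h (f t) (g t)))\<^sup>2) \<in> borel_measurable (lebesgue_on {0..T})" using m by measurable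
    have "(norm (h (f t) (g t)))\<^sup>2 \<le> (B * K)\<^sup>2 * (norm (g t))\<^sup>2" if t: "t \<in> {0..T}" for t
    proof -
      have "norm (h (f t) (g t)) \<le> norm (f t) * norm (g t) * K" by (rule K(2))
      also have "\<dots> \<le> B * norm (g t) * K" using B[OF t] K(1) by (intro mult_right_mono) auto
      finally have "(norm (h (f t) (g t)))\<^sup>2 \<le> (B * norm (g t) * K)\<^sup>2" by (intro power_mono) auto
      then show ?thesis by (simp add: power_mult_distrib mult_ac)
    qed
    then show "AE t in lebesgue_on {0..T}. norm ((norm (h (f t) (g t)))\<^sup>2) \<le> norm ((B * K)\<^sup>2 * (norm (g t))\<^sup>2)"
      by (intro AE_I2) (auto simp: space_restrict_space)
  qed
qed

lemma L2_bilinear_continuous: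
  fixes h :: "'a::euclidean_space \<Rightarrow> 'b::euclidean_space \<Rightarrow> 'c::euclidean_space"
  assumes h: "bounded_bilinear h" and f: "L2 T f" and g: "continuous_on {0..T} g"
  shows "L2 T (\<lambda>t. h (f t) (g t))"
  using L2_continuous_bilinear[OF bounded_bilinear.flip[OF h] g f] .

lemma has_weak_deriv_bilinear:
  fixes h :: "'a::euclidean_space \<Rightarrow> 'b::euclidean_space \<Rightarrow> 'c::euclidean_space"
  assumes h: "bounded_bilinear h" and f: "has_weak_deriv T f f'" and g: "has_weak_deriv T g g'"
  shows "has_weak_deriv T (\<lambda>t. h (f t) (g t)) (\<lambda>t. h (f' t) (g t) + h (f t) (g' t))"
proof -
  have ac: "ac_deriv T f f'" "ac_deriv T g g'" using f g by (simp_all add: has_weak_deriv_ac_deriv)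
  then have c: "continuous_on {0..T} f" "continuous_on {0..T} g" by (simp_all add: ac_deriv_continuous)
  have l: "L2 T f'" "L2 T g'" using f g by (simp_all add: has_weak_deriv_def)
  have "L2 T (\<lambda>t. h (f' t) (g t) + h (f t) (g' t))"
    by (intro L2_add L2_bilinear_continuous[OF h l(1) c(2)] L2_continuous_bilinear[OF h c(1) l(2)])
  then show ?thesis using ac_deriv_bilinear[OF h ac] by (simp add: has_weak_deriv_def ac_deriv_def)
qed

lemma has_weak_deriv_diff:
  assumes "has_weak_deriv T f f'" "has_weak_deriv T g g'"
  shows "has_weak_deriv T (\<lambda>t. f t - g t) (\<lambda>t. f' t - g' t)"
proof -
  have "L2 T (\<lambda>t. - g' t)" using assms(2) by (auto simp: has_weak_deriv_def L2_def)
  then have "L2 T (\<lambda>t. f' t + - g' t)" using assms(1) by (intro L2_add) (auto simp: has_weak_deriv_def)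
  moreover have "((\<lambda>t. f' t - g' t) has_integral (f t - g t) - (f 0 - g 0)) {0..t}" if "t \<in> {0..T}" for t
    using has_integral_diff[of f' "f t - f 0" "{0..t}" g' "g t - g 0"] assms that
    by (simp add: has_weak_deriv_def algebra_simps)
  ultimately show ?thesis by (simp add: has_weak_deriv_def)
qed

lemma has_weak_deriv_C1:
  assumes "\<And>t. t \<in> {0..T} \<Longrightarrow> (f has_vector_derivative f' t) (at t within {0..T})" "continuous_on {0..T} f'"
  shows "has_weak_deriv T f f'"
proof -
  have "(f' has_integral (f t - f 0)) {0..t}" if t: "t \<in> {0..T}" for t
  proof (rule fundamental_theorem_of_calculus)
    fix s assume "s \<in> {0..t}"
    then show "(f has_vector_derivative f' s) (at s within {0..t})"
      using t by (intro has_vector_derivative_within_subset[OF assms(1)]) auto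
  qed (use t in simp)
  then show ?thesis using L2_continuous[OF assms(2)] by (simp add: has_weak_deriv_def)
qed

text \<open>The passage from the operator equation, which holds almost everywhere, to a classical
  one: changing the weak derivative on a null set keeps its integrals, and the integral of a
  continuous function is differentiable at every point.\<close>

lemma has_weak_deriv_continuous_imp_C1:
  assumes f: "has_weak_deriv T f f'" and c: "continuous_on {0..T} g"
    and ae: "AE t in lebesgue_on {0..T}. f' t = g t" and t: "t \<in> {0..T}"
  shows "(f has_vector_derivative g t) (at t within {0..T})"
proof -
  have "AE t in lebesgue. t \<in> {0..T} \<longrightarrow> f' t = g t"
    using ae by (subst (asm) AE_restrict_space_iff) auto
  then obtain N where N: "N \<in> null_sets lebesgue" "{t. \<not> (t \<in> {0..T} \<longrightarrow> f' t = g t)} \<subseteq> N"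
    by (auto simp: eventually_ae_filter)
  have i: "(g has_integral (f s - f 0)) {0..s}" if s: "s \<in> {0..T}" for s
  proof (rule has_integral_spike)
    show "negligible N" using N(1) by (simp add: negligible_iff_null_sets)
    show "(f' has_integral (f s - f 0)) {0..s}" using f s by (simp add: has_weak_deriv_def)
    show "g x = f' x" if "x \<in> {0..s} - N" for x using N(2) that s by auto
  qed
  have D: "((\<lambda>u. f 0 + integral {0..u} g) has_vector_derivative (0 + g t)) (at t within {0..T})"
    by (intro has_vector_derivative_add has_vector_derivative_const integral_has_vector_derivative c t)
  have eq: "f s = f 0 + integral {0..s} g" if "s \<in> {0..T}" for s
    using integral_unique[OF i[OF that]] by simp
  show ?thesis
    using has_vector_derivative_transform[OF t eq D] by simp
qed

text \<open>The candidate derivative \<open>A\<^sup>-\<^sup>1 (h' - A' g)\<close> integrates to a function \<open>S\<close> for which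
  \<open>A S - h\<close> satisfies a homogeneous linear equation with integrable coefficient.\<close>

lemma H1_solution_of_linear_system:
  fixes A :: "real \<Rightarrow> real ^ 'n ^ 'n" and g h :: "real \<Rightarrow> complex ^ 'n"
  assumes T: "0 < T" and A: "H1 T A" and h: "H1 T h" and g: "continuous_on {0..T} g"
    and det: "\<And>t. t \<in> {0..T} \<Longrightarrow> det (A t) \<noteq> 0"
    and eq: "\<And>t. t \<in> {0..T} \<Longrightarrow> mv (A t) (g t) = h t"
  shows "H1 T g"
proof -
  obtain A' where A': "has_weak_deriv T A A'" using A by (auto simp: H1_def)
  obtain h' where h': "has_weak_deriv T h h'" using h by (auto simp: H1_def)
  have cA: "continuous_on {0..T} A" using A' has_weak_deriv_ac_deriv ac_deriv_continuous by blast
  define B where "B t = cramer_inverse (A t)" for t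
  have cB: "continuous_on {0..T} B" unfolding B_def by (rule continuous_on_cramer_inverse[OF cA det])
  have BA: "mv (B t) (mv (A t) v) = v" "mv (A t) (mv (B t) v) = v" if "t \<in> {0..T}" for t v
    using cramer_inverse[OF det[OF that]] by (simp_all add: mv_assoc B_def mv_mat1)
  have l2: "L2 T A'" "L2 T h'" using A' h' by (simp_all add: has_weak_deriv_def)
  define N where "N t = mv (B t) (h' t + - mv (A' t) (g t))" for t
  have "L2 T (\<lambda>t. mv (A' t) (g t))" by (rule L2_bilinear_continuous[OF mv_bilinear l2(1) g])
  then have "L2 T (\<lambda>t. - mv (A' t) (g t))" by (auto simp: L2_def)
  then have l2N: "L2 T N" unfolding N_def
    by (intro L2_continuous_bilinear[OF mv_bilinear cB] L2_add l2)
  then have aN: "N absolutely_integrable_on {0..T}" by (rule L2_absolutely_integrable)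
  then have iN: "N integrable_on {0..T}" by (simp add: set_lebesgue_integral_eq_integral(1))
  define S where "S t = g 0 + integral {0..t} N" for t
  have NS: "(N has_integral (S t - S 0)) {0..t}" if "t \<in> {0..T}" for t
  proof -
    have "N integrable_on {0..t}" using iN that by (auto elim!: integrable_on_subinterval)
    then show ?thesis by (simp add: S_def has_integral_iff)
  qed
  have wS: "has_weak_deriv T S N" using l2N NS by (simp add: has_weak_deriv_def)
  define w where "w t = mv (A t) (S t) - h t" for t
  have cw: "continuous_on {0..T} w" unfolding w_def
    using has_weak_deriv_ac_deriv[OF wS] has_weak_deriv_ac_deriv[OF h']
    by (intro continuous_on_diff mv.continuous_on cA) (auto dest: ac_deriv_continuous)
  have "has_weak_deriv T w (\<lambda>t. (mv (A' t) (S t) + mv (A t) (N t)) - h' t)"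
    unfolding w_def by (rule has_weak_deriv_diff[OF has_weak_deriv_bilinear[OF mv_bilinear A' wS] h'])
  then have aw: "ac_deriv T w (\<lambda>t. (mv (A' t) (S t) + mv (A t) (N t)) - h' t)"
    by (rule has_weak_deriv_ac_deriv)
  obtain K where K: "0 < K" "\<And>(C :: real ^ 'n ^ 'n) v. norm (mv C v) \<le> norm C * norm v * K"
    using mv.pos_bounded by blast
  obtain b where b: "\<And>t. t \<in> {0..T} \<Longrightarrow> norm (B t) \<le> b"
    using continuous_bounded_image[OF cB] unfolding bounded_iff by blast
  have b0: "0 \<le> b" using b[of 0] T norm_ge_zero[of "B 0"] by (meson atLeastAtMost_iff less_imp_le order_refl order_trans)
  define k where "k t = (K * K * b) * norm (A' t)" for t
  \<comment> \<open>From A N = h' - A' g the derivative of w is A' (S - g), and w = A (S - g) gives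
    S - g = B w. The derivative of S has cancelled.\<close>
  have w': "norm ((mv (A' t) (S t) + mv (A t) (N t)) - h' t) \<le> k t * norm (w t)" if t: "t \<in> {0..T}" for t
  proof -
    have "mv (A t) (N t) = h' t - mv (A' t) (g t)" unfolding N_def by (simp add: BA(2)[OF t])
    then have "(mv (A' t) (S t) + mv (A t) (N t)) - h' t = mv (A' t) (S t - g t)"
      by (simp add: mv.diff_right)
    also have "S t - g t = mv (B t) (w t)"
      unfolding w_def eq[OF t, symmetric] by (simp add: mv.diff_right BA(1)[OF t])
    finally have "norm ((mv (A' t) (S t) + mv (A t) (N t)) - h' t) = norm (mv (A' t) (mv (B t) (w t)))" by simp
    also have "\<dots> \<le> norm (A' t) * (norm (B t) * norm (w t) * K) * K"
      using K(1) by (intro order_trans[OF K(2)] mult_right_mono mult_left_mono K(2)) auto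
    also have "\<dots> \<le> norm (A' t) * (b * norm (w t) * K) * K"
      using K(1) b[OF t] by (intro mult_right_mono mult_left_mono) auto
    finally show ?thesis by (simp add: k_def mult_ac)
  qed
  have aA': "A' absolutely_integrable_on {0..T}" using l2(1) by (rule L2_absolutely_integrable)
  have "(\<lambda>t. norm (A' t)) absolutely_integrable_on {0..T}" 
    using absolutely_integrable_norm[OF aA'] by (simp add: o_def)
  then have ak: "k absolutely_integrable_on {0..T}" unfolding k_def
    by (intro set_integrable_mult_right) auto
  have akw: "(\<lambda>t. k t * norm (w t)) absolutely_integrable_on {0..T}"
    by (rule absolutely_integrable_continuous_bilinear(2)[OF bounded_bilinear_mult])
      (intro continuous_intros cw ak)+
  have w0: "w t = 0" if t: "t \<in> {0..T}" for t
  proof (rule gronwall_zero[of k T w, OF _ _ cw _ _ _ t])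
    show "k integrable_on {0..T}" "(\<lambda>t. k t * norm (w t)) integrable_on {0..T}"
      using ak akw by (simp_all add: set_lebesgue_integral_eq_integral(1))
    show "0 \<le> k t" for t using K(1) b0 by (simp add: k_def)
    show "w 0 = 0" using eq[of 0] T by (simp add: w_def S_def)
    fix s t assume st: "0 \<le> s" "s \<le> t" "t \<le> T"
    note i = ac_deriv_increment[OF aw st]
    have "norm (integral {s..t} (\<lambda>t. (mv (A' t) (S t) + mv (A t) (N t)) - h' t)) \<le>
        integral {s..t} (\<lambda>t. k t * norm (w t))"
    proof (rule integral_norm_bound_integral)
      show "(\<lambda>t. (mv (A' t) (S t) + mv (A t) (N t)) - h' t) integrable_on {s..t}" using i by blast
      have "(\<lambda>t. k t * norm (w t)) integrable_on {0..T}"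
        using akw by (simp add: set_lebesgue_integral_eq_integral(1))
      then show "(\<lambda>t. k t * norm (w t)) integrable_on {s..t}"
        using st by (auto elim!: integrable_on_subinterval)
    qed (use w' st in auto)
    then show "norm (w t - w s) \<le> integral {s..t} (\<lambda>t. k t * norm (w t))"
      using integral_unique[OF i] by simp
  qed
  have gS: "g t = S t" if t: "t \<in> {0..T}" for t
  proof -
    have "mv (A t) (S t) = mv (A t) (g t)" using w0[OF t] eq[OF t] by (simp add: w_def)
    then have "mv (B t) (mv (A t) (S t)) = mv (B t) (mv (A t) (g t))" by (rule arg_cong)
    then show ?thesis by (simp only: BA(1)[OF t])
  qed
  have "has_weak_deriv T g N"
    using wS gS T by (auto simp: has_weak_deriv_def)
  then show ?thesis unfolding H1_def by blast
qed

section \<open>Boundary conditions in the Hermitian symplectic space\<close>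

section \<open>Lagrangian subspaces\<close>


lemma vjoin_simps [simp]:
  "vfst (vjoin u v) = u" "vsnd (vjoin u v) = v" "vjoin (vfst w) (vsnd w) = w"
  by (simp_all add: vec_eq_iff vfst_def vsnd_def vjoin_def split: sum.split)

lemma vfst_vsnd_linear:
  fixes u v :: "complex ^ ('m::finite + 'k::finite)"
  shows
  "vfst (u + v) = vfst u + vfst v" "vsnd (u + v) = vsnd u + vsnd v"
  "vfst (u - v) = vfst u - vfst v" "vsnd (u - v) = vsnd u - vsnd v"
  "vfst (c *s u) = c *s vfst u" "vsnd (c *s u) = c *s vsnd u"
  "vfst (a *\<^sub>R u) = a *\<^sub>R vfst u" "vsnd (a *\<^sub>R u) = a *\<^sub>R vsnd u"
  "vfst (0 :: complex ^ ('m + 'k)) = 0" "vsnd (0 :: complex ^ ('m + 'k)) = 0"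
  by (simp_all add: vec_eq_iff vfst_def vsnd_def)

lemma vjoin_linear:
  fixes u u' :: "complex ^ 'm::finite" and v v' :: "complex ^ 'k::finite"
  shows "vjoin u v + vjoin u' v' = vjoin (u + u') (v + v')" "c *s vjoin u v = vjoin (c *s u) (c *s v)"
    "vjoin (0 :: complex ^ 'm) (0 :: complex ^ 'k) = 0"
  by (simp_all add: vec_eq_iff vjoin_def split: sum.split)

lemma vec_eqI_parts: "vfst u = vfst v \<Longrightarrow> vsnd u = vsnd v \<Longrightarrow> u = v"
  by (metis vjoin_simps(3))

lemma sum_UNIV_Plus:
  fixes f :: "'m::finite + 'k::finite \<Rightarrow> 'b::comm_monoid_add"
  shows "(\<Sum>i\<in>UNIV. f i) = (\<Sum>a\<in>UNIV. f (Inl a)) + (\<Sum>b\<in>UNIV. f (Inr b))"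
  by (simp add: UNIV_Plus_UNIV[symmetric] sum.Plus del: UNIV_Plus_UNIV)

lemma herm_parts: "herm u v = herm (vfst u) (vfst v) + herm (vsnd u) (vsnd v)"
  by (simp add: herm_def sum_UNIV_Plus vfst_def vsnd_def)

lemma norm_parts: "(norm w)\<^sup>2 = (norm (vfst w))\<^sup>2 + (norm (vsnd w))\<^sup>2"
  for w :: "complex ^ ('m::finite + 'k::finite)"
  using herm_parts[of w w] by (simp add: herm_self flip: of_real_add of_real_power)

lemma norm_part_le: "norm (vfst w) \<le> norm w" "norm (vsnd w) \<le> norm w"
  for w :: "complex ^ ('m::finite + 'k::finite)"
  by (rule power2_le_imp_le; simp add: norm_parts)+

lemma Jmat_mult: "Jmat *v u = vjoin (- vsnd u) (vfst u)"
  by (simp add: vec_eq_iff matrix_vector_mult_def Jmat_def vjoin_def vfst_def vsnd_def sum_UNIV_Plus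
      if_distrib[of "\<lambda>x. x * _"] cong: if_cong split: sum.split)

lemma omega_parts: "omega u v = herm (vfst u) (vsnd v) - herm (vsnd u) (vfst v)"
  unfolding omega_def Jmat_mult by (subst herm_parts) (simp add: herm_simps)

text \<open>The boundary term <y(T), x(T)> - <y(0), x(0)> of integration by parts, with y from the
  first and x from the second argument. \<open>Omega\<close> is its antisymmetrization.\<close>

definition bdry_form ::
    "complex ^ (('n::finite + 'n) + ('n + 'n)) \<Rightarrow> complex ^ (('n + 'n) + ('n + 'n)) \<Rightarrow> complex" where
  "bdry_form u v = herm (vfst (vsnd u)) (vsnd (vsnd v)) - herm (vfst (vfst u)) (vsnd (vfst v))"

lemma Omega_bdry_form: "Omega u v = bdry_form u v - cnj (bdry_form v u)"
  by (simp add: Omega_def omega_parts bdry_form_def herm_sym[of "vsnd (vfst u)"] herm_sym[of "vsnd (vsnd u)"])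

lemma bdry_form_simps:
  "bdry_form (u + v) w = bdry_form u w + bdry_form v w"
  "bdry_form w (u + v) = bdry_form w u + bdry_form w v"
  "bdry_form (c *s u) w = c * bdry_form u w" "bdry_form w (c *s u) = cnj c * bdry_form w u"
  by (simp_all add: bdry_form_def vfst_vsnd_linear herm_simps algebra_simps)

lemma Omega_simps:
  "Omega (u + v) w = Omega u w + Omega v w" "Omega w (u + v) = Omega w u + Omega w v"
  "Omega (c *s u) w = c * Omega u w" "Omega w (c *s u) = cnj c * Omega w u"
  by (simp_all add: Omega_bdry_form bdry_form_simps algebra_simps)

lemma Omega_skew: "Omega v u = - cnj (Omega u v)"
  by (simp add: Omega_bdry_form)

text \<open>One basis extension serves two ends: \<open>E\<close> spans a complement of
  \<open>S\<close>, and its coordinate functionals cut \<open>S\<close> out of \<open>V\<close>.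
  Coordinates are 0 by default off the span, so the functionals are linear on \<open>V\<close>
  only.\<close>

lemma vec_relative_codimension:
  fixes S V :: "(complex ^ 'm) set"
  assumes S: "vec.subspace S" and V: "vec.subspace V" and SV: "S \<subseteq> V"
  obtains E :: "(complex ^ 'm) set" and l where "finite E" "vec.dim V = vec.dim S + card E"
    "\<And>e x y. e \<in> E \<Longrightarrow> x \<in> V \<Longrightarrow> y \<in> V \<Longrightarrow> l e (x + y) = l e x + (l e y :: complex)"
    "\<And>e c x. e \<in> E \<Longrightarrow> x \<in> V \<Longrightarrow> l e (c *s x) = c * l e x"
    "\<And>v. v \<in> V \<Longrightarrow> \<forall>e\<in>E. l e v = 0 \<Longrightarrow> v \<in> S"
    "E \<subseteq> V" "vec.independent E" "vec.span E \<inter> S \<subseteq> {0}"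
proof -
  obtain B where B: "B \<subseteq> S" "vec.independent B" "S \<subseteq> vec.span B" "card B = vec.dim S"
    by (rule vec.basis_exists)
  have spB: "vec.span B = S" using B S by (simp add: vec.span_subspace)
  obtain B' where B': "B \<subseteq> B'" "B' \<subseteq> V" "vec.independent B'" "V \<subseteq> vec.span B'"
    using vec.maximal_independent_subset_extend[of B V] B SV by (metis order_trans)
  have fB': "finite B'" using B'(3) by (rule vec.finiteI_independent)
  have spB': "vec.span B' = V" using B' V by (simp add: vec.span_subspace)
  have c: "vec.dim V = card B'" using vec.basis_card_eq_dim[OF B'(2,4,3)] by simp
  define E where "E = B' - B"
  have card: "vec.dim V = vec.dim S + card E"
    unfolding c E_def B(4)[symmetric] using fB' B'(1)
    by (simp add: card_Diff_subset card_mono finite_subset)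
  define l where "l e v = vec.representation B' v e" for e v
  have add: "l e (x + y) = l e x + l e y" if "x \<in> V" "y \<in> V" for e x y
    unfolding l_def using that spB' B'(3) by (simp add: vec.representation_add)
  have scl: "l e (a *s x) = a * l e x" if "x \<in> V" for e a x
    unfolding l_def using that spB' B'(3) by (simp add: vec.representation_scale)
  have expand: "(\<Sum>b\<in>B'. vec.representation B' v b *s b) = v" if "v \<in> V" for v
    using vec.sum_representation_eq[OF B'(3) _ fB' order_refl] that spB' by blast
  have ker: "v \<in> S" if v: "v \<in> V" "\<forall>e\<in>E. l e v = 0" for v
  proof -
    have "v = (\<Sum>b\<in>B'. vec.representation B' v b *s b)" using expand[OF v(1)] by simp
    also have "\<dots> = (\<Sum>b\<in>B. vec.representation B' v b *s b)"
      using fB' B'(1) v(2) by (intro sum.mono_neutral_right) (auto simp: E_def l_def)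
    also have "\<dots> \<in> S"
      using B(1) by (intro vec.subspace_sum[OF S] vec.subspace_scale[OF S]) auto
    finally show ?thesis .
  qed
  have disj: "vec.span E \<inter> S \<subseteq> {0}"
  proof
    fix v assume v: "v \<in> vec.span E \<inter> S"
    have "vec.representation B' v = vec.representation E v"
      using v by (intro vec.representation_extend[OF B'(3)]) (auto simp: E_def)
    moreover have "vec.representation B' v = vec.representation B v"
      using v spB by (intro vec.representation_extend[OF B'(3)]) (auto simp: B')
    ultimately have "vec.representation B' v b = 0" for b
      using vec.representation_ne_zero[of E v b] vec.representation_ne_zero[of B v b] E_def by fastforce
    then show "v \<in> {0}" using expand[of v] v SV by auto
  qed
  have "vec.independent E" using B'(3) E_def by (meson Diff_subset vec.independent_mono)
  moreover have "finite E" "E \<subseteq> V" using fB' B'(2) by (auto simp: E_def)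
  ultimately show ?thesis
    using that[of E l, OF _ card add scl ker _ _ disj] by blast
qed

lemma vec_dim_Int:
  fixes S U V :: "(complex ^ 'm) set"
  assumes S: "vec.subspace S" "S \<subseteq> V" and U: "vec.subspace U" "U \<subseteq> V" and V: "vec.subspace V"
  shows "vec.dim U + vec.dim S \<le> vec.dim (U \<inter> S) + vec.dim V"
proof -
  obtain E :: "(complex ^ 'm) set" and l where E: "finite E" "vec.dim V = vec.dim S + card E"
    "\<And>e x y. e \<in> E \<Longrightarrow> x \<in> V \<Longrightarrow> y \<in> V \<Longrightarrow> l e (x + y) = l e x + (l e y :: complex)"
    "\<And>e c x. e \<in> E \<Longrightarrow> x \<in> V \<Longrightarrow> l e (c *s x) = c * l e x"
    "\<And>v. v \<in> V \<Longrightarrow> \<forall>e\<in>E. l e v = 0 \<Longrightarrow> v \<in> S"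
    by (rule vec_relative_codimension[OF S(1) V S(2)]) blast
  obtain B where B: "B \<subseteq> U" "vec.independent B" "U \<subseteq> vec.span B" "card B = vec.dim U"
    by (rule vec.basis_exists)
  have sB: "vec.span B = U" using B U by (simp add: vec.span_subspace)
  have fB: "finite B" using B(2) by (rule vec.finiteI_independent)
  have "\<exists>C. vec.independent C \<and> finite C \<and> C \<subseteq> vec.span B \<and> card B \<le> card C + card E \<and>
      (\<forall>i\<in>E. \<forall>c\<in>C. l i c = 0)"
    using sB U(2) by (intro vec.independent_kernel[OF E(1) B(2) fB] E(3,4)) auto
  then obtain C where C: "vec.independent C" "C \<subseteq> U" "card B \<le> card C + card E"
      "\<forall>i\<in>E. \<forall>c\<in>C. l i c = 0" using sB by auto
  have "C \<subseteq> U \<inter> S" using C E(5) U(2) by blast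
  then have "card C \<le> vec.dim (U \<inter> S)" using C(1) by (rule vec.independent_card_le_dim)
  then show ?thesis using C(3) E(2) B(4) by linarith
qed

text \<open>\<open>Omega u v\<close> is the Hermitian product of J u with v for an injective linear
  J. Isotropy makes J W orthogonal to W, so two subspaces of equal dimension meet trivially in a
  space of dimension 4n.\<close>

lemma isotropic_dim_le:
  fixes W :: "(complex ^ (('n::finite + 'n) + ('n + 'n))) set"
  assumes W: "vec.subspace W" and iso: "\<And>u v. u \<in> W \<Longrightarrow> v \<in> W \<Longrightarrow> Omega u v = 0"
  shows "vec.dim W \<le> 2 * CARD('n)"
proof -
  define J :: "complex ^ (('n + 'n) + ('n + 'n)) \<Rightarrow> complex ^ (('n + 'n) + ('n + 'n))" where
    "J u = vjoin (vjoin (vsnd (vfst u)) (- vfst (vfst u))) (vjoin (- vsnd (vsnd u)) (vfst (vsnd u)))" for u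
  have OJ: "Omega u v = herm (J u) v" for u v
    unfolding Omega_def omega_parts J_def by (simp add: herm_parts[where 'a = "'n + 'n"] herm_parts[where 'a = 'n] herm_simps)
  have add: "J (u + v) = J u + J v" for u v
    by (simp add: J_def vfst_vsnd_linear vjoin_linear)
  have scl: "J (c *s u) = c *s J u" for c u
    by (simp add: J_def vfst_vsnd_linear vjoin_linear vec.scale_minus_right)
  have ker: "u = 0" if "J u = 0" for u
  proof -
    have *: "vfst (vfst (J u)) = 0" "vsnd (vfst (J u)) = 0" "vfst (vsnd (J u)) = 0" "vsnd (vsnd (J u)) = 0"
      unfolding that by (simp_all add: vfst_vsnd_linear)
    show ?thesis
      by (intro vec_eqI_parts) (use * in \<open>simp_all add: J_def vfst_vsnd_linear\<close>)
  qed
  have sJ: "vec.subspace (J ` W)"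
    unfolding vec.subspace_def
  proof (intro conjI ballI allI)
    show "0 \<in> J ` W" using scl[of 0 0] vec.subspace_0[OF W] by (intro image_eqI[of _ _ 0]) auto
    show "x + y \<in> J ` W" if "x \<in> J ` W" "y \<in> J ` W" for x y
      using that add vec.subspace_add[OF W] by (metis (no_types, lifting) image_iff)
    show "c *s x \<in> J ` W" if "x \<in> J ` W" for c x
      using that scl vec.subspace_scale[OF W] by (metis (no_types, lifting) image_iff)
  qed
  have dJ: "vec.dim (J ` W) = vec.dim W"
    by (rule vec.dim_image_on[OF W]) (simp_all add: add scl ker)
  have "J ` W \<inter> W \<subseteq> {0}"
  proof
    fix w assume "w \<in> J ` W \<inter> W"
    then obtain u where u: "u \<in> W" "w = J u" "w \<in> W" by auto
    then have "herm w w = 0" using iso[of u w] OJ by simp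
    then show "w \<in> {0}" by (simp add: herm_self)
  qed
  then have "vec.dim (J ` W \<inter> W) = 0" by simp
  moreover have "vec.dim (J ` W) + vec.dim W \<le> vec.dim (J ` W \<inter> W) + vec.dim (UNIV :: (complex ^ (('n + 'n) + ('n + 'n))) set)"
    by (rule vec_dim_Int) (simp_all add: W sJ)
  moreover have "vec.dim (UNIV :: (complex ^ (('n + 'n) + ('n + 'n))) set) = 4 * CARD('n)"
    by (simp add: vec.dim_UNIV card_cart_basis card_UNIV_sum)
  ultimately show ?thesis using dJ by linarith
qed

lemma Dirichlet_Lag: "(Dirichlet :: (complex ^ (('n::finite + 'n) + ('n + 'n))) set) \<in> Lag"
proof -
  define D where "D = (Dirichlet :: (complex ^ (('n + 'n) + ('n + 'n))) set)"
  have sub: "vec.subspace D"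
    by (auto simp: vec.subspace_def D_def Dirichlet_def vfst_vsnd_linear)
  have iso: "Omega u v = 0" if "u \<in> D" "v \<in> D" for u v
    using that by (simp add: D_def Dirichlet_def Omega_bdry_form bdry_form_def herm_simps)
  define f :: "complex ^ ('n + 'n) \<Rightarrow> complex ^ (('n + 'n) + ('n + 'n))" where
    "f w = vjoin (vjoin (vfst w) 0) (vjoin (vsnd w) 0)" for w
  have fk: "w = 0" if "f w = 0" for w
  proof -
    have "vfst (vfst (f w)) = 0" "vfst (vsnd (f w)) = 0" unfolding that by (simp_all add: vfst_vsnd_linear)
    then show ?thesis by (intro vec_eqI_parts) (simp_all add: f_def vfst_vsnd_linear)
  qed
  have "vec.dim (f ` UNIV) = vec.dim (UNIV :: (complex ^ ('n + 'n)) set)"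
    by (rule vec.dim_image_on) (use fk in \<open>auto simp: f_def vfst_vsnd_linear vjoin_linear\<close>)
  moreover have "f ` UNIV \<subseteq> D" by (auto simp: f_def D_def Dirichlet_def)
  then have "vec.dim (f ` UNIV) \<le> vec.dim D" by (rule vec.dim_subset)
  moreover have "vec.dim (UNIV :: (complex ^ ('n + 'n)) set) = 2 * CARD('n)"
    by (simp add: vec.dim_UNIV card_cart_basis card_UNIV_sum)
  moreover have "vec.dim D \<le> 2 * CARD('n)" using isotropic_dim_le[OF sub iso] .
  ultimately show ?thesis using sub iso by (simp add: Lag_def flip: D_def)
qed

text \<open>To be used with k = d and D the Dirichlet subspace. As G is isotropic, its intersection
  with D is orthogonal to U for the symplectic form and hence lies in L; together with U this gives
  the k + dim (G \<inter> D) dimensions shared by G and L.\<close>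

lemma Lag_with_large_intersection:
  fixes G D :: "(complex ^ (('n::finite + 'n) + ('n + 'n))) set"
  assumes G: "G \<in> Lag" and D: "D \<in> Lag" and k: "k + vec.dim (G \<inter> D) \<le> 2 * CARD('n)"
  obtains L where "L \<in> Lag" "vec.dim (L \<inter> D) + k = 2 * CARD('n)"
    "k + vec.dim (G \<inter> D) \<le> vec.dim (G \<inter> L)"
proof -
  have sG: "vec.subspace G" and sD: "vec.subspace D"
    and iG: "\<And>u v. u \<in> G \<Longrightarrow> v \<in> G \<Longrightarrow> Omega u v = 0" and iD: "\<And>u v. u \<in> D \<Longrightarrow> v \<in> D \<Longrightarrow> Omega u v = 0"
    and dG: "vec.dim G = 2 * CARD('n)" and dD: "vec.dim D = 2 * CARD('n)"
    using G D by (auto simp: Lag_def)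
  have sGD: "vec.subspace (G \<inter> D)" using sG sD by (rule vec.subspace_inter)
  obtain E where E: "finite E" "vec.dim G = vec.dim (G \<inter> D) + card E"
    "E \<subseteq> G" "vec.independent E" "vec.span E \<inter> (G \<inter> D) \<subseteq> {0}"
    by (rule vec_relative_codimension[OF sGD sG]) auto
  have "k \<le> card E" using k E(2) dG by simp
  then obtain E' where E': "E' \<subseteq> E" "card E' = k" "finite E'" using obtain_subset_with_card_n by blast
  define U where "U = vec.span E'"
  have sU: "vec.subspace U" by (simp add: U_def)
  have indE': "vec.independent E'" using E(4) E'(1) by (rule vec.independent_mono)
  have dU: "vec.dim U = k" unfolding U_def using indE' E'(2) vec.dim_span_eq_card_independent by metis
  have UG: "U \<subseteq> G" unfolding U_def using E' E(3) sG by (intro vec.span_minimal) auto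
  have UD: "u = 0" if "u \<in> U" "u \<in> D" for u
  proof -
    have "u \<in> vec.span E" using that(1) vec.span_mono[OF E'(1)] U_def by blast
    then show ?thesis using that UG E(5) by blast
  qed
  define DU where "DU = {d \<in> D. \<forall>u\<in>U. Omega d u = 0}"
  have sDU: "vec.subspace DU"
    using sD unfolding DU_def vec.subspace_def by (auto simp: Omega_simps) (metis Omega_simps(3) mult_zero_left vec.scale_zero_left)
  have "2 * CARD('n) \<le> vec.dim DU + k"
  proof -
    obtain B where B: "B \<subseteq> D" "vec.independent B" "D \<subseteq> vec.span B" "card B = vec.dim D"
      by (rule vec.basis_exists)
    have sB: "vec.span B = D" using B sD by (simp add: vec.span_subspace)
    have fB: "finite B" using B(2) by (rule vec.finiteI_independent)
    have "\<exists>C. vec.independent C \<and> finite C \<and> C \<subseteq> vec.span B \<and> card B \<le> card C + card E' \<and>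
        (\<forall>i\<in>E'. \<forall>c\<in>C. Omega c i = 0)"
      by (rule vec.independent_kernel[OF E'(3) B(2) fB]) (simp_all add: Omega_simps)
    then obtain C where C: "vec.independent C" "C \<subseteq> D" "card B \<le> card C + card E'"
        "\<forall>i\<in>E'. \<forall>c\<in>C. Omega c i = 0" using sB by auto
    have "Omega c u = 0" if c: "c \<in> C" and u: "u \<in> U" for c u
      using u unfolding U_def
    proof (induction rule: vec.span_induct_alt)
      case base
      show ?case using Omega_simps(4)[of c 0 0] by simp
    next
      case (step a x y)
      then show ?case using C(4) c by (simp add: Omega_simps)
    qed
    then have "C \<subseteq> DU" using C(2) DU_def by auto
    then have "card C \<le> vec.dim DU" using C(1) by (rule vec.independent_card_le_dim)
    then show ?thesis using C(3) B(4) dD E'(2) by simp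
  qed
  define L where "L = {u + d |u d. u \<in> U \<and> d \<in> DU}"
  have sL: "vec.subspace L" unfolding L_def using sU sDU by (rule vec.subspace_sums)
  have UL: "U \<subseteq> L" unfolding L_def using vec.subspace_0[OF sDU] by force
  have DUL: "DU \<subseteq> L" unfolding L_def using vec.subspace_0[OF sU] by force
  have iL: "Omega v w = 0" if vw: "v \<in> L" "w \<in> L" for v w
  proof -
    obtain u d u' d' where v: "v = u + d" "u \<in> U" "d \<in> DU" and w: "w = u' + d'" "u' \<in> U" "d' \<in> DU"
      using vw L_def by auto
    have "Omega u u' = 0" using iG UG v w by blast
    moreover have "Omega d d' = 0" using iD v w DU_def by blast
    moreover have "Omega d u' = 0" "Omega d' u = 0" using v w DU_def by auto
    moreover from this have "Omega u d' = 0" using Omega_skew[of u d'] by simp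
    ultimately show ?thesis using v w by (simp add: Omega_simps)
  qed
  have "vec.dim L \<le> 2 * CARD('n)" using isotropic_dim_le[OF sL iL] .
  moreover have UDU: "U \<inter> DU \<subseteq> {0}" using UD DU_def by blast
  have "vec.dim (U \<inter> DU) = 0" using UDU by simp
  then have sumd: "k + vec.dim DU \<le> vec.dim L"
    using vec_dim_Int[OF sDU DUL sU UL sL] dU by linarith
  \<comment> \<open>Isotropy caps dim L at 2n, while U and \<open>DU\<close> contribute k and at
    least 2n - k independent dimensions; so both bounds are equalities.\<close>
  ultimately have dL: "vec.dim L = 2 * CARD('n)" "vec.dim DU + k = 2 * CARD('n)"
    using \<open>2 * CARD('n) \<le> vec.dim DU + k\<close> by simp_all
  have LD: "L \<inter> D = DU"
  proof
    show "DU \<subseteq> L \<inter> D" using DUL DU_def by blast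
    show "L \<inter> D \<subseteq> DU"
    proof
      fix v assume v: "v \<in> L \<inter> D"
      then obtain u d where ud: "v = u + d" "u \<in> U" "d \<in> DU" using L_def by auto
      have "u = v - d" using ud by simp
      then have "u \<in> D" using v ud vec.subspace_diff[OF sD] DU_def by blast
      then have "u = 0" using UD ud(2) by blast
      then show "v \<in> DU" using ud by simp
    qed
  qed
  have GDDU: "G \<inter> D \<subseteq> DU" using iG UG DU_def by blast
  have "k + vec.dim (G \<inter> D) \<le> vec.dim (G \<inter> L)"
  proof -
    have "vec.dim U + vec.dim (G \<inter> D) \<le> vec.dim (U \<inter> (G \<inter> D)) + vec.dim (G \<inter> L)"
      using GDDU DUL UL UG sG sL by (intro vec_dim_Int sU sGD vec.subspace_inter) auto
    moreover have "U \<inter> (G \<inter> D) \<subseteq> {0}" using UD by blast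
    then have "vec.dim (U \<inter> (G \<inter> D)) = 0" by simp
    ultimately show ?thesis using dU by linarith
  qed
  moreover have "L \<in> Lag" using sL iL dL by (simp add: Lag_def)
  ultimately show ?thesis using that dL(2) LD by metis
qed

lemma complex_subspace_real_subspace: "vec.subspace S \<Longrightarrow> subspace S" for S :: "(complex ^ 'm) set"
  unfolding subspace_def vec.subspace_def by (metis of_real_vector_scalar)

text \<open>Modulo \<open>L \<inter> Dirichlet\<close>, which does not contribute to the form, the boundary values of
  the function determine the vector; an injective linear map on a finite-dimensional space
  is bounded below.\<close>

lemma Lag_bdry_form_bound:
  fixes L :: "(complex ^ (('n::finite + 'n) + ('n + 'n))) set"
  assumes L: "L \<in> Lag"
  shows "\<exists>C\<ge>0. \<forall>w\<in>L. Re (bdry_form w w) \<le> C * ((norm (vsnd (vfst w)))\<^sup>2 + (norm (vsnd (vsnd w)))\<^sup>2)"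
proof -
  have sL: "vec.subspace L" and iL: "\<And>u v. u \<in> L \<Longrightarrow> v \<in> L \<Longrightarrow> Omega u v = 0"
    using L by (auto simp: Lag_def)
  have sLD: "vec.subspace (L \<inter> Dirichlet)"
    using sL Dirichlet_Lag by (intro vec.subspace_inter) (auto simp: Lag_def)
  define S where "S = L \<inter> Dirichlet"
  have rS: "subspace S" and rL: "subspace L"
    using complex_subspace_real_subspace sL sLD S_def by auto
  define U where "U = {w \<in> L. \<forall>s\<in>S. orthogonal w s}"
  have rU: "subspace U"
    using rL unfolding U_def subspace_def by (auto simp: orthogonal_def inner_add_left)
  define \<xi> :: "complex ^ (('n + 'n) + ('n + 'n)) \<Rightarrow> (complex ^ 'n) \<times> (complex ^ 'n)"
    where "\<xi> w = (vsnd (vfst w), vsnd (vsnd w))" for w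
  have lin: "bounded_linear \<xi>"
    by (rule linear_conv_bounded_linear[THEN iffD1], rule linearI) (simp_all add: \<xi>_def vfst_vsnd_linear)
  have inj: "\<forall>w\<in>U. \<xi> w = 0 \<longrightarrow> w = 0"
  proof (intro ballI impI)
    fix w assume w: "w \<in> U" "\<xi> w = 0"
    then have "w \<in> S" by (auto simp: U_def S_def \<xi>_def Dirichlet_def zero_prod_def)
    then have "orthogonal w w" using w by (auto simp: U_def)
    then show "w = 0" by (simp add: orthogonal_def)
  qed
  obtain e where e: "e > 0" "\<forall>w\<in>U. e * norm w \<le> norm (\<xi> w)"
    using injective_imp_isometric[OF closed_subspace[OF rU] rU lin inj] by blast
  show ?thesis
  \<comment> \<open>e is the lower bound of \<xi> on the complement U of S, and the form is at most
    2 |u|^2 there, one |u|^2 for each end point.\<close>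
  proof (intro exI[of _ "2 / e\<^sup>2"] conjI ballI)
    fix w assume w: "w \<in> L"
    obtain d u where du: "d \<in> span S" "\<And>s. s \<in> span S \<Longrightarrow> orthogonal u s" "w = d + u"
      using orthogonal_subspace_decomp_exists[of S w] by metis
    have dS: "d \<in> S" using du(1) span_minimal[OF order_refl rS] by blast
    have uL: "u \<in> L" using du(3) dS w rL S_def subspace_diff[OF rL, of w d] by auto
    then have uU: "u \<in> U" using du(2) by (auto simp: U_def span_base)
    have dz: "vsnd (vfst d) = 0" "vsnd (vsnd d) = 0" using dS by (auto simp: S_def Dirichlet_def)
    have xi: "\<xi> w = \<xi> u" using dz by (simp add: \<xi>_def du(3) vfst_vsnd_linear)
    have z: "bdry_form v d = 0" for v using dz by (simp add: bdry_form_def herm_simps)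
    \<comment> \<open>The x-part of d vanishes, so d drops out as second argument of the form; as
      first argument it is removed by the isotropy of L.\<close>
    have "Omega d u = 0" using iL dS uL S_def by blast
    then have "bdry_form d u = 0" by (simp add: Omega_bdry_form z)
    then have b: "bdry_form w w = bdry_form u u" by (simp add: du(3) bdry_form_simps z)
    have comp: "norm (vfst (vfst u)) \<le> norm u" "norm (vsnd (vfst u)) \<le> norm u"
      "norm (vfst (vsnd u)) \<le> norm u" "norm (vsnd (vsnd u)) \<le> norm u"
      by (rule order_trans[OF norm_part_le(1) norm_part_le(1)]
          order_trans[OF norm_part_le(2) norm_part_le(1)]
          order_trans[OF norm_part_le(1) norm_part_le(2)]
          order_trans[OF norm_part_le(2) norm_part_le(2)])+
    have "Re (bdry_form u u) \<le> norm u * norm u + norm u * norm u"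
    proof -
      have "Re (bdry_form u u) = vfst (vsnd u) \<bullet> vsnd (vsnd u) - vfst (vfst u) \<bullet> vsnd (vfst u)"
        by (simp add: bdry_form_def Re_herm)
      moreover have "vfst (vsnd u) \<bullet> vsnd (vsnd u) \<le> norm u * norm u"
        by (rule order_trans[OF norm_cauchy_schwarz mult_mono]) (use comp in auto)
      moreover have "- (vfst (vfst u) \<bullet> vsnd (vfst u)) \<le> norm u * norm u"
        using Cauchy_Schwarz_ineq2[of "vfst (vfst u)" "vsnd (vfst u)"]
          mult_mono[OF comp(1,2)] by auto
      ultimately show ?thesis by linarith
    qed
    also have "\<dots> = 2 * (norm u)\<^sup>2" by (simp add: power2_eq_square)
    also have "\<dots> \<le> 2 * ((norm (\<xi> w))\<^sup>2 / e\<^sup>2)"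
    proof -
      have "(e * norm u)\<^sup>2 \<le> (norm (\<xi> w))\<^sup>2" unfolding xi using e uU by (intro power_mono) auto
      then show ?thesis using e(1) by (simp add: field_simps power_mult_distrib)
    qed
    also have "(norm (\<xi> w))\<^sup>2 = (norm (vsnd (vfst w)))\<^sup>2 + (norm (vsnd (vsnd w)))\<^sup>2"
      by (simp add: \<xi>_def norm_Pair)
    finally show "Re (bdry_form w w) \<le> 2 / e\<^sup>2 * ((norm (vsnd (vfst w)))\<^sup>2 + (norm (vsnd (vsnd w)))\<^sup>2)"
      by (simp add: b)
  qed simp
qed

section \<open>First-order system and monodromy\<close>

section \<open>Solutions of the Sturm--Liouville equation\<close>


interpretation cv: vector_space_pair "\<lambda>(c::complex) (x::real \<Rightarrow> complex ^ 'n) t. c *s x t"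
  "(*s) :: complex \<Rightarrow> complex ^ 'm \<Rightarrow> complex ^ 'm"
  by unfold_locales

lemma has_vector_derivative_imp_continuous_on:
  "(\<And>t. t \<in> S \<Longrightarrow> (f has_vector_derivative f' t) (at t within S)) \<Longrightarrow> continuous_on S f"
  unfolding continuous_on_eq_continuous_within by (blast intro: has_vector_derivative_continuous)

locale sturm_liouville =
  fixes T :: real and P Q R :: "real \<Rightarrow> real ^ 'n ^ 'n"
  assumes T_pos: "0 < T"
    and P_H1: "H1 T P" and Q_H1: "H1 T Q" and R_cont: "continuous_on {0..T} R"
    and P_sym: "\<And>t. t \<in> {0..T} \<Longrightarrow> transpose (P t) = P t"
    and R_sym: "\<And>t. t \<in> {0..T} \<Longrightarrow> transpose (R t) = R t"
    and P_pos: "\<And>t v. t \<in> {0..T} \<Longrightarrow> v \<noteq> 0 \<Longrightarrow> v \<bullet> (P t *v v) > 0"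
begin

abbreviation yq :: "(real \<Rightarrow> complex ^ 'n) \<Rightarrow> real \<Rightarrow> complex ^ 'n" where
  "yq \<equiv> quasi_deriv T P Q"

definition Pinv :: "real \<Rightarrow> real ^ 'n ^ 'n" where
  "Pinv t = cramer_inverse (P t)"

lemma H1_cont: "H1 T f \<Longrightarrow> continuous_on {0..T} f"
  unfolding H1_def using has_weak_deriv_ac_deriv ac_deriv_continuous by blast

lemma P_cont: "continuous_on {0..T} P" and Q_cont: "continuous_on {0..T} Q"
  using P_H1 Q_H1 by (simp_all add: H1_cont)

lemma Qt_cont: "continuous_on {0..T} (\<lambda>t. transpose (Q t))"
  unfolding transpose_def by (intro continuous_on_vec_lambda continuous_on_component Q_cont)

lemma det_P: "t \<in> {0..T} \<Longrightarrow> det (P t) \<noteq> 0"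
proof -
  assume t: "t \<in> {0..T}"
  have "v = 0" if "P t *v v = 0" for v
    using P_pos[OF t, of v] that by fastforce
  then have "\<exists>B. B ** P t = mat 1" unfolding matrix_left_invertible_ker by blast
  then show "det (P t) \<noteq> 0" by (simp add: invertible_left_inverse flip: invertible_det_nz)
qed

lemma Pinv_cont: "continuous_on {0..T} Pinv"
  unfolding Pinv_def by (rule continuous_on_cramer_inverse[OF P_cont det_P])

lemma Pinv_P: "t \<in> {0..T} \<Longrightarrow> mv (Pinv t) (mv (P t) v) = v"
  and P_Pinv: "t \<in> {0..T} \<Longrightarrow> mv (P t) (mv (Pinv t) v) = v"
  using cramer_inverse[OF det_P] by (simp_all add: mv_assoc Pinv_def mv_mat1)

lemma yq_eq: "yq x t = mv (P t) (xdot T x t) + mv (Q t) (x t)"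
  by (simp add: quasi_deriv_def mv_def)

lemma xdot_eq: "t \<in> {0..T} \<Longrightarrow> (x has_vector_derivative d) (at t within {0..T}) \<Longrightarrow> xdot T x t = d"
  unfolding xdot_def using T_pos by (rule vector_derivative_within_closed_interval)

lemma xdot_yq: "t \<in> {0..T} \<Longrightarrow> xdot T x t = mv (Pinv t) (yq x t - mv (Q t) (x t))"
  by (simp add: yq_eq Pinv_P)

definition rhs :: "real \<Rightarrow> (real \<Rightarrow> complex ^ 'n) \<Rightarrow> real \<Rightarrow> complex ^ 'n" where
  "rhs \<mu> x t = mv (transpose (Q t)) (xdot T x t) + mv (R t) (x t) - of_real \<mu> *s x t"

text \<open>The classical form of A x = \<mu> x + f, that is, y' = Q^T x' + R x - \<mu> x - f at
  every point. Vanishing outside the interval matches \<open>SL_dom\<close>.\<close>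

definition solves :: "real \<Rightarrow> (real \<Rightarrow> complex ^ 'n) \<Rightarrow> (real \<Rightarrow> complex ^ 'n) \<Rightarrow> bool" where
  "solves \<mu> f x \<longleftrightarrow> (\<forall>t. t \<notin> {0..T} \<longrightarrow> x t = 0) \<and>
     (\<forall>t\<in>{0..T}. (x has_vector_derivative xdot T x t) (at t within {0..T})) \<and>
     (\<forall>t\<in>{0..T}. (yq x has_vector_derivative (rhs \<mu> x t - f t)) (at t within {0..T}))"

lemma solvesD:
  assumes "solves \<mu> f x"
  shows "t \<notin> {0..T} \<Longrightarrow> x t = 0"
    "t \<in> {0..T} \<Longrightarrow> (x has_vector_derivative xdot T x t) (at t within {0..T})"
    "t \<in> {0..T} \<Longrightarrow> (yq x has_vector_derivative (rhs \<mu> x t - f t)) (at t within {0..T})"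
  using assms by (auto simp: solves_def)

lemma solves_continuous:
  assumes "solves \<mu> f x"
  shows "continuous_on {0..T} x" "continuous_on {0..T} (yq x)" "continuous_on {0..T} (xdot T x)"
    "continuous_on {0..T} (rhs \<mu> x)"
proof -
  show x: "continuous_on {0..T} x" using solvesD(2)[OF assms] by (rule has_vector_derivative_imp_continuous_on)
  show y: "continuous_on {0..T} (yq x)" using solvesD(3)[OF assms] by (rule has_vector_derivative_imp_continuous_on)
  have "continuous_on {0..T} (\<lambda>t. mv (Pinv t) (yq x t - mv (Q t) (x t)))"
    by (intro mv.continuous_on continuous_on_diff Pinv_cont Q_cont x y)
  then show d: "continuous_on {0..T} (xdot T x)"
    by (rule continuous_on_eq) (simp add: xdot_yq)
  show "continuous_on {0..T} (rhs \<mu> x)"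
    unfolding rhs_def of_real_vector_scalar
    by (intro continuous_intros mv.continuous_on Qt_cont R_cont x d)
qed

text \<open>In the first-order system y is an unknown of its own, whereas \<open>yq x\<close> is
  computed from x; inverting P identifies the two.\<close>

lemma solvesI:
  fixes x y :: "real \<Rightarrow> complex ^ 'n"
  assumes x: "\<And>t. t \<in> {0..T} \<Longrightarrow>
      (x has_vector_derivative mv (Pinv t) (y t - mv (Q t) (x t))) (at t within {0..T})"
    and y: "\<And>t. t \<in> {0..T} \<Longrightarrow> (y has_vector_derivative
      (mv (transpose (Q t)) (mv (Pinv t) (y t - mv (Q t) (x t))) + mv (R t) (x t) - of_real \<mu> *s x t - f t))
      (at t within {0..T})"
    and zero: "\<And>t. t \<notin> {0..T} \<Longrightarrow> x t = 0"
  shows "solves \<mu> f x" "\<And>t. t \<in> {0..T} \<Longrightarrow> yq x t = y t"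
proof -
  have d: "xdot T x t = mv (Pinv t) (y t - mv (Q t) (x t))" if "t \<in> {0..T}" for t
    by (rule xdot_eq[OF that x[OF that]])
  show q: "yq x t = y t" if "t \<in> {0..T}" for t
    unfolding yq_eq d[OF that] P_Pinv[OF that] by simp
  show "solves \<mu> f x"
    unfolding solves_def
  proof (intro conjI allI ballI impI)
    show "t \<notin> {0..T} \<Longrightarrow> x t = 0" for t by (rule zero)
    fix t assume t: "t \<in> {0..T}"
    show "(x has_vector_derivative xdot T x t) (at t within {0..T})" unfolding d[OF t] by (rule x[OF t])
    show "(yq x has_vector_derivative (rhs \<mu> x t - f t)) (at t within {0..T})"
      unfolding rhs_def d[OF t] by (rule has_vector_derivative_transform[OF t q y[OF t]])
  qed
qed

text \<open>The homogeneous system for (y, x), with x' eliminated as P^-1 (y - Q x). Its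
  coefficients are continuous, and no derivative of P or Q occurs.\<close>

definition sys :: "real \<Rightarrow> real \<Rightarrow> (complex ^ 'n) \<times> (complex ^ 'n) \<Rightarrow> (complex ^ 'n) \<times> (complex ^ 'n)" where
  "sys \<mu> t u =
    (mv (transpose (Q t)) (mv (Pinv t) (fst u - mv (Q t) (snd u))) + mv (R t) (snd u) - of_real \<mu> *s snd u,
     mv (Pinv t) (fst u - mv (Q t) (snd u)))"

lemma sys_diff: "sys \<mu> t u - sys \<mu> t v = sys \<mu> t (u - v)"
  by (simp add: sys_def of_real_vector_scalar mv.diff_right scaleR_right_diff_distrib)

lemma sys_bound: "\<exists>L>0. \<forall>t\<in>{0..T}. \<forall>u. norm (sys \<mu> t u) \<le> L * norm u"
proof -
  obtain K where K: "0 < K" "\<And>(C :: real ^ 'n ^ 'n) v. norm (mv C v) \<le> norm C * norm v * K"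
    using mv.pos_bounded by blast
  have mvb: "\<exists>b\<ge>0. \<forall>t\<in>{0..T}. \<forall>v. norm (mv (C t) v) \<le> b * norm v"
    if c: "continuous_on {0..T} C" for C :: "real \<Rightarrow> real ^ 'n ^ 'n"
  proof -
    obtain b where b: "\<forall>t\<in>{0..T}. norm (C t) \<le> b"
      using continuous_bounded_image[OF c] unfolding bounded_iff by blast
    have "norm (C 0) \<le> b" using b T_pos by simp
    then have b0: "0 \<le> b" using norm_ge_zero order_trans by blast
    have "norm (mv (C t) v) \<le> (b * K) * norm v" if t: "t \<in> {0..T}" for t v
    proof -
      have "norm (mv (C t) v) \<le> norm (C t) * norm v * K" by (rule K(2))
      also have "\<dots> \<le> b * norm v * K" using b t K(1) by (intro mult_right_mono) auto
      finally show ?thesis by (simp add: mult_ac)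
    qed
    then show ?thesis using b0 K(1) by (intro exI[of _ "b * K"]) auto
  qed
  obtain p where p: "0 \<le> p" "\<forall>t\<in>{0..T}. \<forall>v. norm (mv (Pinv t) v) \<le> p * norm v" using mvb[OF Pinv_cont] by blast
  obtain q where q: "0 \<le> q" "\<forall>t\<in>{0..T}. \<forall>v. norm (mv (Q t) v) \<le> q * norm v" using mvb[OF Q_cont] by blast
  obtain q' where q': "0 \<le> q'" "\<forall>t\<in>{0..T}. \<forall>v. norm (mv (transpose (Q t)) v) \<le> q' * norm v" using mvb[OF Qt_cont] by blast
  obtain r where r: "0 \<le> r" "\<forall>t\<in>{0..T}. \<forall>v. norm (mv (R t) v) \<le> r * norm v" using mvb[OF R_cont] by blast
  define a where "a = p * (1 + q)"
  have a0: "0 \<le> a" using p q by (simp add: a_def)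
  define L where "L = q' * a + r + \<bar>\<mu>\<bar> + a + 1"
  have "norm (sys \<mu> t u) \<le> L * norm u" if t: "t \<in> {0..T}" for t u
  proof -
    define g where "g = mv (Pinv t) (fst u - mv (Q t) (snd u))"
    have fs: "norm (fst u) \<le> norm u" "norm (snd u) \<le> norm u" 
      using norm_fst_le[of "fst u" "snd u"] norm_snd_le[of "snd u" "fst u"] by simp_all
    have "norm (mv (Q t) (snd u)) \<le> q * norm (snd u)" using q t by blast
    also have "\<dots> \<le> q * norm u" using fs q(1) by (intro mult_left_mono) auto
    finally have "norm (fst u - mv (Q t) (snd u)) \<le> norm u + q * norm u"
      using fs(1) norm_triangle_ineq4[of "fst u" "mv (Q t) (snd u)"] by linarith
    then have "p * norm (fst u - mv (Q t) (snd u)) \<le> p * (norm u + q * norm u)" using p(1) by (rule mult_left_mono)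
    moreover have "norm g \<le> p * norm (fst u - mv (Q t) (snd u))" unfolding g_def using p(2) t by blast
    ultimately have g: "norm g \<le> a * norm u" by (simp add: a_def algebra_simps)
    have "norm (mv (transpose (Q t)) g) \<le> q' * norm g" using q' t by blast
    also have "\<dots> \<le> q' * (a * norm u)" using g q'(1) by (rule mult_left_mono)
    finally have n1: "norm (mv (transpose (Q t)) g) \<le> q' * a * norm u" by (simp add: mult_ac)
    have "norm (mv (R t) (snd u)) \<le> r * norm (snd u)" using r t by blast
    also have "\<dots> \<le> r * norm u" using fs r(1) by (intro mult_left_mono) auto
    finally have n2: "norm (mv (R t) (snd u)) \<le> r * norm u" .
    have n3: "norm (\<mu> *\<^sub>R snd u) \<le> \<bar>\<mu>\<bar> * norm u" using fs by (simp add: mult_left_mono)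
    have "norm (sys \<mu> t u) \<le> norm (mv (transpose (Q t)) g + mv (R t) (snd u) - \<mu> *\<^sub>R snd u) + norm g"
      unfolding sys_def g_def of_real_vector_scalar by (rule norm_Pair_le)
    also have "\<dots> \<le> (q' * a * norm u + r * norm u + \<bar>\<mu>\<bar> * norm u) + a * norm u"
      using norm_triangle_ineq4[of "mv (transpose (Q t)) g + mv (R t) (snd u)" "\<mu> *\<^sub>R snd u"]
        norm_triangle_ineq[of "mv (transpose (Q t)) g" "mv (R t) (snd u)"] n1 n2 n3 g by linarith
    also have "\<dots> \<le> L * norm u" by (simp add: L_def algebra_simps)
    finally show ?thesis .
  qed
  moreover have "L > 0" using a0 q'(1) r(1) by (simp add: L_def add_nonneg_pos)
  ultimately show ?thesis by blast
qed

lemma solves_exists: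
  assumes f: "continuous_on {0..T} f"
  shows "\<exists>x. solves \<mu> f x \<and> phase T P Q x 0 = vjoin y0 x0"
proof -
  obtain L where L: "L > 0" "\<And>t u. t \<in> {0..T} \<Longrightarrow> norm (sys \<mu> t u) \<le> L * norm u"
    using sys_bound by blast
  have "\<exists>z. z 0 = (y0, x0) \<and>
      (\<forall>t\<in>{0..T}. (z has_vector_derivative (sys \<mu> t (z t) - (f t, 0))) (at t within {0..T}))"
  proof (rule lipschitz_ode_solution[OF T_pos _ L(1)])
    show "continuous_on {0..T} (\<lambda>t. sys \<mu> t (z t) - (f t, 0))" if "continuous_on {0..T} z" for z
      unfolding sys_def of_real_vector_scalar
      by (intro continuous_intros mv.continuous_on Qt_cont Q_cont R_cont Pinv_cont f that)
    show "norm (sys \<mu> t z - (f t, 0) - (sys \<mu> t w - (f t, 0))) \<le> L * norm (z - w)" if "t \<in> {0..T}" for t z w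
      using L(2)[OF that, of "z - w"] by (simp add: sys_diff[symmetric])
  qed
  then obtain z where z: "z 0 = (y0, x0)"
    "\<And>t. t \<in> {0..T} \<Longrightarrow> (z has_vector_derivative (sys \<mu> t (z t) - (f t, 0))) (at t within {0..T})" by blast
  define x where "x t = (if t \<in> {0..T} then snd (z t) else 0)" for t
  define y where "y t = fst (z t)" for t
  have dx: "(x has_vector_derivative mv (Pinv t) (y t - mv (Q t) (x t))) (at t within {0..T})" if t: "t \<in> {0..T}" for t
  proof -
    have "((\<lambda>t. snd (z t)) has_vector_derivative snd (sys \<mu> t (z t) - (f t, 0))) (at t within {0..T})"
      by (rule bounded_linear.has_vector_derivative[OF bounded_linear_snd z(2)[OF t]])
    then have "((\<lambda>t. snd (z t)) has_vector_derivative mv (Pinv t) (y t - mv (Q t) (x t))) (at t within {0..T})"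
      using t by (simp add: sys_def x_def y_def)
    then show ?thesis by (rule has_vector_derivative_transform[OF t, rotated]) (simp add: x_def)
  qed
  have dy: "(y has_vector_derivative
      (mv (transpose (Q t)) (mv (Pinv t) (y t - mv (Q t) (x t))) + mv (R t) (x t) - of_real \<mu> *s x t - f t))
      (at t within {0..T})" if t: "t \<in> {0..T}" for t
  proof -
    have "((\<lambda>t. fst (z t)) has_vector_derivative fst (sys \<mu> t (z t) - (f t, 0))) (at t within {0..T})"
      by (rule bounded_linear.has_vector_derivative[OF bounded_linear_fst z(2)[OF t]])
    then show ?thesis unfolding y_def[abs_def] using t by (simp add: sys_def x_def)
  qed
  have zero: "x t = 0" if "t \<notin> {0..T}" for t using that by (auto simp: x_def)
  have "solves \<mu> f x" and "\<And>t. t \<in> {0..T} \<Longrightarrow> yq x t = y t"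
    using solvesI[OF dx dy zero] by blast+
  moreover have "0 \<in> {0..T}" using T_pos by simp
  ultimately show ?thesis using z(1) by (intro exI[of _ x]) (simp add: phase_def x_def y_def)
qed

lemma phase_eq: "phase T P Q x t = vjoin (yq x t) (x t)"
  by (simp add: phase_def)

lemma solves_unique:
  assumes x: "solves \<mu> (\<lambda>_. 0) x" and z: "phase T P Q x 0 = 0"
  shows "x = 0"
proof -
  obtain L where L: "L > 0" "\<And>t u. t \<in> {0..T} \<Longrightarrow> norm (sys \<mu> t u) \<le> L * norm u"
    using sys_bound by blast
  define w where "w t = (yq x t, x t)" for t
  have dw: "(w has_vector_derivative sys \<mu> t (w t)) (at t within {0..T})" if t: "t \<in> {0..T}" for t
  proof -
    have "sys \<mu> t (w t) = (rhs \<mu> x t - 0, xdot T x t)"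
      by (simp add: sys_def w_def rhs_def xdot_yq[OF t])
    then show ?thesis
      unfolding w_def[abs_def] using has_vector_derivative_Pair[OF solvesD(3)[OF x t] solvesD(2)[OF x t]] by simp
  qed
  have cw: "continuous_on {0..T} w" using dw by (rule has_vector_derivative_imp_continuous_on)
  have csys: "continuous_on {0..T} (\<lambda>t. sys \<mu> t (w t))"
    unfolding sys_def of_real_vector_scalar
    by (intro continuous_intros mv.continuous_on Qt_cont Q_cont R_cont Pinv_cont cw)
  have cLw: "continuous_on {0..T} (\<lambda>r. L * norm (w r))" by (intro continuous_intros cw)
  have w0: "w t = 0" if t: "t \<in> {0..T}" for t
  proof (rule gronwall_zero[of "\<lambda>_. L" T w, OF _ _ cw _ _ _ t])
    show "(\<lambda>_. L) integrable_on {0..T}" by (intro integrable_continuous_interval continuous_on_const)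
    show "0 \<le> L" using L by simp
    have "yq x 0 = 0" "x 0 = 0" using arg_cong[OF z, of vfst] arg_cong[OF z, of vsnd]
      by (simp_all add: phase_eq vfst_vsnd_linear)
    then show "w 0 = 0" by (simp add: w_def zero_prod_def)
    show "(\<lambda>r. L * norm (w r)) integrable_on {0..T}" by (rule integrable_continuous_interval[OF cLw])
    fix s t assume st: "0 \<le> s" "s \<le> t" "t \<le> T"
    have i: "((\<lambda>t. sys \<mu> t (w t)) has_integral (w t - w s)) {s..t}"
      by (rule fundamental_theorem_of_calculus[OF st(2)])
        (rule has_vector_derivative_within_subset[OF dw]; use st in auto)
    have "norm (integral {s..t} (\<lambda>t. sys \<mu> t (w t))) \<le> integral {s..t} (\<lambda>r. L * norm (w r))"
    proof (rule integral_norm_bound_integral)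
      show "(\<lambda>t. sys \<mu> t (w t)) integrable_on {s..t}" using i by blast
      show "(\<lambda>r. L * norm (w r)) integrable_on {s..t}"
        using st by (intro integrable_continuous_interval continuous_on_subset[OF cLw]) auto
    qed (use L(2) st in auto)
    then show "norm (w t - w s) \<le> integral {s..t} (\<lambda>r. L * norm (w r))"
      using integral_unique[OF i] by simp
  qed
  have "x t = 0" for t
    using w0[of t] solvesD(1)[OF x, of t] by (cases "t \<in> {0..T}") (auto simp: w_def zero_prod_def)
  then show ?thesis by (simp add: fun_eq_iff zero_fun_def)
qed

definition bd :: "(real \<Rightarrow> complex ^ 'n) \<Rightarrow> complex ^ (('n + 'n) + ('n + 'n))" where
  "bd x = vjoin (phase T P Q x 0) (phase T P Q x T)"

text \<open>\<open>xdot\<close> is an arbitrary value where x has no derivative, so linearity of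
  \<open>xdot\<close>, \<open>yq\<close> and \<open>bd\<close> is claimed on solutions. The single
  combination x + c u yields sums, differences and multiples.\<close>

lemma solves_combine:
  assumes x: "solves \<mu> f x" and u: "solves \<mu> g u"
  shows "solves \<mu> (\<lambda>t. f t + c *s g t) (\<lambda>t. x t + c *s u t)"
    and "t \<in> {0..T} \<Longrightarrow> xdot T (\<lambda>t. x t + c *s u t) t = xdot T x t + c *s xdot T u t"
    and "t \<in> {0..T} \<Longrightarrow> yq (\<lambda>t. x t + c *s u t) t = yq x t + c *s yq u t"
    and "bd (\<lambda>t. x t + c *s u t) = bd x + c *s bd u"
proof -
  let ?z = "\<lambda>t. x t + c *s u t"
  have dz: "(?z has_vector_derivative (xdot T x t + c *s xdot T u t)) (at t within {0..T})" if t: "t \<in> {0..T}" for t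
    by (intro has_vector_derivative_add solvesD(2)[OF x t]
        bounded_linear.has_vector_derivative[OF vector_scalar_bounded_linear] solvesD(2)[OF u t])
  show xz: "xdot T ?z t = xdot T x t + c *s xdot T u t" if t: "t \<in> {0..T}" for t
    by (rule xdot_eq[OF t dz[OF t]])
  show yz: "yq ?z t = yq x t + c *s yq u t" if t: "t \<in> {0..T}" for t
    unfolding yq_eq xz[OF t] by (simp add: mv.add_right mv_scale vec.scale_right_distrib)
  have rz: "rhs \<mu> ?z t = rhs \<mu> x t + c *s rhs \<mu> u t" if t: "t \<in> {0..T}" for t
    unfolding rhs_def xz[OF t]
    by (simp add: mv.add_right mv_scale vec.scale_right_distrib vec.scale_right_diff_distrib algebra_simps)
  show "solves \<mu> (\<lambda>t. f t + c *s g t) ?z"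
    unfolding solves_def
  proof (intro conjI allI ballI impI)
    show "x t + c *s u t = 0" if "t \<notin> {0..T}" for t using solvesD(1)[OF x that] solvesD(1)[OF u that] by simp
    fix t assume t: "t \<in> {0..T}"
    show "(?z has_vector_derivative xdot T ?z t) (at t within {0..T})" unfolding xz[OF t] by (rule dz[OF t])
    have "((\<lambda>t. yq x t + c *s yq u t) has_vector_derivative (rhs \<mu> x t - f t + c *s (rhs \<mu> u t - g t))) (at t within {0..T})"
      by (intro has_vector_derivative_add solvesD(3)[OF x t]
        bounded_linear.has_vector_derivative[OF vector_scalar_bounded_linear] solvesD(3)[OF u t])
    then have D: "((\<lambda>t. yq x t + c *s yq u t) has_vector_derivative (rhs \<mu> ?z t - (f t + c *s g t))) (at t within {0..T})"
      unfolding rz[OF t] by (simp add: vec.scale_right_diff_distrib algebra_simps)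
    have "yq ?z s = yq x s + c *s yq u s" if "s \<in> {0..T}" for s by (rule yz[OF that])
    then show "(yq ?z has_vector_derivative (rhs \<mu> ?z t - (f t + c *s g t))) (at t within {0..T})"
      by (rule has_vector_derivative_transform[OF t _ D])
  qed
  show "bd ?z = bd x + c *s bd u"
    using T_pos by (simp add: bd_def phase_eq vjoin_linear yz)
qed

lemma solves_zero: "solves \<mu> (\<lambda>_. 0) 0"
proof -
  have "solves \<mu> (\<lambda>_. 0) (\<lambda>_. 0)"
    by (rule solvesI(1)[where y = "\<lambda>_. 0"]) (simp_all add: mv.zero_right)
  then show ?thesis by (simp add: zero_fun_def)
qed

lemma bd_zero: "bd 0 = 0"
  using solves_combine(4)[OF solves_zero[of 0] solves_zero[of 0], of "- 1"]
  by (simp add: zero_fun_def)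

lemma solves_scale: "solves \<mu> f x \<Longrightarrow> solves \<mu> (\<lambda>t. c *s f t) (\<lambda>t. c *s x t)"
  "solves \<mu> f x \<Longrightarrow> bd (\<lambda>t. c *s x t) = c *s bd x"
  using solves_combine(1)[OF solves_zero, of \<mu> f x c] solves_combine(4)[OF solves_zero, of \<mu> f x c]
    bd_zero
  by (simp_all add: zero_fun_def)

lemma solves_add: "solves \<mu> f x \<Longrightarrow> solves \<mu> g u \<Longrightarrow> solves \<mu> (\<lambda>t. f t + g t) (x + u)"
  "solves \<mu> f x \<Longrightarrow> solves \<mu> g u \<Longrightarrow> bd (x + u) = bd x + bd u"
  using solves_combine(1)[of \<mu> f x g u 1] solves_combine(4)[of \<mu> f x g u 1]
  by (simp_all add: plus_fun_def)

lemma solves_minus: "solves \<mu> f x \<Longrightarrow> solves \<mu> g u \<Longrightarrow> solves \<mu> (\<lambda>t. f t - g t) (x - u)"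
  "solves \<mu> f x \<Longrightarrow> solves \<mu> g u \<Longrightarrow> bd (x - u) = bd x - bd u"
  using solves_combine(1)[of \<mu> f x g u "-1"] solves_combine(4)[of \<mu> f x g u "-1"]
  by (simp_all add: fun_diff_def)

definition Sol :: "real \<Rightarrow> (real \<Rightarrow> complex ^ 'n) set" where
  "Sol \<mu> = {x. solves \<mu> (\<lambda>_. 0) x}"

text \<open>The graph of the monodromy map from z(0) to z(T). It involves no boundary condition; an
  eigenvalue of L is a \<mu> at which it meets L nontrivially.\<close>

definition Gr :: "real \<Rightarrow> (complex ^ (('n + 'n) + ('n + 'n))) set" where
  "Gr \<mu> = bd ` Sol \<mu>"

lemma Sol_closed: "0 \<in> Sol \<mu>" "x \<in> Sol \<mu> \<Longrightarrow> u \<in> Sol \<mu> \<Longrightarrow> x + u \<in> Sol \<mu>"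
  "x \<in> Sol \<mu> \<Longrightarrow> (\<lambda>t. c *s x t) \<in> Sol \<mu>"
  using solves_zero solves_add(1)[of \<mu> "\<lambda>_. 0" x "\<lambda>_. 0" u] solves_scale(1)[of \<mu> "\<lambda>_. 0" x c]
  by (simp_all add: Sol_def)

lemma bd_Sol: "x \<in> Sol \<mu> \<Longrightarrow> u \<in> Sol \<mu> \<Longrightarrow> bd (x + u) = bd x + bd u"
  "x \<in> Sol \<mu> \<Longrightarrow> bd (\<lambda>t. c *s x t) = c *s bd x"
  using solves_add(2) solves_scale(2) by (auto simp: Sol_def)

lemma bd_eq_0:
  assumes x: "x \<in> Sol \<mu>" and b: "bd x = 0"
  shows "x = 0"
proof (rule solves_unique)
  show "solves \<mu> (\<lambda>_. 0) x" using x by (simp add: Sol_def)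
  show "phase T P Q x 0 = 0" using arg_cong[OF b, of vfst] by (simp add: bd_def[of x] vfst_vsnd_linear)
qed

lemma subspace_Sol_bd:
  assumes "vec.subspace L"
  shows "cfun.subspace {x \<in> Sol \<mu>. bd x \<in> L}"
proof -
  show ?thesis
    unfolding cfun.subspace_def using assms bd_zero
    by (auto simp: Sol_closed bd_Sol vec.subspace_0 vec.subspace_add vec.subspace_scale)
qed

lemma dim_Sol_bd:
  assumes "vec.subspace L"
  shows "cfun.dim {x \<in> Sol \<mu>. bd x \<in> L} = vec.dim (Gr \<mu> \<inter> L)"
proof -
  have "bd ` {x \<in> Sol \<mu>. bd x \<in> L} = Gr \<mu> \<inter> L" by (auto simp: Gr_def)
  moreover have "vec.dim (bd ` {x \<in> Sol \<mu>. bd x \<in> L}) = cfun.dim {x \<in> Sol \<mu>. bd x \<in> L}"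
    by (rule cv.dim_image_on[OF subspace_Sol_bd[OF assms]]) (auto simp: bd_Sol dest: bd_eq_0)
  ultimately show ?thesis by simp
qed

lemma finite_basis_Sol: "\<exists>B. finite B \<and> Sol \<mu> \<subseteq> cfun.span B"
proof -
  obtain B where B: "B \<subseteq> Sol \<mu>" "cfun.independent B" "Sol \<mu> \<subseteq> cfun.span B"
    by (rule cfun.basis_exists)
  have sS: "cfun.subspace (Sol \<mu>)" using subspace_Sol_bd[OF vec.subspace_UNIV, of \<mu>] by simp
  have "vec.independent (bd ` B)" "inj_on bd B"
    using cv.independent_image_on[OF sS B(1,2), of bd] by (auto simp: bd_Sol dest: bd_eq_0)
  then have "finite B" using vec.finiteI_independent finite_imageD by blast
  then show ?thesis using B by blast
qed

lemma subspace_Gr: "vec.subspace (Gr \<mu>)"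
  unfolding vec.subspace_def
proof (intro conjI ballI allI)
  show "0 \<in> Gr \<mu>"
    using bd_zero Sol_closed(1)[of \<mu>] unfolding Gr_def by (intro image_eqI[of _ _ 0]) auto
  show "x + y \<in> Gr \<mu>" if "x \<in> Gr \<mu>" "y \<in> Gr \<mu>" for x y
    using that Sol_closed(2) bd_Sol(1) unfolding Gr_def by (smt (verit) image_iff)
  show "c *s x \<in> Gr \<mu>" if "x \<in> Gr \<mu>" for c x
    using that Sol_closed(3) bd_Sol(2) unfolding Gr_def by (smt (verit) image_iff)
qed

lemma dim_Gr: "vec.dim (Gr \<mu>) = 2 * CARD('n)"
proof -
  let ?ph = "\<lambda>x. phase T P Q x 0"
  have ph: "?ph x = vfst (bd x)" for x by (simp add: bd_def)
  have sS: "cfun.subspace (Sol \<mu>)" using subspace_Sol_bd[OF vec.subspace_UNIV, of \<mu>] by simp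
  have "?ph ` Sol \<mu> = UNIV"
  proof (intro equalityI subsetI UNIV_I)
    fix w :: "complex ^ ('n + 'n)"
    obtain x where "solves \<mu> (\<lambda>_. 0) x" "phase T P Q x 0 = vjoin (vfst w) (vsnd w)"
      using solves_exists[of "\<lambda>_. 0" \<mu> "vfst w" "vsnd w"] by auto
    then show "w \<in> ?ph ` Sol \<mu>" by (intro image_eqI[of _ _ x]) (auto simp: Sol_def)
  qed
  moreover have "vec.dim (?ph ` Sol \<mu>) = cfun.dim (Sol \<mu>)"
  proof (rule cv.dim_image_on[OF sS])
    show "?ph (x + u) = ?ph x + ?ph u" if "x \<in> Sol \<mu>" "u \<in> Sol \<mu>" for x u
      unfolding ph bd_Sol(1)[OF that] vfst_vsnd_linear ..
    show "?ph (\<lambda>t. c *s x t) = c *s ?ph x" if "x \<in> Sol \<mu>" for c x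
      unfolding ph bd_Sol(2)[OF that] vfst_vsnd_linear ..
    show "x = 0" if "x \<in> Sol \<mu>" "?ph x = 0" for x
      using that unfolding Sol_def by (blast intro: solves_unique)
  qed
  moreover have "vec.dim (Gr \<mu>) = cfun.dim (Sol \<mu>)"
    using dim_Sol_bd[OF vec.subspace_UNIV, of \<mu>] by simp
  moreover have "vec.dim (UNIV :: (complex ^ ('n + 'n)) set) = 2 * CARD('n)"
    by (simp add: vec.dim_UNIV card_cart_basis card_UNIV_sum)
  ultimately show ?thesis by simp
qed

text \<open>A homogeneous solution with x(0) = 0 is determined by y(0), which has n
  components.\<close>

lemma dim_Gr_Dirichlet: "vec.dim (Gr \<mu> \<inter> Dirichlet) \<le> CARD('n)"
proof -
  have sub: "vec.subspace (Gr \<mu> \<inter> Dirichlet)"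
    using subspace_Gr Dirichlet_Lag by (intro vec.subspace_inter) (auto simp: Lag_def)
  have ker: "w = 0" if w: "w \<in> Gr \<mu> \<inter> Dirichlet" "vfst (vfst w) = 0" for w
  proof -
    obtain x where x: "x \<in> Sol \<mu>" "w = bd x" using w Gr_def by auto
    have "vfst w = 0" by (intro vec_eqI_parts) (use w in \<open>auto simp: vfst_vsnd_linear Dirichlet_def\<close>)
    then have "x = 0" using x solves_unique by (simp add: bd_def Sol_def)
    then show ?thesis using x bd_zero by simp
  qed
  have "vec.dim ((\<lambda>w. vfst (vfst w)) ` (Gr \<mu> \<inter> Dirichlet)) = vec.dim (Gr \<mu> \<inter> Dirichlet)"
    by (rule vec.dim_image_on[OF sub]) (simp_all add: vfst_vsnd_linear ker)
  moreover have "vec.dim ((\<lambda>w. vfst (vfst w)) ` (Gr \<mu> \<inter> Dirichlet)) \<le> CARD('n)"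
    using vec.dim_subset[OF subset_UNIV, of "(\<lambda>w. vfst (vfst w)) ` (Gr \<mu> \<inter> Dirichlet)"]
    by (simp add: vec.dim_UNIV card_cart_basis)
  ultimately show ?thesis by simp
qed

text \<open>From weak to classical, y' is almost everywhere equal to a continuous function. In the
  other direction the issue is membership in H^2: P x' = y - Q x is in H^1, and dividing by P stays
  in H^1 by \<open>H1_solution_of_linear_system\<close>.\<close>

lemma eigenspace_eq: "eigenspace T P Q R L \<mu> = {x \<in> Sol \<mu>. bd x \<in> L}"
proof (intro equalityI subsetI)
  fix x assume "x \<in> eigenspace T P Q R L \<mu>"
  then have H2: "H2 T x" and z: "\<And>t. t \<notin> {0..T} \<Longrightarrow> x t = 0" and b: "bd x \<in> L"
    and maps: "SL_maps T P Q R x (\<lambda>t. of_real \<mu> *s x t)"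
    by (auto simp: eigenspace_def SL_dom_def bd_def)
  obtain g where g: "has_weak_deriv T x g" "H1 T g" using H2 by (auto simp: H2_def)
  have dx: "(x has_vector_derivative g t) (at t within {0..T})" if "t \<in> {0..T}" for t
    by (rule has_weak_deriv_continuous_imp_C1[OF g(1) H1_cont[OF g(2)] _ that]) simp
  have xd: "xdot T x t = g t" if "t \<in> {0..T}" for t by (rule xdot_eq[OF that dx[OF that]])
  have cx: "continuous_on {0..T} x" using dx by (rule has_vector_derivative_imp_continuous_on)
  have cd: "continuous_on {0..T} (xdot T x)"
    by (rule continuous_on_eq[OF H1_cont[OF g(2)]]) (simp add: xd)
  have cr: "continuous_on {0..T} (rhs \<mu> x)"
    unfolding rhs_def of_real_vector_scalar
    by (intro continuous_intros mv.continuous_on Qt_cont R_cont cx cd)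
  obtain g2 where g2: "has_weak_deriv T (yq x) g2"
    "AE t in lebesgue_on {0..T}. of_real \<mu> *s x t = - g2 t + cmat (transpose (Q t)) *v xdot T x t + cmat (R t) *v x t"
    using maps by (auto simp: SL_maps_def)
  have "AE t in lebesgue_on {0..T}. g2 t = rhs \<mu> x t"
    using g2(2) by (rule AE_mp) (auto simp: rhs_def mv_def)
  then have dy: "(yq x has_vector_derivative rhs \<mu> x t) (at t within {0..T})" if "t \<in> {0..T}" for t
    using has_weak_deriv_continuous_imp_C1[OF g2(1) cr _ that] by blast
  have "solves \<mu> (\<lambda>_. 0) x"
    unfolding solves_def using z dx dy by (auto simp: xd)
  then show "x \<in> {x \<in> Sol \<mu>. bd x \<in> L}" using b by (simp add: Sol_def)
next
  fix x assume "x \<in> {x \<in> Sol \<mu>. bd x \<in> L}"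
  then have x: "solves \<mu> (\<lambda>_. 0) x" and b: "bd x \<in> L" by (auto simp: Sol_def)
  note c = solves_continuous[OF x]
  have wx: "has_weak_deriv T x (xdot T x)" by (rule has_weak_deriv_C1[OF solvesD(2)[OF x] c(3)])
  have wy: "has_weak_deriv T (yq x) (rhs \<mu> x)"
    using has_weak_deriv_C1[of T "yq x" "rhs \<mu> x"] solvesD(3)[OF x] c(4) by simp
  obtain Q' where Q': "has_weak_deriv T Q Q'" using Q_H1 by (auto simp: H1_def)
  have "H1 T (\<lambda>t. yq x t - mv (Q t) (x t))"
    unfolding H1_def using has_weak_deriv_diff[OF wy has_weak_deriv_bilinear[OF mv_bilinear Q' wx]] by blast
  then have "H1 T (xdot T x)"
    by (rule H1_solution_of_linear_system[OF T_pos P_H1 _ c(3) det_P]) (simp_all add: yq_eq)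
  then have "H2 T x" using wx by (auto simp: H2_def)
  moreover have "SL_maps T P Q R x (\<lambda>t. of_real \<mu> *s x t)"
    unfolding SL_maps_def using wy by (intro exI[of _ "rhs \<mu> x"]) (simp add: rhs_def mv_def)
  ultimately show "x \<in> eigenspace T P Q R L \<mu>"
    using solvesD(1)[OF x] b by (simp add: eigenspace_def SL_dom_def bd_def)
qed

lemma multiplicity_eq:
  assumes "vec.subspace L"
  shows "multiplicity_at T P Q R L \<mu> = vec.dim (Gr \<mu> \<inter> L)"
  unfolding multiplicity_at_def eigenspace_eq by (rule dim_Sol_bd[OF assms])

end

section \<open>Green's formula and coercivity\<close>

section \<open>Energy form and resolvent\<close>


lemma has_vector_derivative_bilinear:
  assumes "bounded_bilinear h"
    and "(f has_vector_derivative f') (at x within S)" "(g has_vector_derivative g') (at x within S)"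
  shows "((\<lambda>x. h (f x) (g x)) has_vector_derivative (h (f x) g' + h f' (g x))) (at x within S)"
proof -
  interpret bounded_bilinear h by fact
  show ?thesis
    using FDERIV[of f "\<lambda>r. r *\<^sub>R f'" x S g "\<lambda>r. r *\<^sub>R g'"] assms(2,3)
    by (simp add: has_vector_derivative_def scaleR_right scaleR_left scaleR_add_right)
qed

context sturm_liouville
begin

text \<open>The carrier of the resolvents; values outside the interval are fixed to 0 so that
  \<open>ip\<close> is definite.\<close>

definition HC :: "(real \<Rightarrow> complex ^ 'n) set" where
  "HC = {f. continuous_on {0..T} f \<and> (\<forall>t. t \<notin> {0..T} \<longrightarrow> f t = 0)}"

definition ip :: "(real \<Rightarrow> complex ^ 'n) \<Rightarrow> (real \<Rightarrow> complex ^ 'n) \<Rightarrow> complex" where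
  "ip f g = integral {0..T} (\<lambda>t. herm (f t) (g t))"

lemma herm_integrable:
  "continuous_on {0..T} f \<Longrightarrow> continuous_on {0..T} g \<Longrightarrow> (\<lambda>t. herm (f t) (g t)) integrable_on {0..T}"
  by (intro integrable_continuous_interval herm.continuous_on)

lemma ip_self_real: "f \<in> HC \<Longrightarrow> ip f f = of_real (integral {0..T} (\<lambda>t. (norm (f t))\<^sup>2))"
proof -
  assume f: "f \<in> HC"
  have i: "(\<lambda>t. (norm (f t))\<^sup>2) integrable_on {0..T}"
    using f by (intro integrable_continuous_interval continuous_intros) (simp add: HC_def)
  have "integral {0..T} (\<lambda>t. complex_of_real ((norm (f t))\<^sup>2)) = of_real (integral {0..T} (\<lambda>t. (norm (f t))\<^sup>2))"
    using integral_linear[OF i, of complex_of_real] bounded_linear_of_real by (simp add: o_def)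
  then show ?thesis by (simp add: ip_def herm_self)
qed

lemma Re_ip: "f \<in> HC \<Longrightarrow> Re (ip f f) = integral {0..T} (\<lambda>t. (norm (f t))\<^sup>2)"
  by (simp add: ip_self_real)

lemma HC_subspace: "cfun.subspace HC"
  unfolding cfun.subspace_def HC_def of_real_vector_scalar
  by (auto simp: zero_fun_def plus_fun_def intro!: continuous_intros
      linear_continuous_on_compose[OF _ bounded_linear.linear[OF vector_scalar_bounded_linear]])

lemma HC_hermitian_form: "hermitian_form (\<lambda>(c::complex) x t. c *s x t) HC ip"
proof unfold_locales
  show "cfun.subspace HC" by (rule HC_subspace)
  show "ip (f + g) h = ip f h + ip g h" if "f \<in> HC" "g \<in> HC" "h \<in> HC" for f g h
    using that by (simp add: ip_def plus_fun_def herm_simps integral_add herm_integrable HC_def)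
  show "ip (\<lambda>t. c *s f t) h = c * ip f h" if "f \<in> HC" "h \<in> HC" for f h c
    using that by (simp add: ip_def herm_simps)
  show "ip g f = cnj (ip f g)" if "f \<in> HC" "g \<in> HC" for f g
    unfolding ip_def integral_cnj by (rule arg_cong[of _ _ "integral {0..T}"]) (simp add: herm_sym[of "f _"])
  show "0 \<le> Re (ip f f)" if "f \<in> HC" for f
    unfolding Re_ip[OF that] using that
    by (intro integral_nonneg integrable_continuous_interval continuous_intros) (auto simp: HC_def)
qed

lemma ip_positive: "f \<in> HC \<Longrightarrow> f \<noteq> 0 \<Longrightarrow> 0 < Re (ip f f)"
proof -
  assume f: "f \<in> HC" "f \<noteq> 0"
  have c: "continuous_on {0..T} (\<lambda>t. (norm (f t))\<^sup>2)"
    using f by (intro continuous_intros) (simp add: HC_def)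
  have "integral {0..T} (\<lambda>t. (norm (f t))\<^sup>2) \<noteq> 0"
  proof
    assume "integral {0..T} (\<lambda>t. (norm (f t))\<^sup>2) = 0"
    then have "\<forall>t\<in>{0..T}. (norm (f t))\<^sup>2 = 0" using integral_eq_0_iff[OF c T_pos] by simp
    then have "f t = 0" for t using f(1) by (cases "t \<in> {0..T}") (auto simp: HC_def)
    then show False using f(2) by (simp add: fun_eq_iff zero_fun_def)
  qed
  moreover have "0 \<le> integral {0..T} (\<lambda>t. (norm (f t))\<^sup>2)"
    using c by (intro integral_nonneg integrable_continuous_interval) auto
  ultimately show "0 < Re (ip f f)" using Re_ip[OF f(1)] by simp
qed

lemma solves_HC: "solves \<mu> f x \<Longrightarrow> x \<in> HC"
  using solves_continuous(1) solvesD(1) by (auto simp: HC_def)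

text \<open>The sesquilinear form of A - \<mu> without boundary terms. It is Hermitian because P and
  R are symmetric and the terms with Q and its transpose are exchanged.\<close>

definition energy :: "real \<Rightarrow> (real \<Rightarrow> complex ^ 'n) \<Rightarrow> (real \<Rightarrow> complex ^ 'n) \<Rightarrow> complex" where
  "energy \<mu> x u = integral {0..T} (\<lambda>t. herm (yq x t) (xdot T u t) + herm (rhs \<mu> x t) (u t))"

lemma energy_sym: "energy \<mu> u x = cnj (energy \<mu> x u)"
proof -
  have "herm (yq u t) (xdot T x t) + herm (rhs \<mu> u t) (x t) =
      cnj (herm (yq x t) (xdot T u t) + herm (rhs \<mu> x t) (u t))" if t: "t \<in> {0..T}" for t
  proof -
    let ?x = "xdot T x t" and ?u = "xdot T u t"
    have "herm (mv (P t) ?u) ?x = cnj (herm (mv (P t) ?x) ?u)"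
      unfolding herm_mv[of "P t" ?u] P_sym[OF t] by (rule herm_sym)
    moreover have "herm (mv (Q t) (u t)) ?x = cnj (herm (mv (transpose (Q t)) ?x) (u t))"
      unfolding herm_mv[of "Q t"] by (rule herm_sym)
    moreover have "herm (mv (transpose (Q t)) ?u) (x t) = cnj (herm (mv (Q t) (x t)) ?u)"
      unfolding herm_mv[of "transpose (Q t)"] transpose_transpose by (rule herm_sym)
    moreover have "herm (mv (R t) (u t)) (x t) = cnj (herm (mv (R t) (x t)) (u t))"
      unfolding herm_mv[of "R t" "u t"] R_sym[OF t] by (rule herm_sym)
    moreover have "herm (u t) (x t) = cnj (herm (x t) (u t))" by (rule herm_sym)
    ultimately show ?thesis by (simp add: yq_eq rhs_def herm_simps)
  qed
  then show ?thesis unfolding energy_def integral_cnj by (rule integral_cong)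
qed

text \<open>The derivative of <y, u> is integrated, with y the quasi-derivative of x. Only the
  equation of x is inserted, so u may belong to another parameter and another right-hand
  side.\<close>

lemma Green:
  assumes x: "solves \<mu> f x" and u: "solves \<nu> g u" and f: "continuous_on {0..T} f"
  shows "bdry_form (bd x) (bd u) = energy \<mu> x u - ip f u"
proof -
  note cx = solves_continuous[OF x] and cu = solves_continuous[OF u]
  have "((\<lambda>t. herm (yq x t) (xdot T u t) + herm (rhs \<mu> x t - f t) (u t)) has_integral
      (herm (yq x T) (u T) - herm (yq x 0) (u 0))) {0..T}"
    using T_pos
    by (intro fundamental_theorem_of_calculus
        has_vector_derivative_bilinear[OF herm_bilinear solvesD(3)[OF x] solvesD(2)[OF u]]) auto
  then have "integral {0..T} (\<lambda>t. (herm (yq x t) (xdot T u t) + herm (rhs \<mu> x t) (u t)) - herm (f t) (u t)) =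
      herm (yq x T) (u T) - herm (yq x 0) (u 0)"
    by (intro integral_unique) (simp add: herm_simps algebra_simps)
  moreover have "integral {0..T} (\<lambda>t. (herm (yq x t) (xdot T u t) + herm (rhs \<mu> x t) (u t)) - herm (f t) (u t)) =
      energy \<mu> x u - ip f u"
    unfolding energy_def ip_def
    by (intro integral_diff integrable_add herm_integrable cx cu f)
  ultimately show ?thesis by (simp add: bdry_form_def bd_def phase_eq)
qed

text \<open>Without right-hand sides Green's formula turns the boundary form into the Hermitian
  energy, whose antisymmetrization vanishes.\<close>

lemma Gr_Lag: "Gr \<mu> \<in> Lag"
proof -
  have "Omega v w = 0" if vw: "v \<in> Gr \<mu>" "w \<in> Gr \<mu>" for v w
  proof -
    obtain x u where x: "solves \<mu> (\<lambda>_. 0) x" "v = bd x" and u: "solves \<mu> (\<lambda>_. 0) u" "w = bd u"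
      using vw unfolding Gr_def Sol_def by blast
    have "ip (\<lambda>_. 0) z = 0" for z by (simp add: ip_def herm_simps)
    then have "bdry_form v w = energy \<mu> x u" "bdry_form w v = energy \<mu> u x"
      using Green[OF x(1) u(1)] Green[OF u(1) x(1)] x u by simp_all
    then show ?thesis by (simp add: Omega_bdry_form energy_sym[of \<mu> u x])
  qed
  then show ?thesis using subspace_Gr dim_Gr by (simp add: Lag_def)
qed

text \<open>Splitting a complex vector into real and imaginary parts leaves no cross terms in the
  real inner product, which gives pointwise positivity; compactness of the interval times the unit
  sphere makes it uniform.\<close>

lemma P_lower_bound: "\<exists>p>0. \<forall>t\<in>{0..T}. \<forall>v. p * (norm v)\<^sup>2 \<le> mv (P t) v \<bullet> v"
proof -
  define S where "S = {0..T} \<times> sphere (0 :: complex ^ 'n) 1"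
  have cP: "continuous_on S (\<lambda>z. P (fst z))"
    by (rule continuous_on_compose2[OF P_cont continuous_on_fst[OF continuous_on_id]]) (auto simp: S_def)
  have cont: "continuous_on S (\<lambda>z. mv (P (fst z)) (snd z) \<bullet> snd z)"
    by (intro continuous_intros mv.continuous_on cP)
  have comp: "compact S" unfolding S_def by (intro compact_Times compact_Icc compact_sphere)
  have pos: "0 < mv (P t) v \<bullet> v" if t: "t \<in> {0..T}" and v: "v \<noteq> 0" for t and v :: "complex ^ 'n"
  proof -
    define a where "a = (\<chi> i. Re (v $ i))"
    define b where "b = (\<chi> i. Im (v $ i))"
    have "mv (P t) v \<bullet> v = a \<bullet> (P t *v a) + b \<bullet> (P t *v b)"
      by (simp add: inner_vec_def inner_complex_def mv_nth matrix_vector_mult_def a_def b_def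
          sum.distrib sum_distrib_left sum_distrib_right algebra_simps)
    moreover have "a \<noteq> 0 \<or> b \<noteq> 0" using v by (auto simp: vec_eq_iff a_def b_def complex_eq_iff)
    moreover have "0 \<le> w \<bullet> (P t *v w)" for w using P_pos[OF t, of w] by (cases "w = 0") auto
    ultimately show ?thesis using P_pos[OF t, of a] P_pos[OF t, of b]
      by (metis add_nonneg_pos add_pos_nonneg)
  qed
  have "(SOME i. i \<in> Basis) \<in> sphere (0 :: complex ^ 'n) 1" by (simp add: norm_Basis[OF SOME_Basis])
  then have "S \<noteq> {}" using T_pos by (auto simp: S_def)
  then obtain z where z: "z \<in> S" "\<And>y. y \<in> S \<Longrightarrow> mv (P (fst z)) (snd z) \<bullet> snd z \<le> mv (P (fst y)) (snd y) \<bullet> snd y"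
    using continuous_attains_inf[OF comp _ cont] by blast
  define p where "p = mv (P (fst z)) (snd z) \<bullet> snd z"
  have "p > 0" unfolding p_def using z(1) by (intro pos) (auto simp: S_def)
  moreover have "p * (norm v)\<^sup>2 \<le> mv (P t) v \<bullet> v" if t: "t \<in> {0..T}" for t v
  proof (cases "v = 0")
    case True
    then show ?thesis by simp
  next
    case False
    define w where "w = (1 / norm v) *\<^sub>R v"
    have "(t, w) \<in> S" using t False by (simp add: S_def w_def)
    then have "p \<le> mv (P t) w \<bullet> w" using z(2)[of "(t, w)"] by (simp add: p_def)
    also have "\<dots> = (mv (P t) v \<bullet> v) / (norm v)\<^sup>2"
      by (simp add: w_def mv.scaleR_right power2_eq_square)
    finally show ?thesis using False by (simp add: field_simps)
  qed
  ultimately show ?thesis by blast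
qed

text \<open>The weight 2t/T - 1 is -1 at 0 and 1 at T, so integrating the derivative of its product
  with |x|^2 produces the sum of both end point terms.\<close>

lemma boundary_norm_identity:
  assumes x: "solves \<mu> f x"
  shows "(norm (x 0))\<^sup>2 + (norm (x T))\<^sup>2 =
    integral {0..T} (\<lambda>t. 2 / T * (norm (x t))\<^sup>2 + 2 * (2 * t / T - 1) * (x t \<bullet> xdot T x t))"
proof -
  have d: "((\<lambda>t. (2 * t / T - 1) * (x t \<bullet> x t)) has_vector_derivative
      (2 / T * (norm (x t))\<^sup>2 + 2 * (2 * t / T - 1) * (x t \<bullet> xdot T x t))) (at t within {0..T})"
    if t: "t \<in> {0..T}" for t
  proof -
    have "((\<lambda>t. x t \<bullet> x t) has_vector_derivative (x t \<bullet> xdot T x t + xdot T x t \<bullet> x t)) (at t within {0..T})"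
      by (rule has_vector_derivative_bilinear[OF bounded_bilinear_inner solvesD(2)[OF x t] solvesD(2)[OF x t]])
    moreover have "((\<lambda>t. 2 * t / T - 1) has_vector_derivative 2 / T) (at t within {0..T})"
      using T_pos by (auto intro!: derivative_eq_intros simp flip: has_real_derivative_iff_has_vector_derivative)
    ultimately have "((\<lambda>t. (2 * t / T - 1) * (x t \<bullet> x t)) has_vector_derivative
        ((2 * t / T - 1) * (x t \<bullet> xdot T x t + xdot T x t \<bullet> x t) + 2 / T * (x t \<bullet> x t))) (at t within {0..T})"
      by (intro has_vector_derivative_mult)
    then show ?thesis
      by (simp add: power2_norm_eq_inner inner_commute[of "xdot T x t"] algebra_simps)
  qed
  have "((\<lambda>t. 2 / T * (norm (x t))\<^sup>2 + 2 * (2 * t / T - 1) * (x t \<bullet> xdot T x t)) has_integral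
      ((2 * T / T - 1) * (x T \<bullet> x T) - (2 * 0 / T - 1) * (x 0 \<bullet> x 0))) {0..T}"
    using T_pos by (intro fundamental_theorem_of_calculus d) auto
  then show ?thesis using T_pos by (simp add: integral_unique power2_norm_eq_inner)
qed

text \<open>Beside the P-term everything, including the end point values by
  \<open>boundary_norm_identity\<close>, costs |x| |x'| or |x|^2. Half of the P-term is kept, the
  other half absorbs the mixed products, and -\<mu> |x|^2 pays for the rest.\<close>

lemma energy_coercive:
  "\<exists>p>0. \<forall>C\<ge>0. \<exists>\<mu>0. \<forall>\<mu>\<le>\<mu>0. \<forall>f x. solves \<mu> f x \<longrightarrow>
    C * ((norm (x 0))\<^sup>2 + (norm (x T))\<^sup>2) + p * integral {0..T} (\<lambda>t. (norm (xdot T x t))\<^sup>2)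
      + integral {0..T} (\<lambda>t. (norm (x t))\<^sup>2) \<le> Re (energy \<mu> x x)"
proof -
  obtain p0 where p0: "p0 > 0" "\<And>t v. t \<in> {0..T} \<Longrightarrow> p0 * (norm v)\<^sup>2 \<le> mv (P t) v \<bullet> v"
    using P_lower_bound by blast
  obtain K where K: "0 < K" "\<And>(A :: real ^ 'n ^ 'n) v. norm (mv A v) \<le> norm A * norm v * K"
    using mv.pos_bounded by blast
  obtain bQ where bQ: "\<forall>t\<in>{0..T}. norm (Q t) \<le> bQ" using continuous_bounded_image[OF Q_cont] unfolding bounded_iff by blast
  obtain bR where bR: "\<forall>t\<in>{0..T}. norm (R t) \<le> bR" using continuous_bounded_image[OF R_cont] unfolding bounded_iff by blast
  have bQ0: "0 \<le> bQ" "0 \<le> bR" using bQ bR T_pos norm_ge_zero[of "Q 0"] norm_ge_zero[of "R 0"] by (meson atLeastAtMost_iff less_imp_le order_refl order_trans)+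
  define q where "q = bQ * K"
  define r where "r = bR * K"
  have q: "norm (mv (Q t) v) \<le> q * norm v" if "t \<in> {0..T}" for t v
  proof -
    have "norm (Q t) * norm v * K \<le> bQ * norm v * K" using bQ that K(1) by (intro mult_right_mono) auto
    then show ?thesis using K(2)[of "Q t" v] by (simp add: q_def mult_ac)
  qed
  have r: "norm (mv (R t) v) \<le> r * norm v" if "t \<in> {0..T}" for t v
  proof -
    have "norm (R t) * norm v * K \<le> bR * norm v * K" using bR that K(1) by (intro mult_right_mono) auto
    then show ?thesis using K(2)[of "R t" v] by (simp add: r_def mult_ac)
  qed
  have "\<exists>\<mu>0. \<forall>\<mu>\<le>\<mu>0. \<forall>f x. solves \<mu> f x \<longrightarrow>
    C * ((norm (x 0))\<^sup>2 + (norm (x T))\<^sup>2) + (p0 / 2) * integral {0..T} (\<lambda>t. (norm (xdot T x t))\<^sup>2)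
      + integral {0..T} (\<lambda>t. (norm (x t))\<^sup>2) \<le> Re (energy \<mu> x x)" if C: "C \<ge> 0" for C
  proof -
    \<comment> \<open>The multiples of |x|^2 to be paid for: r for R, 2C/T from the boundary weight,
      1 for the term to be kept, and 2 (q + C)^2 / p0 from Young's inequality for 2 (q + C) |x| |x'|
      against (p0/2) |x'|^2.\<close>
    define \<mu>0 where "\<mu>0 = - (r + 2 * C / T + 1 + 2 * (q + C)\<^sup>2 / p0)"
    have "C * ((norm (x 0))\<^sup>2 + (norm (x T))\<^sup>2) + (p0 / 2) * integral {0..T} (\<lambda>t. (norm (xdot T x t))\<^sup>2)
      + integral {0..T} (\<lambda>t. (norm (x t))\<^sup>2) \<le> Re (energy \<mu> x x)" if mu: "\<mu> \<le> \<mu>0" and x: "solves \<mu> f x" for \<mu> f x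
    proof -
      note cx = solves_continuous[OF x]
      define g where "g t = C * (2 / T * (norm (x t))\<^sup>2 + 2 * (2 * t / T - 1) * (x t \<bullet> xdot T x t))
          + (p0 / 2) * (norm (xdot T x t))\<^sup>2 + (norm (x t))\<^sup>2" for t
      define h where "h t = yq x t \<bullet> xdot T x t + rhs \<mu> x t \<bullet> x t" for t
      have le: "g t \<le> h t" if t: "t \<in> {0..T}" for t
      proof -
        define a where "a = xdot T x t"
        define b where "b = x t"
        define \<psi> where "\<psi> = 2 * t / T - 1"
        have psi: "\<bar>\<psi>\<bar> \<le> 1" using t T_pos by (auto simp: \<psi>_def abs_le_iff field_simps)
        have "mv (transpose (Q t)) a \<bullet> b = mv (Q t) b \<bullet> a"
          using herm_mv[of "transpose (Q t)" a b] by (metis Re_herm inner_commute transpose_transpose)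
        then have hh: "h t = mv (P t) a \<bullet> a + 2 * (mv (Q t) b \<bullet> a) + mv (R t) b \<bullet> b - \<mu> * (norm b)\<^sup>2"
          by (simp add: h_def yq_eq rhs_def of_real_vector_scalar inner_add_left inner_diff_left a_def b_def power2_norm_eq_inner)
        have i1: "- (mv (Q t) b \<bullet> a) \<le> q * (norm b * norm a)"
        proof -
          have "- (mv (Q t) b \<bullet> a) \<le> norm (mv (Q t) b) * norm a"
            using Cauchy_Schwarz_ineq2[of "mv (Q t) b" a] by linarith
          also have "\<dots> \<le> q * norm b * norm a" using q[OF t] by (intro mult_right_mono) auto
          finally show ?thesis by (simp add: mult_ac)
        qed
        have i2: "- (mv (R t) b \<bullet> b) \<le> r * (norm b)\<^sup>2"
        proof -
          have "- (mv (R t) b \<bullet> b) \<le> norm (mv (R t) b) * norm b"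
            using Cauchy_Schwarz_ineq2[of "mv (R t) b" b] by linarith
          also have "\<dots> \<le> r * norm b * norm b" using r[OF t] by (intro mult_right_mono) auto
          finally show ?thesis by (simp add: power2_eq_square mult_ac)
        qed
        have i3: "C * (2 * \<psi> * (b \<bullet> a)) \<le> 2 * C * (norm b * norm a)"
        proof -
          have "\<psi> * (b \<bullet> a) \<le> \<bar>\<psi>\<bar> * \<bar>b \<bullet> a\<bar>" by (metis abs_ge_self abs_mult)
          also have "\<dots> \<le> 1 * (norm b * norm a)" using psi Cauchy_Schwarz_ineq2 by (intro mult_mono) auto
          finally show ?thesis using C mult_left_mono[of "\<psi> * (b \<bullet> a)" "norm b * norm a" "2 * C"] by (simp add: algebra_simps)
        qed
        have i4: "2 * (q + C) * (norm b * norm a) \<le> (p0 / 2) * (norm a)\<^sup>2 + 2 * (q + C)\<^sup>2 / p0 * (norm b)\<^sup>2"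
        proof -
          have "0 \<le> (p0 / 2) * (norm a - 2 * (q + C) / p0 * norm b)\<^sup>2" using p0(1) by simp
          also have "\<dots> = (p0 / 2) * (norm a)\<^sup>2 + 2 * (q + C)\<^sup>2 / p0 * (norm b)\<^sup>2 - 2 * (q + C) * (norm b * norm a)"
            using p0(1) by (simp add: power2_eq_square field_simps)
          finally show ?thesis by simp
        qed
        have i5: "\<mu> * (norm b)\<^sup>2 \<le> - (r + 2 * C / T + 1 + 2 * (q + C)\<^sup>2 / p0) * (norm b)\<^sup>2"
          using mu unfolding \<mu>0_def by (intro mult_right_mono) auto
        have gg: "g t = 2 * C / T * (norm b)\<^sup>2 + C * (2 * \<psi> * (b \<bullet> a)) + (p0 / 2) * (norm a)\<^sup>2 + (norm b)\<^sup>2"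
          by (simp add: g_def a_def b_def \<psi>_def algebra_simps)
        have "p0 * (norm a)\<^sup>2 \<le> mv (P t) a \<bullet> a" by (rule p0(2)[OF t])
        moreover have "- (r + 2 * C / T + 1 + 2 * (q + C)\<^sup>2 / p0) * (norm b)\<^sup>2 =
            - (r * (norm b)\<^sup>2) - 2 * C / T * (norm b)\<^sup>2 - (norm b)\<^sup>2 - 2 * (q + C)\<^sup>2 / p0 * (norm b)\<^sup>2"
          by (simp add: algebra_simps)
        moreover have "2 * (q + C) * (norm b * norm a) = 2 * (q * (norm b * norm a)) + 2 * C * (norm b * norm a)"
          by (simp add: algebra_simps)
        moreover have "(p0 / 2) * (norm a)\<^sup>2 + (p0 / 2) * (norm a)\<^sup>2 = p0 * (norm a)\<^sup>2" by simp
        ultimately show ?thesis unfolding gg hh using i1 i2 i3 i4 i5 by linarith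
      qed
      have cn: "continuous_on {0..T} (\<lambda>t. (norm (x t))\<^sup>2)" "continuous_on {0..T} (\<lambda>t. (norm (xdot T x t))\<^sup>2)"
        "continuous_on {0..T} (\<lambda>t. 2 / T * (norm (x t))\<^sup>2 + 2 * (2 * t / T - 1) * (x t \<bullet> xdot T x t))"
        by (intro continuous_intros cx | simp add: T_pos less_imp_neq[symmetric])+
      have ig: "(g has_integral (C * integral {0..T} (\<lambda>t. 2 / T * (norm (x t))\<^sup>2 + 2 * (2 * t / T - 1) * (x t \<bullet> xdot T x t))
          + (p0 / 2) * integral {0..T} (\<lambda>t. (norm (xdot T x t))\<^sup>2) + integral {0..T} (\<lambda>t. (norm (x t))\<^sup>2))) {0..T}"
        unfolding g_def
        by (intro has_integral_add has_integral_mult_right integrable_integral integrable_continuous_interval cn)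
      have ch: "continuous_on {0..T} h" unfolding h_def by (intro continuous_intros cx)
      have "integral {0..T} g \<le> integral {0..T} h"
        by (rule integral_le[OF has_integral_integrable[OF ig] integrable_continuous_interval[OF ch] le])
      moreover have "Re (energy \<mu> x x) = integral {0..T} h"
      proof -
        have "(\<lambda>t. herm (yq x t) (xdot T x t) + herm (rhs \<mu> x t) (x t)) integrable_on {0..T}"
          by (intro integrable_add herm_integrable cx)
        from integral_linear[OF this bounded_linear_Re]
        show ?thesis by (simp add: energy_def h_def[abs_def] o_def Re_herm)
      qed
      ultimately show ?thesis
        using integral_unique[OF ig] boundary_norm_identity[OF x] by simp
    qed
    then show ?thesis by blast
  qed
  then show ?thesis using p0(1) by (intro exI[of _ "p0 / 2"]) auto
qed

end


lemma sum_function_apply: "(\<Sum>i\<in>I. f i) t = (\<Sum>i\<in>I. f i t)"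
  for f :: "'i \<Rightarrow> 'a \<Rightarrow> 'b::comm_monoid_add"
  by (induction I rule: infinite_finite_induct) (simp_all add: zero_fun_def plus_fun_def)

context sturm_liouville
begin

lemma bd_parts: "vsnd (vfst (bd x)) = x 0" "vsnd (vsnd (bd x)) = x T"
  by (simp_all add: bd_def phase_eq)

lemma ip_zero_left: "ip (\<lambda>_. 0) u = 0"
  by (simp add: ip_def herm_simps)

lemma solves_shift: "solves \<mu> (\<lambda>t. of_real c *s x t) x \<longleftrightarrow> solves (\<mu> + c) (\<lambda>_. 0) x"
proof -
  have "rhs \<mu> x t - of_real c *s x t = rhs (\<mu> + c) x t - 0" for t
    by (simp add: rhs_def of_real_vector_scalar scaleR_left_distrib)
  then show ?thesis by (simp add: solves_def)
qed

text \<open>Monomials in one fixed coordinate: a vanishing combination is a polynomial with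
  infinitely many zeros.\<close>

lemma HC_infinite_dim:
  "\<exists>C. C \<subseteq> HC \<and> cfun.independent C \<and> finite C \<and> card C = N"
proof -
  define f :: "nat \<Rightarrow> real \<Rightarrow> complex ^ 'n" where
    "f k t = (if t \<in> {0..T} then of_real (t ^ k) *s axis undefined 1 else 0)" for k t
  have f_nth: "f k t $ undefined = of_real t ^ k" if "t \<in> {0..T}" for k t
    using that by (simp add: f_def)
  have "f k \<in> HC" for k
  proof -
    have "continuous_on {0..T} (\<lambda>t. (t ^ k) *\<^sub>R (axis undefined 1 :: complex ^ 'n))" by (intro continuous_intros)
    then have "continuous_on {0..T} (f k)"
      by (rule continuous_on_eq) (simp add: f_def flip: of_real_vector_scalar)
    then show ?thesis by (auto simp: HC_def f_def)
  qed
  moreover have inj: "inj f"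
  proof (rule injI)
    fix j k assume eq: "f j = f k"
    \<comment> \<open>A point of the interval strictly between 0 and 1, at which distinct powers
      differ.\<close>
    define t where "t = min (1 / 2) T"
    have t: "t \<in> {0..T}" "0 < t" "t < 1" using T_pos by (auto simp: t_def)
    have "complex_of_real t ^ j = of_real t ^ k" using f_nth[OF t(1), of j] f_nth[OF t(1), of k] eq by simp
    then have "t ^ j = t ^ k" by (metis of_real_eq_iff of_real_power)
    then show "j = k" using power_inject_exp'[of t j k] t by auto
  qed
  moreover have "cfun.independent (f ` {..<N})"
  proof (rule cfun.independent_if_scalars_zero)
    fix c x assume z: "(\<Sum>x\<in>f ` {..<N}. (\<lambda>t. c x *s x t)) = 0" and x: "x \<in> f ` {..<N}"
    define a where "a k = (if k < N then c (f k) else 0)" for k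
    have "(\<Sum>i\<le>N. a i * of_real t ^ i) = 0" if t: "t \<in> {0..T}" for t
    proof -
      have "(\<Sum>x\<in>f ` {..<N}. (\<lambda>t. c x *s x t)) t $ undefined = (\<Sum>k<N. c (f k) * of_real t ^ k)"
        using inj f_nth[OF t] by (subst sum.reindex) (auto simp: inj_on_def inj_def sum_function_apply)
      then have "(\<Sum>k<N. c (f k) * of_real t ^ k) = 0" unfolding z by (simp add: zero_fun_def)
      moreover have "(\<Sum>i\<le>N. a i * of_real t ^ i) = (\<Sum>k<N. c (f k) * of_real t ^ k)"
        by (rule sum.mono_neutral_cong_right) (auto simp: a_def)
      ultimately show ?thesis by simp
    qed
    then have "complex_of_real ` {0..T} \<subseteq> {z. (\<Sum>i\<le>N. a i * z ^ i) = 0}" by auto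
    moreover have "infinite (complex_of_real ` {0..T})"
      using T_pos infinite_Icc[of 0 T] by (simp add: finite_image_iff inj_on_def)
    ultimately have "infinite {z. (\<Sum>i\<le>N. a i * z ^ i) = 0}" using finite_subset by blast
    then have a0: "a i = 0" if "i \<le> N" for i using that polyfun_finite_roots[where n = N and c = a] by blast
    obtain k where "k < N" "x = f k" using x by auto
    then show "c x = 0" using a0[of k] by (simp add: a_def)
  qed simp
  ultimately show ?thesis
    by (intro exI[of _ "f ` {..<N}"]) (auto simp: card_image inj_on_subset[OF inj])
qed

end

section \<open>The resolvent as a compact positive operator\<close>

locale sl_operator = sturm_liouville T P Q R
  for T :: real and P Q R :: "real \<Rightarrow> real ^ 'n ^ 'n" +
  fixes L :: "(complex ^ (('n + 'n) + ('n + 'n))) set" and C p \<mu>0 :: real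
  assumes L_Lag: "L \<in> Lag" and p_pos: "0 < p"
    and L_bound: "\<And>w. w \<in> L \<Longrightarrow>
      Re (bdry_form w w) \<le> C * ((norm (vsnd (vfst w)))\<^sup>2 + (norm (vsnd (vsnd w)))\<^sup>2)"
    and coercive: "\<And>\<mu> f x. \<mu> \<le> \<mu>0 \<Longrightarrow> solves \<mu> f x \<Longrightarrow>
      C * ((norm (x 0))\<^sup>2 + (norm (x T))\<^sup>2) + p * integral {0..T} (\<lambda>t. (norm (xdot T x t))\<^sup>2)
      + integral {0..T} (\<lambda>t. (norm (x t))\<^sup>2) \<le> Re (energy \<mu> x x)"
begin

lemma L_subspace: "vec.subspace L"
  and L_isotropic: "u \<in> L \<Longrightarrow> v \<in> L \<Longrightarrow> Omega u v = 0"
  and L_dim: "vec.dim L = 2 * CARD('n)"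
  using L_Lag by (auto simp: Lag_def)

text \<open>By Green's formula <f, x> is the energy minus the boundary form, and the C-term of the
  coercivity estimate pays for the latter.\<close>

lemma lower_bound:
  assumes "\<mu> \<le> \<mu>0" "solves \<mu> f x" "bd x \<in> L" "continuous_on {0..T} f"
  shows "p * integral {0..T} (\<lambda>t. (norm (xdot T x t))\<^sup>2) + integral {0..T} (\<lambda>t. (norm (x t))\<^sup>2) \<le> Re (ip f x)"
  using coercive[OF assms(1,2)] L_bound[OF assms(3)] Green[OF assms(2,2,4)]
  by (simp add: bd_parts)

lemma integral_norm_sq_nonneg:
  "continuous_on {0..T} g \<Longrightarrow> 0 \<le> integral {0..T} (\<lambda>t. (norm (g t))\<^sup>2)" for g :: "real \<Rightarrow> complex ^ 'n"
  by (intro integral_nonneg integrable_continuous_interval continuous_intros) auto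

lemma lower_bound':
  assumes "\<mu> \<le> \<mu>0" "solves \<mu> f x" "bd x \<in> L" "continuous_on {0..T} f"
  shows "Re (ip x x) \<le> Re (ip f x)"
proof -
  have "0 \<le> p * integral {0..T} (\<lambda>t. (norm (xdot T x t))\<^sup>2)"
    using integral_norm_sq_nonneg[OF solves_continuous(3)[OF assms(2)]] p_pos by simp
  then show ?thesis using lower_bound[OF assms] Re_ip[OF solves_HC[OF assms(2)]] by simp
qed

lemma Sol_trivial:
  assumes "\<mu> \<le> \<mu>0" "x \<in> Sol \<mu>" "bd x \<in> L"
  shows "x = 0"
proof (rule ccontr)
  assume "x \<noteq> 0"
  have x: "solves \<mu> (\<lambda>_. 0) x" using assms(2) by (simp add: Sol_def)
  have "Re (ip x x) \<le> Re (ip (\<lambda>_. 0) x)" by (rule lower_bound'[OF assms(1) x assms(3)]) simp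
  then show False using ip_positive[OF solves_HC[OF x] \<open>x \<noteq> 0\<close>] by (simp add: ip_zero_left)
qed

lemma Gr_trivial: "\<mu> \<le> \<mu>0 \<Longrightarrow> Gr \<mu> \<inter> L \<subseteq> {0}"
  using Sol_trivial bd_zero by (auto simp: Gr_def)

text \<open>A Fredholm alternative by dimension count: \<open>Gr \<mu>0\<close> and L have dimension
  2n each and meet trivially, so their sum is everything and a homogeneous solution corrects the
  boundary values of any particular solution.\<close>

lemma bvp_exists:
  assumes f: "continuous_on {0..T} f"
  shows "\<exists>x. solves \<mu>0 f x \<and> bd x \<in> L"
proof -
  obtain x where x: "solves \<mu>0 f x" using solves_exists[OF f, of \<mu>0 0 0] by blast
  define V where "V = {g + l |g l. g \<in> Gr \<mu>0 \<and> l \<in> L}"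
  have sV: "vec.subspace V" unfolding V_def using subspace_Gr L_subspace by (rule vec.subspace_sums)
  have "Gr \<mu>0 \<subseteq> V" "L \<subseteq> V" unfolding V_def
    using vec.subspace_0[OF L_subspace] vec.subspace_0[OF subspace_Gr] by force+
  then have "vec.dim (Gr \<mu>0) + vec.dim L \<le> vec.dim (Gr \<mu>0 \<inter> L) + vec.dim V"
    by (intro vec_dim_Int L_subspace subspace_Gr sV)
  moreover have "vec.dim (Gr \<mu>0 \<inter> L) = 0" using Gr_trivial[OF order_refl] by simp
  ultimately have "4 * CARD('n) \<le> vec.dim V" using dim_Gr[of \<mu>0] L_dim by linarith
  then have "vec.dim (UNIV :: (complex ^ (('n + 'n) + ('n + 'n))) set) \<le> vec.dim V"
    by (simp add: vec.dim_UNIV card_cart_basis card_UNIV_sum)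
  then have "V = UNIV" using vec.subspace_dim_equal[OF sV vec.subspace_UNIV subset_UNIV] by blast
  then have "bd x \<in> V" by simp
  then obtain h l where h: "h \<in> Sol \<mu>0" "l \<in> L" "bd x = bd h + l" by (auto simp: V_def Gr_def)
  have hs: "solves \<mu>0 (\<lambda>_. 0) h" using h(1) by (simp add: Sol_def)
  have "solves \<mu>0 f (x - h)" "bd (x - h) = l"
    using solves_minus[OF x hs] h(3) by simp_all
  then show ?thesis using h(2) by blast
qed

lemma bvp_unique:
  assumes "solves \<mu>0 f x" "bd x \<in> L" "solves \<mu>0 f u" "bd u \<in> L"
  shows "x = u"
proof -
  have "x - u \<in> Sol \<mu>0" using solves_minus(1)[OF assms(1,3)] by (simp add: Sol_def)
  moreover have "bd (x - u) \<in> L"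
    using solves_minus(2)[OF assms(1,3)] vec.subspace_diff[OF L_subspace assms(2,4)] by simp
  ultimately have "x - u = 0" using Sol_trivial by blast
  then show ?thesis by simp
qed

text \<open>The resolvent of A with boundary condition L at \<mu>0, restricted to continuous
  right-hand sides.\<close>

definition Kop :: "(real \<Rightarrow> complex ^ 'n) \<Rightarrow> real \<Rightarrow> complex ^ 'n" where
  "Kop f = (THE x. solves \<mu>0 f x \<and> bd x \<in> L)"

lemma Kop_eq: "solves \<mu>0 f x \<Longrightarrow> bd x \<in> L \<Longrightarrow> Kop f = x"
  unfolding Kop_def by (rule the_equality) (auto intro: bvp_unique)

lemma Kop: "f \<in> HC \<Longrightarrow> solves \<mu>0 f (Kop f)" "f \<in> HC \<Longrightarrow> bd (Kop f) \<in> L"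
proof -
  assume "f \<in> HC"
  then obtain x where "solves \<mu>0 f x" "bd x \<in> L" using bvp_exists[of f] by (auto simp: HC_def)
  then show "solves \<mu>0 f (Kop f)" "bd (Kop f) \<in> L" using Kop_eq by simp_all
qed

lemma HC_cont: "f \<in> HC \<Longrightarrow> continuous_on {0..T} f"
  by (simp add: HC_def)

lemma Kop_HC: "f \<in> HC \<Longrightarrow> Kop f \<in> HC"
  using Kop(1) solves_HC by blast

lemma Kop_add: "f \<in> HC \<Longrightarrow> g \<in> HC \<Longrightarrow> Kop (f + g) = Kop f + Kop g"
  using solves_add[OF Kop(1) Kop(1), of f g] vec.subspace_add[OF L_subspace Kop(2) Kop(2), of f g]
  by (intro Kop_eq) (simp_all add: plus_fun_def)

lemma Kop_scale: "f \<in> HC \<Longrightarrow> Kop (\<lambda>t. c *s f t) = (\<lambda>t. c *s Kop f t)"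
  using solves_scale[OF Kop(1), of f c] vec.subspace_scale[OF L_subspace Kop(2), of f c]
  by (intro Kop_eq) simp_all

lemma Kop_symmetric:
  assumes f: "f \<in> HC" and g: "g \<in> HC"
  shows "ip (Kop f) g = ip f (Kop g)"
proof -
  have sym: "ip g (Kop f) = cnj (ip (Kop f) g)"
    using hermitian_form.ip_sym[OF HC_hermitian_form Kop_HC[OF f] g] .
  have "bdry_form (bd (Kop f)) (bd (Kop g)) = energy \<mu>0 (Kop f) (Kop g) - ip f (Kop g)"
    by (rule Green[OF Kop(1)[OF f] Kop(1)[OF g] HC_cont[OF f]])
  moreover have "bdry_form (bd (Kop g)) (bd (Kop f)) = cnj (energy \<mu>0 (Kop f) (Kop g)) - ip g (Kop f)"
    using Green[OF Kop(1)[OF g] Kop(1)[OF f] HC_cont[OF g]] energy_sym[of \<mu>0 "Kop g" "Kop f"] by simp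
  moreover have "Omega (bd (Kop f)) (bd (Kop g)) = 0" using L_isotropic Kop(2) f g by blast
  ultimately show ?thesis using sym by (simp add: Omega_bdry_form)
qed

lemma Re_ip_Kop: "f \<in> HC \<Longrightarrow> Re (ip (Kop f) f) = Re (ip f (Kop f))"
  using Kop_symmetric[of f f] by simp

text \<open>If \<open>Kop f\<close> were 0, the zero function would solve the equation with
  right-hand side f and with right-hand side 0; derivatives within the interval are unique.\<close>

lemma Kop_nonzero:
  assumes f: "f \<in> HC" "f \<noteq> 0"
  shows "Kop f \<noteq> 0"
proof
  assume k: "Kop f = 0"
  have s: "solves \<mu>0 f 0" "solves \<mu>0 (\<lambda>_. 0) 0" using Kop(1)[OF f(1)] solves_zero k by simp_all
  have "f t = 0" for t
  proof (cases "t \<in> {0..T}")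
    case True
    have "rhs \<mu>0 0 t - f t = vector_derivative (yq 0) (at t within {0..T})"
      using vector_derivative_within_closed_interval[OF T_pos True solvesD(3)[OF s(1) True]] by simp
    moreover have "rhs \<mu>0 0 t - 0 = vector_derivative (yq 0) (at t within {0..T})"
      using vector_derivative_within_closed_interval[OF T_pos True solvesD(3)[OF s(2) True]] by simp
    ultimately show ?thesis by simp
  qed (use f in \<open>simp add: HC_def\<close>)
  then show False using f(2) by (simp add: fun_eq_iff zero_fun_def)
qed

lemma Kop_positive: "f \<in> HC \<Longrightarrow> f \<noteq> 0 \<Longrightarrow> 0 < Re (ip (Kop f) f)"
  using lower_bound'[OF order_refl Kop(1) Kop(2) HC_cont, of f] Re_ip_Kop[of f]
    ip_positive[OF Kop_HC Kop_nonzero, of f] by simp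

text \<open>|K f|^2 \<le> Re <f, K f> \<le> |f| |K f|, where the first inequality relies on the
  coefficient 1 of the integral of |x|^2 in the coercivity estimate.\<close>

lemma Kop_contraction:
  assumes f: "f \<in> HC"
  shows "Re (ip (Kop f) (Kop f)) \<le> Re (ip f f)"
proof -
  interpret hf: hermitian_form "\<lambda>(c::complex) x t. c *s x t" HC ip by (rule HC_hermitian_form)
  have "(hf.nrm (Kop f))\<^sup>2 \<le> Re (ip f (Kop f))"
    using lower_bound'[OF order_refl Kop(1)[OF f] Kop(2)[OF f] HC_cont[OF f]] by (simp add: hf.nrm_sq Kop_HC f)
  also have "\<dots> \<le> hf.nrm f * hf.nrm (Kop f)"
    using hf.cs_nrm[OF f Kop_HC[OF f]] complex_Re_le_cmod[of "ip f (Kop f)"] by linarith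
  finally have "hf.nrm (Kop f) * hf.nrm (Kop f) \<le> hf.nrm f * hf.nrm (Kop f)" by (simp add: power2_eq_square)
  then have "hf.nrm (Kop f) \<le> hf.nrm f"
    using hf.nrm_ge0[OF f] hf.nrm_ge0[OF Kop_HC[OF f]] by (cases "hf.nrm (Kop f) = 0") (auto simp: mult_le_cancel_right)
  then have "(hf.nrm (Kop f))\<^sup>2 \<le> (hf.nrm f)\<^sup>2" using hf.nrm_ge0[OF Kop_HC[OF f]] by (rule power_mono)
  then show ?thesis by (simp add: hf.nrm_sq Kop_HC f)
qed

text \<open>Bounds in \<open>H\<^sup>1\<close> give equicontinuity, via \<open>2 \<bar>a\<bar> \<le> \<eta> a\<^sup>2 + 1/\<eta>\<close> under the integral.\<close>

lemma increment_bound: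
  assumes x: "solves \<mu> f x" and st: "0 \<le> s" "s \<le> t" "t \<le> T" and eta: "0 < \<eta>"
    and b: "integral {0..T} (\<lambda>t. (norm (xdot T x t))\<^sup>2) \<le> B"
  shows "norm (x t - x s) \<le> \<eta> * B / 2 + (t - s) / (2 * \<eta>)"
proof -
  note cx = solves_continuous[OF x]
  have sub: "{s..t} \<subseteq> {0..T}" using st by auto
  have i: "((\<lambda>t. xdot T x t) has_integral (x t - x s)) {s..t}"
    by (rule fundamental_theorem_of_calculus[OF st(2)])
      (rule has_vector_derivative_within_subset[OF solvesD(2)[OF x]]; use st in auto)
  have cn: "continuous_on {0..T} (\<lambda>r. \<eta> / 2 * (norm (xdot T x r))\<^sup>2)" by (intro continuous_intros cx)
  have cn': "continuous_on {s..t} (\<lambda>r. \<eta> / 2 * (norm (xdot T x r))\<^sup>2)" using cn sub by (rule continuous_on_subset)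
  have "norm (integral {s..t} (xdot T x)) \<le> integral {s..t} (\<lambda>r. \<eta> / 2 * (norm (xdot T x r))\<^sup>2 + 1 / (2 * \<eta>))"
  proof (rule integral_norm_bound_integral)
    show "xdot T x integrable_on {s..t}" using i by blast
    show "(\<lambda>r. \<eta> / 2 * (norm (xdot T x r))\<^sup>2 + 1 / (2 * \<eta>)) integrable_on {s..t}"
      by (intro integrable_continuous_interval continuous_intros cn')
    fix r
    define a where "a = norm (xdot T x r)"
    have "0 \<le> (\<eta> * a - 1)\<^sup>2 / (2 * \<eta>)" using eta by simp
    also have "\<dots> = \<eta> / 2 * a\<^sup>2 + 1 / (2 * \<eta>) - a"
      using eta by (simp add: power2_eq_square field_simps)
    finally show "norm (xdot T x r) \<le> \<eta> / 2 * (norm (xdot T x r))\<^sup>2 + 1 / (2 * \<eta>)" by (simp add: a_def)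
  qed
  also have "\<dots> = integral {s..t} (\<lambda>r. \<eta> / 2 * (norm (xdot T x r))\<^sup>2) + integral {s..t} (\<lambda>r. 1 / (2 * \<eta>))"
    by (intro integral_add integrable_continuous_interval continuous_on_const cn')
  also have "integral {s..t} (\<lambda>r. 1 / (2 * \<eta>)) = (t - s) / (2 * \<eta>)" using st by simp
  also have "integral {s..t} (\<lambda>r. \<eta> / 2 * (norm (xdot T x r))\<^sup>2) \<le> integral {0..T} (\<lambda>r. \<eta> / 2 * (norm (xdot T x r))\<^sup>2)"
    using eta by (intro integral_subset_le sub integrable_continuous_interval cn cn') auto
  also have "integral {0..T} (\<lambda>r. \<eta> / 2 * (norm (xdot T x r))\<^sup>2) \<le> \<eta> * B / 2"
    using b eta by (simp add: mult_left_mono)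
  finally show ?thesis using integral_unique[OF i] by simp
qed

text \<open>The coercivity estimate bounds the images uniformly in H^1. Equicontinuity and a
  pointwise bound follow, and the uniform limit of a subsequence is continuous, hence again in
  \<open>HC\<close>.\<close>

lemma Kop_compact:
  assumes u: "\<And>n. u n \<in> HC" "\<And>n. Re (ip (u n) (u n)) \<le> 1"
  shows "\<exists>v\<in>HC. \<exists>s. strict_mono (s :: nat \<Rightarrow> nat) \<and>
        (\<lambda>n. Re (ip (Kop (u (s n)) - v) (Kop (u (s n)) - v))) \<longlonglongrightarrow> 0"
proof -
  interpret hf: hermitian_form "\<lambda>(c::complex) x t. c *s x t" HC ip by (rule HC_hermitian_form)
  define x where "x n = Kop (u n)" for n
  have xs: "solves \<mu>0 (u n) (x n)" and xL: "bd (x n) \<in> L" and xH: "x n \<in> HC" for n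
    unfolding x_def using Kop Kop_HC u(1) by auto
  define B where "B = 1 / p"
  have B0: "0 < B" using p_pos by (simp add: B_def)
  have bounds: "integral {0..T} (\<lambda>t. (norm (xdot T (x n) t))\<^sup>2) \<le> B" "integral {0..T} (\<lambda>t. (norm (x n t))\<^sup>2) \<le> 1" for n
  proof -
    have "Re (ip (u n) (x n)) \<le> hf.nrm (u n) * hf.nrm (x n)"
      using hf.cs_nrm[OF u(1) xH, of n n] complex_Re_le_cmod[of "ip (u n) (x n)"] by linarith
    also have "\<dots> \<le> 1 * 1"
      using u(2)[of n] Kop_contraction[OF u(1)[of n]] hf.ip_nonneg[OF xH[of n]]
      by (intro mult_mono) (auto simp: hf.nrm_def x_def)
    finally have "p * integral {0..T} (\<lambda>t. (norm (xdot T (x n) t))\<^sup>2) + integral {0..T} (\<lambda>t. (norm (x n t))\<^sup>2) \<le> 1"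
      using lower_bound[OF order_refl xs xL HC_cont[OF u(1)], of n] by linarith
    moreover have "0 \<le> integral {0..T} (\<lambda>t. (norm (xdot T (x n) t))\<^sup>2)" "0 \<le> integral {0..T} (\<lambda>t. (norm (x n t))\<^sup>2)"
      using solves_continuous[OF xs[of n]] by (intro integral_norm_sq_nonneg; simp)+
    moreover from this have "0 \<le> p * integral {0..T} (\<lambda>t. (norm (xdot T (x n) t))\<^sup>2)" using p_pos by simp
    ultimately have "p * integral {0..T} (\<lambda>t. (norm (xdot T (x n) t))\<^sup>2) \<le> 1" "integral {0..T} (\<lambda>t. (norm (x n t))\<^sup>2) \<le> 1"
      by linarith+
    then show "integral {0..T} (\<lambda>t. (norm (xdot T (x n) t))\<^sup>2) \<le> B" "integral {0..T} (\<lambda>t. (norm (x n t))\<^sup>2) \<le> 1"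
      using p_pos by (auto simp: B_def field_simps)
  qed
  have incr: "norm (x n t - x n s) \<le> \<eta> * B / 2 + \<bar>t - s\<bar> / (2 * \<eta>)"
    if "s \<in> {0..T}" "t \<in> {0..T}" "0 < \<eta>" for n s t \<eta>
  proof (cases "s \<le> t")
    case True
    then show ?thesis using increment_bound[OF xs[of n] _ True _ that(3) bounds(1)] that by auto
  next
    case False
    then show ?thesis
      using increment_bound[OF xs[of n] _ _ _ that(3) bounds(1), of t s] that by (auto simp: norm_minus_commute)
  qed
  \<comment> \<open>Comparison with another point s costs at most B/2 + T/2, by \<open>incr\<close>
    with \<eta> = 1; averaging |x(s)| \<le> (1 + |x(s)|^2)/2 over s gives (T + 1)/(2T).\<close>
  define M where "M = B / 2 + T / 2 + (T + 1) / (2 * T)"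
  have bound: "norm (x n t) \<le> M" if t: "t \<in> {0..T}" for n t
  proof -
    define b where "b = B / 2 + T / 2"
    have cx: "continuous_on {0..T} (\<lambda>s. (1 + (norm (x n s))\<^sup>2) / 2)"
      using HC_cont[OF xH[of n]] by (intro continuous_intros) auto
    have "norm (x n t) - b \<le> (1 + (norm (x n s))\<^sup>2) / 2" if s: "s \<in> {0..T}" for s
    proof -
      have "norm (x n t) \<le> norm (x n s) + norm (x n t - x n s)"
        using norm_triangle_ineq[of "x n s" "x n t - x n s"] by simp
      moreover have "\<bar>t - s\<bar> \<le> T" using s t by auto
      then have "norm (x n t - x n s) \<le> b" using incr[OF s t, of 1 n] by (simp add: b_def)
      moreover have "norm (x n s) \<le> (1 + (norm (x n s))\<^sup>2) / 2"
        using zero_le_power2[of "norm (x n s) - 1"] by (simp add: power2_diff)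
      ultimately show ?thesis by linarith
    qed
    then have "integral {0..T} (\<lambda>s. norm (x n t) - b) \<le> integral {0..T} (\<lambda>s. (1 + (norm (x n s))\<^sup>2) / 2)"
      by (intro integral_le integrable_continuous_interval cx continuous_on_const)
    also have "\<dots> = (T + integral {0..T} (\<lambda>s. (norm (x n s))\<^sup>2)) / 2"
    proof -
      have "integral {0..T} (\<lambda>s. 1 + (norm (x n s))\<^sup>2) = integral {0..T} (\<lambda>s. 1) + integral {0..T} (\<lambda>s. (norm (x n s))\<^sup>2)"
        using HC_cont[OF xH[of n]] by (intro integral_add integrable_continuous_interval continuous_intros)
      then show ?thesis using T_pos by simp
    qed
    also have "\<dots> \<le> (T + 1) / 2" using bounds(2)[of n] by simp
    finally have "T * (norm (x n t) - b) \<le> (T + 1) / 2" using T_pos by simp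
    then have "norm (x n t) - b \<le> (T + 1) / (2 * T)" using T_pos by (simp add: field_simps)
    then show ?thesis by (simp add: M_def b_def)
  qed
  have equi: "\<exists>d>0. \<forall>n y. y \<in> {0..T} \<and> norm (t - y) < d \<longrightarrow> norm (x n t - x n y) < e"
    if t: "t \<in> {0..T}" and e: "0 < e" for t e
  proof -
    \<comment> \<open>\<eta> = e/B makes the first term of \<open>incr\<close> equal to e/2, and the
      radius e \<eta> makes the second smaller than e/2.\<close>
    define \<eta> where "\<eta> = e / B"
    have eta: "0 < \<eta>" using e B0 by (simp add: \<eta>_def)
    have "norm (x n t - x n y) < e" if y: "y \<in> {0..T}" "norm (t - y) < e * \<eta>" for n y
    proof -
      have "norm (x n t - x n y) \<le> \<eta> * B / 2 + \<bar>t - y\<bar> / (2 * \<eta>)" by (rule incr[OF y(1) t eta])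
      also have "\<eta> * B = e" using B0 by (simp add: \<eta>_def)
      also have "\<bar>t - y\<bar> / (2 * \<eta>) < e / 2" using y(2) eta by (simp add: field_simps)
      finally show ?thesis by simp
    qed
    then show ?thesis using e eta by (intro exI[of _ "e * \<eta>"]) auto
  qed
  obtain g s where g: "continuous_on {0..T} g" "strict_mono (s :: nat \<Rightarrow> nat)"
    "\<And>e. 0 < e \<Longrightarrow> \<exists>N. \<forall>n t. n \<ge> N \<and> t \<in> {0..T} \<longrightarrow> norm (x (s n) t - g t) < e"
    by (rule Arzela_Ascoli[OF compact_Icc bound equi]) auto
  define v where "v t = (if t \<in> {0..T} then g t else 0)" for t
  have vH: "v \<in> HC"
  proof -
    have "continuous_on {0..T} v" by (rule continuous_on_eq[OF g(1)]) (simp add: v_def)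
    then show ?thesis by (auto simp: HC_def v_def)
  qed
  have "(\<lambda>n. Re (ip (x (s n) - v) (x (s n) - v))) \<longlonglongrightarrow> 0"
  proof (rule LIMSEQ_I)
    fix r :: real assume r: "0 < r"
    define e where "e = sqrt (r / (2 * T))"
    have e: "0 < e" "T * e\<^sup>2 < r" using r T_pos by (auto simp: e_def)
    obtain N where N: "\<And>n t. n \<ge> N \<Longrightarrow> t \<in> {0..T} \<Longrightarrow> norm (x (s n) t - g t) < e" using g(3)[OF e(1)] by blast
    have "norm (Re (ip (x (s n) - v) (x (s n) - v)) - 0) < r" if n: "n \<ge> N" for n
    proof -
      have dH: "x (s n) - v \<in> HC" using hf.H_closed(4)[OF xH vH] .
      have "Re (ip (x (s n) - v) (x (s n) - v)) = integral {0..T} (\<lambda>t. (norm ((x (s n) - v) t))\<^sup>2)" by (rule Re_ip[OF dH])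
      also have "\<dots> \<le> integral {0..T} (\<lambda>t. e\<^sup>2)"
      proof (rule integral_le)
        show "(\<lambda>t. (norm ((x (s n) - v) t))\<^sup>2) integrable_on {0..T}"
          using HC_cont[OF dH] by (intro integrable_continuous_interval continuous_intros)
        show "(\<lambda>t. e\<^sup>2) integrable_on {0..T}" by (intro integrable_continuous_interval continuous_on_const)
        show "(norm ((x (s n) - v) t))\<^sup>2 \<le> e\<^sup>2" if t: "t \<in> {0..T}" for t
          using N[OF n t] t by (intro power_mono) (auto simp: v_def)
      qed
      also have "\<dots> = T * e\<^sup>2" using T_pos by simp
      finally show ?thesis using e(2) hf.ip_nonneg[OF dH] by simp
    qed
    then show "\<exists>no. \<forall>n\<ge>no. norm (Re (ip (x (s n) - v) (x (s n) - v)) - 0) < r" by blast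
  qed
  then show ?thesis using vH g(2) unfolding x_def by blast
qed

text \<open>K f = \<kappa> f says that f itself solves the equation with right-hand side f/\<kappa>,
  which is absorbed into the spectral parameter.\<close>

lemma Eig_eq_Sol:
  assumes k: "0 < \<kappa>"
  shows "{f \<in> HC. Kop f = (\<lambda>t. of_real \<kappa> *s f t)} = {x \<in> Sol (\<mu>0 + 1 / \<kappa>). bd x \<in> L}"
proof (intro equalityI subsetI)
  fix f assume "f \<in> {f \<in> HC. Kop f = (\<lambda>t. of_real \<kappa> *s f t)}"
  then have f: "f \<in> HC" "Kop f = (\<lambda>t. of_real \<kappa> *s f t)" by auto
  have e: "(\<lambda>t. of_real (1 / \<kappa>) *s Kop f t) = f" using k by (simp add: f(2) fun_eq_iff)
  have "solves \<mu>0 (\<lambda>t. of_real (1 / \<kappa>) *s f t) f" "bd f = of_real (1 / \<kappa>) *s bd (Kop f)"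
    using solves_scale[OF Kop(1)[OF f(1)], of "of_real (1 / \<kappa>)"] unfolding e by simp_all
  then show "f \<in> {x \<in> Sol (\<mu>0 + 1 / \<kappa>). bd x \<in> L}"
    using vec.subspace_scale[OF L_subspace Kop(2)[OF f(1)]] by (simp add: Sol_def solves_shift del: of_real_divide)
next
  fix x assume "x \<in> {x \<in> Sol (\<mu>0 + 1 / \<kappa>). bd x \<in> L}"
  then have x: "solves (\<mu>0 + 1 / \<kappa>) (\<lambda>_. 0) x" "bd x \<in> L" by (auto simp: Sol_def)
  then have s: "solves \<mu>0 (\<lambda>t. of_real (1 / \<kappa>) *s x t) x" using solves_shift by blast
  have e: "(\<lambda>t. of_real \<kappa> *s (of_real (1 / \<kappa>) *s x t)) = x" using k by (simp add: fun_eq_iff)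
  have "solves \<mu>0 x (\<lambda>t. of_real \<kappa> *s x t)" "bd (\<lambda>t. of_real \<kappa> *s x t) = of_real \<kappa> *s bd x"
    using solves_scale[OF s, of "of_real \<kappa>"] unfolding e by simp_all
  then have "Kop x = (\<lambda>t. of_real \<kappa> *s x t)"
    using vec.subspace_scale[OF L_subspace x(2)] by (intro Kop_eq) simp_all
  then show "x \<in> {f \<in> HC. Kop f = (\<lambda>t. of_real \<kappa> *s f t)}" using solves_HC[OF x(1)] by simp
qed

lemma Kop_compact_positive: "compact_positive (\<lambda>(c::complex) x t. c *s x t) HC ip Kop"
proof -
  interpret hf: hermitian_form "\<lambda>(c::complex) x t. c *s x t" HC ip by (rule HC_hermitian_form)
  show ?thesis
  proof unfold_locales
    fix \<kappa> :: real
    \<comment> \<open>For \<kappa> \<le> 0 there is no corresponding solution space; positivity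
      shows that the eigenspace is trivial.\<close>
    have nr: "f = 0" if f: "f \<in> HC" "Kop f = (\<lambda>t. of_real \<kappa> *s f t)" "\<kappa> \<le> 0" for f
    proof (rule ccontr)
      assume "f \<noteq> 0"
      have "ip (Kop f) f = of_real \<kappa> * ip f f" unfolding f(2) by (rule hf.ip_scale[OF f(1) f(1)])
      then have "Re (ip (Kop f) f) = \<kappa> * Re (ip f f)" by simp
      then show False
        using Kop_positive[OF f(1) \<open>f \<noteq> 0\<close>] f(3) hf.ip_nonneg[OF f(1)] by (simp add: mult_nonpos_nonneg leD)
    qed
    show "\<exists>B. finite B \<and> {f \<in> HC. Kop f = (\<lambda>t. of_real \<kappa> *s f t)} \<subseteq> cfun.span B"
    proof (cases "0 < \<kappa>")
      case True
      then show ?thesis using finite_basis_Sol[of "\<mu>0 + 1 / \<kappa>"] Eig_eq_Sol[OF True] by blast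
    next
      case False
      then have "{f \<in> HC. Kop f = (\<lambda>t. of_real \<kappa> *s f t)} \<subseteq> cfun.span {}" using nr by auto
      then show ?thesis by blast
    qed
    show "\<exists>C. C \<subseteq> HC \<and> cfun.independent C \<and> finite C \<and> card C = N" for N by (rule HC_infinite_dim)
  qed (fact ip_positive Kop_HC Kop_add Kop_scale Kop_symmetric Kop_positive Kop_contraction Kop_compact)+
qed

sublocale kop: compact_positive "\<lambda>(c::complex) x t. c *s x t" HC ip Kop
  by (rule Kop_compact_positive)

abbreviation mul :: "real \<Rightarrow> nat" where
  "mul \<equiv> multiplicity_at T P Q R L"

lemma dim_Eig: "0 < \<kappa> \<Longrightarrow> cfun.dim (kop.Eig \<kappa>) = mul (\<mu>0 + 1 / \<kappa>)"
  unfolding kop.Eig_def multiplicity_at_def eigenspace_eq by (simp add: Eig_eq_Sol)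

lemma mul_zero: "\<mu> \<le> \<mu>0 \<Longrightarrow> mul \<mu> = 0"
  using Gr_trivial[of \<mu>] by (simp add: multiplicity_eq[OF L_subspace])

text \<open>\<mu>0 + 1/\<kappa> reverses the order and matches \<kappa> \<ge> 1/(c - \<mu>0) with
  \<mu>0 < \<mu> \<le> c; at and below \<mu>0 there are no eigenvalues.\<close>

lemma mul_support:
  assumes c: "\<mu>0 < c"
  shows "{\<mu>. \<mu> \<le> c \<and> 0 < mul \<mu>} = (\<lambda>\<kappa>. \<mu>0 + 1 / \<kappa>) ` kop.spec (1 / (c - \<mu>0))"
proof (intro equalityI subsetI)
  fix \<mu> assume "\<mu> \<in> {\<mu>. \<mu> \<le> c \<and> 0 < mul \<mu>}"
  then have m: "\<mu> \<le> c" "0 < mul \<mu>" by auto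
  then have mu: "\<mu>0 < \<mu>" using mul_zero[of \<mu>] by force
  have "1 / (\<mu> - \<mu>0) \<in> kop.spec (1 / (c - \<mu>0))"
    unfolding kop.spec_def using m mu dim_Eig[of "1 / (\<mu> - \<mu>0)"] by (simp add: frac_le)
  then show "\<mu> \<in> (\<lambda>\<kappa>. \<mu>0 + 1 / \<kappa>) ` kop.spec (1 / (c - \<mu>0))"
    by (intro image_eqI[of _ _ "1 / (\<mu> - \<mu>0)"]) simp_all
next
  fix \<mu> assume "\<mu> \<in> (\<lambda>\<kappa>. \<mu>0 + 1 / \<kappa>) ` kop.spec (1 / (c - \<mu>0))"
  then obtain \<kappa> where k: "\<mu> = \<mu>0 + 1 / \<kappa>" "1 / (c - \<mu>0) \<le> \<kappa>" "0 < cfun.dim (kop.Eig \<kappa>)"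
    by (auto simp: kop.spec_def)
  have cp: "0 < 1 / (c - \<mu>0)" using c by simp
  then have k0: "0 < \<kappa>" using k(2) by linarith
  have "1 / \<kappa> \<le> c - \<mu>0" using k(2) k0 c by (simp add: field_simps)
  then show "\<mu> \<in> {\<mu>. \<mu> \<le> c \<and> 0 < mul \<mu>}" using k dim_Eig[OF k0] by simp
qed

lemma mass_count:
  assumes c: "\<mu>0 < c"
  shows "mass_upto mul c = kop.count (1 / (c - \<mu>0))"
proof -
  have pos: "0 < \<kappa>" if "\<kappa> \<in> kop.spec (1 / (c - \<mu>0))" for \<kappa>
  proof -
    have "0 < 1 / (c - \<mu>0)" using c by simp
    moreover have "1 / (c - \<mu>0) \<le> \<kappa>" using that by (simp add: kop.spec_def)
    ultimately show ?thesis by linarith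
  qed
  have inj: "inj_on (\<lambda>\<kappa>. \<mu>0 + 1 / \<kappa>) (kop.spec (1 / (c - \<mu>0)))"
    using pos by (auto intro!: inj_onI simp: field_simps)
  show ?thesis
    unfolding mass_upto_def mul_support[OF c] kop.count_def sum.reindex[OF inj] o_def
    by (rule sum.cong[OF refl]) (simp add: dim_Eig pos)
qed

lemma mass_zero: "c \<le> \<mu>0 \<Longrightarrow> mass_upto mul c = 0"
  unfolding mass_upto_def by (rule sum.neutral) (use mul_zero in force)

lemma mul_discrete: "discrete_mass mul"
proof
  show "finite {\<mu>. \<mu> \<le> c \<and> 0 < mul \<mu>}" for c
  proof (cases "\<mu>0 < c")
    case True
    then show ?thesis unfolding mul_support[OF True] by (intro finite_imageI kop.finite_spec) simp
  next
    case False
    then have "{\<mu>. \<mu> \<le> c \<and> 0 < mul \<mu>} = {}" using mul_zero by force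
    then show ?thesis by (simp only: finite.emptyI)
  qed
  show "\<exists>c. n \<le> mass_upto mul c" for n
  proof -
    obtain t where t: "0 < t" "n \<le> kop.count t" using kop.count_unbounded by blast
    have "mass_upto mul (\<mu>0 + 1 / t) = kop.count t" using mass_count[of "\<mu>0 + 1 / t"] t(1) by simp
    then show ?thesis using t(2) by metis
  qed
qed

end

section \<open>Interlacing and the range of the eigenvalues on a layer\<close>

section \<open>Comparison with the Dirichlet condition\<close>


context sturm_liouville
begin

text \<open>The two resolvents can be compared only at the same \<mu>0. The constant C comes from L
  and \<mu>0 from C; on the Dirichlet subspace the boundary form is 0, so these constants serve
  there as well.\<close>

lemma sl_operator_pair:
  assumes L: "L \<in> Lag"
  obtains C p \<mu>0 where "sl_operator T P Q R L C p \<mu>0" "sl_operator T P Q R Dirichlet C p \<mu>0"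
proof -
  obtain p where p: "0 < p" "\<forall>C\<ge>0. \<exists>\<mu>0. \<forall>\<mu>\<le>\<mu>0. \<forall>f x. solves \<mu> f x \<longrightarrow>
    C * ((norm (x 0))\<^sup>2 + (norm (x T))\<^sup>2) + p * integral {0..T} (\<lambda>t. (norm (xdot T x t))\<^sup>2)
      + integral {0..T} (\<lambda>t. (norm (x t))\<^sup>2) \<le> Re (energy \<mu> x x)"
    using energy_coercive by blast
  obtain C where C: "0 \<le> C"
    "\<forall>w\<in>L. Re (bdry_form w w) \<le> C * ((norm (vsnd (vfst w)))\<^sup>2 + (norm (vsnd (vsnd w)))\<^sup>2)"
    using Lag_bdry_form_bound[OF L] by blast
  obtain \<mu>0 where mu: "\<forall>\<mu>\<le>\<mu>0. \<forall>f x. solves \<mu> f x \<longrightarrow>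
    C * ((norm (x 0))\<^sup>2 + (norm (x T))\<^sup>2) + p * integral {0..T} (\<lambda>t. (norm (xdot T x t))\<^sup>2)
      + integral {0..T} (\<lambda>t. (norm (x t))\<^sup>2) \<le> Re (energy \<mu> x x)"
    using p(2) C(1) by blast
  have "sl_operator T P Q R L C p \<mu>0"
    by unfold_locales (use L p(1) C(2) mu in blast)+
  moreover have "sl_operator T P Q R Dirichlet C p \<mu>0"
  proof unfold_locales
    show "Re (bdry_form w w) \<le> C * ((norm (vsnd (vfst w)))\<^sup>2 + (norm (vsnd (vsnd w)))\<^sup>2)"
      if "w \<in> Dirichlet" for w
      using that by (simp add: Dirichlet_def bdry_form_def herm_simps)
  qed (use Dirichlet_Lag p(1) mu in blast)+
  ultimately show ?thesis by (rule that)
qed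

lemma multiplicity_discrete: "L \<in> Lag \<Longrightarrow> discrete_mass (multiplicity_at T P Q R L)"
  by (rule sl_operator_pair) (auto dest: sl_operator.mul_discrete)

text \<open>The difference of the two resolvents at a value below both spectra is positive
  semidefinite and its rank is at most the codimension of \<open>L \<inter> Dirichlet\<close> in \<open>L\<close>.\<close>

theorem Dirichlet_interlacing:
  assumes L: "L \<in> Lag"
  shows "mass_upto (multiplicity_at T P Q R Dirichlet) c \<le> mass_upto (multiplicity_at T P Q R L) c"
    and "mass_upto (multiplicity_at T P Q R L) c \<le>
      mass_upto (multiplicity_at T P Q R Dirichlet) c + (2 * CARD('n) - vec.dim (L \<inter> Dirichlet))"
proof -
  obtain C p \<mu>0 where op: "sl_operator T P Q R L C p \<mu>0" "sl_operator T P Q R Dirichlet C p \<mu>0"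
    by (rule sl_operator_pair[OF L])
  interpret l: sl_operator T P Q R L C p \<mu>0 by (rule op(1))
  interpret d: sl_operator T P Q R Dirichlet C p \<mu>0 by (rule op(2))
  have "mass_upto d.mul c \<le> mass_upto l.mul c \<and>
      mass_upto l.mul c \<le> mass_upto d.mul c + (2 * CARD('n) - vec.dim (L \<inter> Dirichlet))"
  proof (cases "\<mu>0 < c")
    case False
    then show ?thesis by (simp add: d.mass_zero l.mass_zero)
  next
    case True
    define t where "t = 1 / (c - \<mu>0)"
    have t: "0 < t" using True by (simp add: t_def)
    have compare: "Re (ip (d.Kop f) f) \<le> Re (ip (l.Kop f) f)" if f: "f \<in> HC" for f
    proof -
      \<comment> \<open>w solves the homogeneous equation, and since u vanishes at both ends, w has
        the same end point values as x.\<close>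
      define x u w where "x = l.Kop f" and "u = d.Kop f" and "w = l.Kop f - d.Kop f"
      have x: "solves \<mu>0 f x" "bd x \<in> L" and u: "solves \<mu>0 f u" "bd u \<in> Dirichlet"
        unfolding x_def u_def using l.Kop d.Kop f by auto
      have w: "solves \<mu>0 (\<lambda>_. 0) w" "bd w = bd x - bd u"
        using solves_minus[OF x(1) u(1)] by (simp_all add: x_def u_def w_def)
      have xw: "vsnd (vfst (bd w)) = vsnd (vfst (bd x))" "vsnd (vsnd (bd w)) = vsnd (vsnd (bd x))"
        using u(2) by (simp_all add: w(2) vfst_vsnd_linear Dirichlet_def)
      have "bdry_form (bd x) (bd w) = energy \<mu>0 x w - ip f w" by (rule Green[OF x(1) w(1) d.HC_cont[OF f]])
      moreover have "bdry_form (bd w) (bd x) = energy \<mu>0 w x"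
        using Green[OF w(1) x(1)] by (simp add: ip_zero_left)
      moreover have "bdry_form (bd w) (bd w) = energy \<mu>0 w w"
        using Green[OF w(1) w(1)] by (simp add: ip_zero_left)
      \<comment> \<open>The form reads only the x-part of its second argument, where
        \<open>bd w\<close> and \<open>bd x\<close> agree. So Re <f, w> is the energy of w minus the
        boundary form of x, and coercivity for w outweighs the latter.\<close>
      moreover have "bdry_form (bd x) (bd w) = bdry_form (bd x) (bd x)"
        "bdry_form (bd w) (bd x) = bdry_form (bd w) (bd w)"
        by (simp_all add: bdry_form_def xw)
      ultimately have "Re (ip f w) = Re (energy \<mu>0 w w) - Re (bdry_form (bd x) (bd x))"
        using energy_sym[of \<mu>0 x w] by simp
      moreover have "C * ((norm (w 0))\<^sup>2 + (norm (w T))\<^sup>2) + p * integral {0..T} (\<lambda>t. (norm (xdot T w t))\<^sup>2)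
          + integral {0..T} (\<lambda>t. (norm (w t))\<^sup>2) \<le> Re (energy \<mu>0 w w)"
        by (rule l.coercive[OF order_refl w(1)])
      moreover have "Re (bdry_form (bd x) (bd x)) \<le> C * ((norm (w 0))\<^sup>2 + (norm (w T))\<^sup>2)"
        using l.L_bound[OF x(2)] xw by (simp add: bd_parts)
      moreover have "0 \<le> p * integral {0..T} (\<lambda>t. (norm (xdot T w t))\<^sup>2)" "0 \<le> integral {0..T} (\<lambda>t. (norm (w t))\<^sup>2)"
        using l.integral_norm_sq_nonneg[OF solves_continuous(3)[OF w(1)]]
          l.integral_norm_sq_nonneg[OF solves_continuous(1)[OF w(1)]] l.p_pos by simp_all
      ultimately have "0 \<le> Re (ip f w)" by linarith
      moreover have "ip f w = ip f x - ip f u"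
        unfolding w_def x_def u_def by (rule l.kop.ip_minus(2)[OF l.Kop_HC[OF f] d.Kop_HC[OF f] f])
      ultimately show ?thesis using l.Re_ip_Kop[OF f] d.Re_ip_Kop[OF f] by (simp add: x_def u_def)
    qed
    have "d.kop.count t \<le> l.kop.count t"
    proof -
      \<comment> \<open>Dirichlet eigenvectors serve as trial vectors for the larger resolvent of
        L.\<close>
      obtain B where B: "finite B" "cfun.independent B" "card B = d.kop.count t"
        "\<And>f. f \<in> cfun.span B \<Longrightarrow> f \<in> HC \<and> t * Re (ip f f) \<le> Re (ip (d.Kop f) f)"
        by (rule d.kop.eigenbasis[OF t]) blast
      have "card B \<le> l.kop.count t"
      proof (rule l.kop.count_maximal[OF t _ B(2,1)])
        show "B \<subseteq> HC" using B(4) cfun.span_base by blast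
        show "t * Re (ip f f) \<le> Re (ip (l.Kop f) f)" if "f \<in> cfun.span B" for f
          using B(4)[OF that] compare[of f] by linarith
      qed
      then show ?thesis using B(3) by simp
    qed
    moreover have "l.kop.count t \<le> d.kop.count t + (2 * CARD('n) - vec.dim (L \<inter> Dirichlet))"
    proof -
      have sLD: "vec.subspace (L \<inter> Dirichlet)" by (rule vec.subspace_inter[OF l.L_subspace d.L_subspace])
      obtain E :: "(complex ^ (('n + 'n) + ('n + 'n))) set" and e where E: "finite E"
        "vec.dim L = vec.dim (L \<inter> Dirichlet) + card E"
        "\<And>i v w. i \<in> E \<Longrightarrow> v \<in> L \<Longrightarrow> w \<in> L \<Longrightarrow> e i (v + w) = e i v + (e i w :: complex)"
        "\<And>i a v. i \<in> E \<Longrightarrow> v \<in> L \<Longrightarrow> e i (a *s v) = a * e i v"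
        "\<And>v. v \<in> L \<Longrightarrow> \<forall>i\<in>E. e i v = 0 \<Longrightarrow> v \<in> L \<inter> Dirichlet"
        by (rule vec_relative_codimension[OF sLD l.L_subspace Int_lower1]) blast
      obtain B where B: "finite B" "cfun.independent B" "card B = l.kop.count t"
        "\<And>f. f \<in> cfun.span B \<Longrightarrow> f \<in> HC \<and> t * Re (ip f f) \<le> Re (ip (l.Kop f) f)"
        by (rule l.kop.eigenbasis[OF t]) blast
      have bdK: "bd (l.Kop (f + g)) = bd (l.Kop f) + bd (l.Kop g)"
        "bd (l.Kop (\<lambda>t. a *s f t)) = a *s bd (l.Kop f)" if "f \<in> HC" "g \<in> HC" for f g a
        using solves_add(2)[OF l.Kop(1) l.Kop(1), of f g] solves_scale(2)[OF l.Kop(1), of f a] that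
        by (simp_all add: l.Kop_add l.Kop_scale)
      \<comment> \<open>The \<open>card E\<close> coordinate functionals on L modulo L \<inter> D,
        composed with the boundary values of \<open>l.Kop f\<close>, cut out those f whose image
        satisfies both boundary conditions. There the two resolvents coincide by uniqueness.\<close>
      have "\<exists>B'. cfun.independent B' \<and> finite B' \<and> B' \<subseteq> cfun.span B \<and> card B \<le> card B' + card E \<and>
          (\<forall>i\<in>E. \<forall>f\<in>B'. e i (bd (l.Kop f)) = 0)"
      proof (rule cfun.independent_kernel[OF E(1) B(2,1)])
        fix i f g a assume i: "i \<in> E"
        show "e i (bd (l.Kop (f + g))) = e i (bd (l.Kop f)) + e i (bd (l.Kop g))"
          if "f \<in> cfun.span B" "g \<in> cfun.span B"
          using B(4)[OF that(1)] B(4)[OF that(2)] by (simp add: bdK E(3)[OF i] l.Kop(2))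
        show "e i (bd (l.Kop (\<lambda>t. a *s f t))) = a * e i (bd (l.Kop f))" if "f \<in> cfun.span B"
          using B(4)[OF that] by (simp add: bdK[where g = f] E(4)[OF i] l.Kop(2))
      qed
      then obtain B' where B': "cfun.independent B'" "finite B'" "B' \<subseteq> cfun.span B" "card B \<le> card B' + card E"
        "\<forall>i\<in>E. \<forall>f\<in>B'. e i (bd (l.Kop f)) = 0" by blast
      have HB': "B' \<subseteq> HC" using B'(3) B(4) by blast
      have inD: "bd (l.Kop f) \<in> L \<inter> Dirichlet" if "f \<in> cfun.span B'" for f
      proof -
        have "f \<in> HC \<and> bd (l.Kop f) \<in> L \<inter> Dirichlet"
          using that
        proof (induction rule: cfun.span_induct_alt)
          case base
          have "bd (l.Kop 0) = 0" using l.kop.K0 bd_zero by simp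
          then show ?case
            using l.kop.H_closed(1) vec.subspace_0[OF sLD] by (simp add: zero_fun_def)
        next
          case (step a f g)
          have f: "f \<in> HC" "bd (l.Kop f) \<in> L \<inter> Dirichlet"
            using step(1) HB' B'(5) E(5)[OF l.Kop(2)] by auto
          then have "(\<lambda>t. a *s f t) + g \<in> HC \<and> bd (l.Kop ((\<lambda>t. a *s f t) + g)) \<in> L \<inter> Dirichlet"
            using step(2) l.kop.H_closed(2)[OF l.kop.H_closed(3)[OF f(1), of a], of g]
              vec.subspace_add[OF sLD vec.subspace_scale[OF sLD f(2), of a], of "bd (l.Kop g)"]
            by (simp add: bdK l.kop.H_closed(3)[OF f(1)] bdK(2)[OF f(1) f(1)])
          then show ?case by (simp add: plus_fun_def)
        qed
        then show ?thesis by simp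
      qed
      have "card B' \<le> d.kop.count t"
      proof (rule d.kop.count_maximal[OF t HB' B'(1,2)])
        fix f assume f: "f \<in> cfun.span B'"
        have "f \<in> cfun.span B" using f cfun.span_minimal[OF B'(3) cfun.subspace_span] by blast
        then have fH: "f \<in> HC" "t * Re (ip f f) \<le> Re (ip (l.Kop f) f)" using B(4) by auto
        have "d.Kop f = l.Kop f" using d.Kop_eq[OF l.Kop(1)[OF fH(1)]] inD[OF f] by simp
        then show "t * Re (ip f f) \<le> Re (ip (d.Kop f) f)" using fH(2) by simp
      qed
      then show ?thesis using B'(4) B(3) E(2) l.L_dim by linarith
    qed
    ultimately show ?thesis by (simp add: l.mass_count[OF True] d.mass_count[OF True] flip: t_def)
  qed
  then show "mass_upto d.mul c \<le> mass_upto l.mul c"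
    "mass_upto l.mul c \<le> mass_upto d.mul c + (2 * CARD('n) - vec.dim (L \<inter> Dirichlet))" by auto
qed

lemma eigval_eq:
  "eigval T P Q R j L = (THE l. enumerates (multiplicity_at T P Q R L) l) (j - 1)"
  by (simp add: eigval_def enumerates_eigvals_def enumerates_def)

text \<open>\<open>eigval\<close> depends on L only through its multiplicity function, so the family
  handed to \<open>interlacing_range\<close> is the set of multiplicity functions of the
  layer.\<close>

theorem eigval_layer:
  assumes r: "CARD('n) \<le> r" "r \<le> 2 * CARD('n)"
  shows "eigval T P Q R j ` layer r = {c. c \<le> eigval T P Q R j Dirichlet \<and>
    (2 * CARD('n) - r \<le> j - 1 \<longrightarrow> eigval T P Q R (j - (2 * CARD('n) - r)) Dirichlet \<le> c)}"
proof -
  define m where "m = multiplicity_at T P Q R"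
  define d where "d = 2 * CARD('n) - r"
  have LagI: "L \<in> Lag" "vec.dim (L \<inter> Dirichlet) = r" if "L \<in> layer r" for L :: "(complex ^ (('n + 'n) + ('n + 'n))) set"
    using that by (auto simp: layer_def)
  have dm: "discrete_mass (m L)" if "L \<in> Lag" for L
    unfolding m_def using that by (rule multiplicity_discrete)
  have "(\<lambda>m. (THE l. enumerates m l) (j - 1)) ` (m ` layer r) =
      {c. c \<le> (THE l. enumerates (m Dirichlet) l) (j - 1) \<and>
        (d \<le> j - 1 \<longrightarrow> (THE l. enumerates (m Dirichlet) l) (j - 1 - d) \<le> c)}"
  proof (rule interlacing_range)
    show "discrete_mass (m Dirichlet)" by (rule dm[OF Dirichlet_Lag])
    show "discrete_mass \<nu>" if "\<nu> \<in> m ` layer r" for \<nu> using that dm LagI by auto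
    show "mass_upto (m Dirichlet) c \<le> mass_upto \<nu> c \<and> mass_upto \<nu> c \<le> mass_upto (m Dirichlet) c + d"
      if nu: "\<nu> \<in> m ` layer r" for \<nu> c
    proof -
      obtain L where L: "L \<in> layer r" "\<nu> = m L" using nu by blast
      show ?thesis
        using Dirichlet_interlacing[OF LagI(1)[OF L(1)], of c]
        unfolding L(2) m_def d_def LagI(2)[OF L(1)] by blast
    qed
    show "\<exists>\<nu>\<in>m ` layer r. m Dirichlet c + d \<le> \<nu> c" for c
    proof -
      have "d + vec.dim (Gr c \<inter> Dirichlet) \<le> 2 * CARD('n)"
        using dim_Gr_Dirichlet[of c] r unfolding d_def by linarith
      then obtain L where L: "L \<in> Lag" "vec.dim (L \<inter> Dirichlet) + d = 2 * CARD('n)"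
        "d + vec.dim (Gr c \<inter> Dirichlet) \<le> vec.dim (Gr c \<inter> L)"
        by (rule Lag_with_large_intersection[OF Gr_Lag Dirichlet_Lag])
      have "L \<in> layer r" using L(1,2) r unfolding layer_def d_def by simp
      moreover have "vec.subspace (Dirichlet :: (complex ^ (('n + 'n) + ('n + 'n))) set)" "vec.subspace L"
        using Dirichlet_Lag L(1) by (auto simp: Lag_def)
      then have "m Dirichlet c + d \<le> m L c"
        using L(3) unfolding m_def by (simp add: multiplicity_eq)
      ultimately show ?thesis by blast
    qed
    show "(THE l. enumerates (m Dirichlet) l) k \<le> c \<longleftrightarrow> k < mass_upto (m Dirichlet) c" for k c
      by (rule discrete_mass.the_enumeration(2)[OF dm[OF Dirichlet_Lag]])
    show "(THE l. enumerates \<nu> l) k \<le> c \<longleftrightarrow> k < mass_upto \<nu> c" if "\<nu> \<in> m ` layer r" for \<nu> k c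
    proof -
      have "discrete_mass \<nu>" using that dm LagI by auto
      then show ?thesis by (rule discrete_mass.the_enumeration(2))
    qed
  qed
  \<comment> \<open>The shift from j to j - 1 and the shift by d commute even for truncated
    subtraction.\<close>
  moreover have "j - d - 1 = j - 1 - d" by simp
  ultimately show ?thesis
    unfolding eigval_eq d_def[symmetric] image_image m_def by (simp only:)
qed

end

theorem corollary1p5:
  fixes T :: real and P Q R :: "real \<Rightarrow> real ^ 'n ^ 'n" and r :: nat
  assumes "T > 0"
    and "H1 T P" and "H1 T Q" and "continuous_on {0..T} R"
    and "\<And>t. t \<in> {0..T} \<Longrightarrow> transpose (P t) = P t"
    and "\<And>t. t \<in> {0..T} \<Longrightarrow> transpose (R t) = R t"
    and "\<And>t v. t \<in> {0..T} \<Longrightarrow> v \<noteq> 0 \<Longrightarrow> v \<bullet> (P t *v v) > 0"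
    and "CARD('n) \<le> r" and "r \<le> 2 * CARD('n)"
  shows "(\<forall>j. 1 \<le> j \<and> j \<le> 2 * CARD('n) - r \<longrightarrow>
            eigval T P Q R j ` layer r = {..eigval T P Q R j Dirichlet}) \<and>
         (\<forall>j. j > 2 * CARD('n) - r \<longrightarrow>
            eigval T P Q R j ` layer r =
              {eigval T P Q R (j - (2 * CARD('n) - r)) Dirichlet .. eigval T P Q R j Dirichlet})"
proof -
  interpret sturm_liouville T P Q R using assms(1-7) by unfold_locales
  \<comment> \<open>For j \<ge> 1 the guard d \<le> j - 1 means j > d, which separates the two
    cases.\<close>
  show ?thesis
    unfolding eigval_layer[OF assms(8,9)] by auto
qed

end
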